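(* Let $A=KQ/I$ be a locally gentle algebra with $d_A>0$ and let $k$ be a positive integer. Let $A^{(k)\prime}$ be the algebra of upper triangular $k\times k$ matrices $[x_{ij}]$ with $x_{ii}\in A$, $x_{ij}\in V(A)$ for $i<j$ and $x_{ij}=0$ for $i>j$, with product $[x_{ij}][y_{ij}]=[z_{ij}]$ given by $$z_{ii}=x_{ii}y_{ii},\qquad z_{ij}=\eta_A(x_{ii})y_{ij}+\Big(\sum_{i<m<j}x_{im}y_{mj}\Big)+x_{ij}\eta_A(y_{jj})\ \ (i<j),\qquad z_{ij}=0\ \ (i>j).$$ Then there is an isomorphism of $K$-algebras $\psi:A^{(k)}\xrightarrow{\cong}A^{(k)\prime}$.
   Context: $K$ is an algebraically closed field. A quiver $Q=(Q_0,Q_1,s,t)$ is finite. Paths are composed from left to right: $\alpha_1\cdots\alpha_l$ (arrows $\alpha_i$, $l\ge1$) is a path of length $l$ if $t(\alpha_i)=s(\alpha_{i+1})$; $e_a$ is the path of length $0$ at $a$. A bound quiver $(Q,I)$, and the algebra $A=KQ/I$, is locally gentle if $I$ is an ideal of $KQ$ generated by a set of paths of length $2$, every vertex $a$ has in-degree $d_{\rm in}(a)\le 2$ and out-degree $d_{\rm out}(a)\le 2$, and for every arrow $\alpha$ there is at most one arrow $\beta$ with $t(\beta)=s(\alpha)$, $\beta\alpha\in I$; at most one with $t(\beta)=s(\alpha)$, $\beta\alpha\notin I$; at most one with $s(\beta)=t(\alpha)$, $\alpha\beta\in I$; at most one with $s(\beta)=t(\alpha)$, $\alpha\beta\notin I$.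 Standing assumptions: $Q$ is connected and $Q_1\neq\emptyset$. A path in $A$ is a path of $Q$ not in $I$. $\mathfrak M_A$ is the set of maximal paths: paths $\rho$ of positive length in $A$ such that neither $\alpha\rho$ nor $\rho\alpha$ is a path in $A$ for any arrow $\alpha$. $\mathfrak T_A\subseteq Q_0$ is the set of vertices $a$ with $d_{\rm in}(a)\le1$, $d_{\rm out}(a)\le1$ and $\beta\gamma\notin I$ for all arrows $\beta,\gamma$ with $t(\beta)=s(\gamma)=a$. $V(A)$ and $\eta_A$: for $\rho=\alpha_1\cdots\alpha_l\in\mathfrak M_A$ with $s(\alpha_u)=a_{u-1}$, $t(\alpha_u)=a_u$, let $\mathcal M_\rho=M_{l+1}(K)$ with matrix units $\rho_{u,v}$ ($0\le u,v\le l$), and let $\eta_A^\rho:A\to\mathcal M_\rho$ be the $K$-algebra map with $\eta_A^\rho(e_a)=\sum_{u:\,a_u=a}\rho_{u,u}$ and, for a path $\theta$ of positive length in $A$, $\eta_A^\rho(\theta)=\rho_{u-1,v}$ if $\theta=\alpha_u\cdots\alpha_v$ for some $1\le u\le v\le l$ and $0$ otherwise. For $a\in\mathfrak T_A$ let $K\mathfrak e_a$ be the one-dimensional algebra with identity $\mathfrak e_a$ and $\eta_A^a:A\to K\mathfrak e_a$ the algebra map with $e_a\mapsto\mathfrak e_a$ and all other paths $\mapsto0$. $V(A)=\prod_{\rho\in\mathfrak M_A}\mathcal M_\rho\times\prod_{a\in\mathfrak T_A}K\mathfrak e_a$ and $\eta_A:A\to V(A)$ is the algebra map with these components. Blossoming: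 $(Q^{\rm bl},I^{\rm bl})$ is obtained by adding, for each $v\in Q_0$, $2-d_{\rm in}(v)$ incoming arrows from new pairwise distinct vertices and $2-d_{\rm out}(v)$ outgoing arrows to new pairwise distinct vertices, and adding length-two relations so that the result is locally gentle and $\alpha\beta\in I\Leftrightarrow\alpha\beta\in I^{\rm bl}$ for $\alpha,\beta\in Q_1$ (unique up to isomorphism). Put $d=d_A=2|Q_0|-|Q_1|$. The new vertices are $d$ sources $s_1,\dots,s_d$ and $d$ sinks $t_1,\dots,t_d$; $\sigma_p$ is the unique arrow starting at $s_p$, $\tau_p$ the unique arrow ending at $t_p$; the labeling is chosen so that for each $p$ there is a maximal path from $s_p$ to $t_p$ in $KQ^{\rm bl}/I^{\rm bl}$. Finite gentle repetition: $A^{(k)}=KQ^{(k)}/I^{(k)}$, where $Q^{(k)}$ has vertices $a^{[i]}$ ($a\in Q_0$, $1\le i\le k$), arrows $\alpha^{[i]}:s(\alpha)^{[i]}\to t(\alpha)^{[i]}$ ($\alpha\in Q_1$, $1\le i\le k$), and $\varpi_p^{[i]}: s(\tau_p)^{[i]}\to t(\sigma_p)^{[i+1]}$ ($1\le p\le d$, $1\le i<k$); $I^{(k)}$ is generated by the $\alpha^{[i]}\beta^{[i]}$ with $\alpha\beta\in I$, the $\alpha^{[i]}\varpi_p^{[i]}$ with $\alpha\tau_p\in I^{\rm bl}$, the $\varpi_p^{[i]}\beta^{[i+1]}$ with $\sigma_p\beta\in I^{\rm bl}$, and the $\varpi_p^{[i]}\varpi_{p'}^{[i+1]}$ with $\sigma_p\tau_{p'}\in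 I^{\rm bl}$ (composable arrows, $\alpha,\beta\in Q_1$). *)

theory Defs
  imports
    "HOL-Library.Poly_Mapping"
    "HOL-Library.FuncSet"
    "HOL-Computational_Algebra.Polynomial"
    "HOL-Algebra.QuotRing"
    "HOL-Algebra.Module"
    "Jordan_Normal_Form.Matrix"
    "Graph_Theory.Digraph_Component"
begin

text \<open>
  A quiver is a \<^locale>\<open>fin_digraph\<close>: loops and parallel arrows are allowed, the source of an arrow
  is its \<^const>\<open>tail\<close> and its target is its \<^const>\<open>head\<close>.
  A \<open>K\<close>-algebra is a \<^typ>\<open>('k, 'x) module\<close> record (a ring record together with a scalar
  multiplication).
\<close>

section \<open>Paths and path algebras\<close>

text \<open>
  The path \<open>\<alpha>\<^sub>1\<cdots>\<alpha>\<^sub>l\<close> is the pair of its source and the list of its arrows;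
  the trivial path at \<open>a\<close> is \<open>(a, [])\<close>.
\<close>

type_synonym ('v, 'a) path = "'v \<times> 'a list"

definition quiver_paths :: "('v, 'a) pre_digraph \<Rightarrow> ('v, 'a) path set" where
  "quiver_paths Q = {(a, as). \<exists>b. pre_digraph.awalk Q a as b}"

definition path_vertices :: "('v, 'a) pre_digraph \<Rightarrow> ('v, 'a) path \<Rightarrow> 'v list" where
  "path_vertices Q \<theta> = pre_digraph.awalk_verts Q (fst \<theta>) (snd \<theta>)"

definition path_target :: "('v, 'a) pre_digraph \<Rightarrow> ('v, 'a) path \<Rightarrow> 'v" where
  "path_target Q \<theta> = last (path_vertices Q \<theta>)"

abbreviation path_length :: "('v, 'a) path \<Rightarrow> nat" where
  "path_length \<theta> \<equiv> length (snd \<theta>)"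

abbreviation basis_elt :: "('v, 'a) path \<Rightarrow> ('v, 'a) path \<Rightarrow>\<^sub>0 'k::field" where
  "basis_elt \<theta> \<equiv> Poly_Mapping.single \<theta> 1"

definition path_algebra ::
  "('v, 'a) pre_digraph \<Rightarrow> ('k::field, ('v, 'a) path \<Rightarrow>\<^sub>0 'k) module" where
  "path_algebra Q =
    \<lparr> carrier = {f. Poly_Mapping.keys f \<subseteq> quiver_paths Q},
      mult = (\<lambda>f g. \<Sum>\<theta> \<in> Poly_Mapping.keys f. \<Sum>\<theta>' \<in> Poly_Mapping.keys g.
        if path_target Q \<theta> = fst \<theta>'
        then Poly_Mapping.single (fst \<theta>, snd \<theta> @ snd \<theta>')
               (Poly_Mapping.lookup f \<theta> * Poly_Mapping.lookup g \<theta>')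
        else 0),
      one = (\<Sum>a \<in> verts Q. basis_elt (a, [])),
      zero = 0,
      add = (+),
      smult = (\<lambda>c. Poly_Mapping.map ((*) c)) \<rparr>"

section \<open>Algebra constructions\<close>

definition quotient_algebra :: "('k, 'x) module \<Rightarrow> 'x set \<Rightarrow> ('k, 'x set) module" where
  "quotient_algebra R I =
    \<lparr> carrier = carrier (R Quot I), mult = mult (R Quot I), one = one (R Quot I),
      zero = zero (R Quot I), add = add (R Quot I),
      smult = (\<lambda>c X. \<Union>x\<in>X. I +>\<^bsub>R\<^esub> (c \<odot>\<^bsub>R\<^esub> x)) \<rparr>"

definition field_algebra :: "('k::field, 'k) module" where
  "field_algebra =
    \<lparr> carrier = UNIV, mult = (*), one = 1, zero = 0, add = (+), smult = (*) \<rparr>"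

definition family_product :: "'i set \<Rightarrow> ('i \<Rightarrow> ('k, 'x) module) \<Rightarrow> ('k, 'i \<Rightarrow> 'x) module" where
  "family_product J R =
    \<lparr> carrier = (\<Pi>\<^sub>E j\<in>J. carrier (R j)),
      mult = (\<lambda>x y. \<lambda>j\<in>J. x j \<otimes>\<^bsub>R j\<^esub> y j),
      one = (\<lambda>j\<in>J. \<one>\<^bsub>R j\<^esub>),
      zero = (\<lambda>j\<in>J. \<zero>\<^bsub>R j\<^esub>),
      add = (\<lambda>x y. \<lambda>j\<in>J. x j \<oplus>\<^bsub>R j\<^esub> y j),
      smult = (\<lambda>c x. \<lambda>j\<in>J. c \<odot>\<^bsub>R j\<^esub> x j) \<rparr>"

definition binary_product :: "('k, 'x) module \<Rightarrow> ('k, 'y) module \<Rightarrow> ('k, 'x \<times> 'y) module" where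
  "binary_product R S =
    \<lparr> carrier = carrier R \<times> carrier S,
      mult = (\<lambda>(x, y) (x', y'). (x \<otimes>\<^bsub>R\<^esub> x', y \<otimes>\<^bsub>S\<^esub> y')),
      one = (\<one>\<^bsub>R\<^esub>, \<one>\<^bsub>S\<^esub>),
      zero = (\<zero>\<^bsub>R\<^esub>, \<zero>\<^bsub>S\<^esub>),
      add = (\<lambda>(x, y) (x', y'). (x \<oplus>\<^bsub>R\<^esub> x', y \<oplus>\<^bsub>S\<^esub> y')),
      smult = (\<lambda>c (x, y). (c \<odot>\<^bsub>R\<^esub> x, c \<odot>\<^bsub>S\<^esub> y)) \<rparr>"

definition algebra_iso :: "('k, 'x) module \<Rightarrow> ('k, 'y) module \<Rightarrow> ('x \<Rightarrow> 'y) set" where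
  "algebra_iso R S =
    {\<psi> \<in> ring_iso R S. \<forall>c. \<forall>x \<in> carrier R. \<psi> (c \<odot>\<^bsub>R\<^esub> x) = c \<odot>\<^bsub>S\<^esub> \<psi> x}"

section \<open>Locally gentle algebras\<close>

definition length_two_in ::
  "('v, 'a) pre_digraph \<Rightarrow> (('v, 'a) path \<Rightarrow>\<^sub>0 'k::field) set \<Rightarrow> 'a \<Rightarrow> 'a \<Rightarrow> bool" where
  "length_two_in Q I \<alpha> \<beta> \<longleftrightarrow> head Q \<alpha> = tail Q \<beta> \<and> basis_elt (tail Q \<alpha>, [\<alpha>, \<beta>]) \<in> I"

definition length_two_notin ::
  "('v, 'a) pre_digraph \<Rightarrow> (('v, 'a) path \<Rightarrow>\<^sub>0 'k::field) set \<Rightarrow> 'a \<Rightarrow> 'a \<Rightarrow> bool" where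
  "length_two_notin Q I \<alpha> \<beta> \<longleftrightarrow> head Q \<alpha> = tail Q \<beta> \<and> basis_elt (tail Q \<alpha>, [\<alpha>, \<beta>]) \<notin> I"

definition locally_gentle ::
  "('v, 'a) pre_digraph \<Rightarrow> (('v, 'a) path \<Rightarrow>\<^sub>0 'k::field) set \<Rightarrow> bool" where
  "locally_gentle Q I \<longleftrightarrow>
    fin_digraph Q \<and>
    (\<exists>R \<subseteq> {\<theta> \<in> quiver_paths Q. path_length \<theta> = 2}. I = Idl\<^bsub>path_algebra Q\<^esub> (basis_elt ` R)) \<and>
    (\<forall>a \<in> verts Q. in_degree Q a \<le> 2 \<and> out_degree Q a \<le> 2) \<and>
    (\<forall>\<alpha> \<in> arcs Q.
      (\<exists>\<^sub>\<le>\<^sub>1\<beta>. \<beta> \<in> arcs Q \<and> length_two_in Q I \<beta> \<alpha>) \<and>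
      (\<exists>\<^sub>\<le>\<^sub>1\<beta>. \<beta> \<in> arcs Q \<and> length_two_notin Q I \<beta> \<alpha>) \<and>
      (\<exists>\<^sub>\<le>\<^sub>1\<beta>. \<beta> \<in> arcs Q \<and> length_two_in Q I \<alpha> \<beta>) \<and>
      (\<exists>\<^sub>\<le>\<^sub>1\<beta>. \<beta> \<in> arcs Q \<and> length_two_notin Q I \<alpha> \<beta>))"

definition paths_in_algebra ::
  "('v, 'a) pre_digraph \<Rightarrow> (('v, 'a) path \<Rightarrow>\<^sub>0 'k::field) set \<Rightarrow> ('v, 'a) path set" where
  "paths_in_algebra Q I = {\<theta> \<in> quiver_paths Q. basis_elt \<theta> \<notin> I}"

definition maximal_paths ::
  "('v, 'a) pre_digraph \<Rightarrow> (('v, 'a) path \<Rightarrow>\<^sub>0 'k::field) set \<Rightarrow> ('v, 'a) path set" where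
  "maximal_paths Q I =
    {\<rho> \<in> paths_in_algebra Q I. path_length \<rho> > 0 \<and>
      (\<forall>\<alpha> \<in> arcs Q.
        \<not> (head Q \<alpha> = fst \<rho> \<and> (tail Q \<alpha>, \<alpha> # snd \<rho>) \<in> paths_in_algebra Q I) \<and>
        \<not> (path_target Q \<rho> = tail Q \<alpha> \<and> (fst \<rho>, snd \<rho> @ [\<alpha>]) \<in> paths_in_algebra Q I))}"

definition trivial_vertices ::
  "('v, 'a) pre_digraph \<Rightarrow> (('v, 'a) path \<Rightarrow>\<^sub>0 'k::field) set \<Rightarrow> 'v set" where
  "trivial_vertices Q I =
    {a \<in> verts Q. in_degree Q a \<le> 1 \<and> out_degree Q a \<le> 1 \<and>
      (\<forall>\<beta> \<in> arcs Q. \<forall>\<gamma> \<in> arcs Q. head Q \<beta> = a \<and> tail Q \<gamma> = a \<longrightarrow> length_two_notin Q I \<beta> \<gamma>)}"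

section \<open>The algebra \<open>V(A)\<close> and the map \<open>\<eta>\<^sub>A\<close>\<close>

type_synonym ('v, 'a, 'k) V_elt = "(('v, 'a) path \<Rightarrow> 'k mat) \<times> ('v \<Rightarrow> 'k)"

definition V_algebra ::
  "('v, 'a) pre_digraph \<Rightarrow> (('v, 'a) path \<Rightarrow>\<^sub>0 'k::field) set \<Rightarrow> ('k, ('v, 'a, 'k) V_elt) module" where
  "V_algebra Q I =
    binary_product
      (family_product (maximal_paths Q I)
        (\<lambda>\<rho>. module_mat TYPE('k) (path_length \<rho> + 1) (path_length \<rho> + 1)))
      (family_product (trivial_vertices Q I) (\<lambda>a. field_algebra))"

text \<open>
  The image of a path \<open>\<theta>\<close> of \<open>Q\<close> in \<open>M\<^bsub>l+1\<^esub>(K)\<close>, entry by entry, for \<open>\<rho> = \<alpha>\<^sub>1\<cdots>\<alpha>\<^sub>l\<close>.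
  If \<open>\<theta>\<close> is trivial at \<open>a\<close>, the entries equal to \<open>1\<close> are those at \<open>(u, u)\<close> with \<open>a\<^sub>u = a\<close>.
  If \<open>\<theta>\<close> has positive length, the entry at \<open>(u - 1, v)\<close> is \<open>1\<close> when \<open>1 \<le> u \<le> v \<le> l\<close> and
  \<open>\<theta> = \<alpha>\<^sub>u\<cdots>\<alpha>\<^sub>v\<close>; since the arrows of a maximal path of a locally gentle algebra are pairwise
  distinct, there is at most one such pair \<open>(u, v)\<close>, so this is a single matrix unit or \<open>0\<close>.
\<close>

definition eta_path ::
  "('v, 'a) pre_digraph \<Rightarrow> ('v, 'a) path \<Rightarrow> ('v, 'a) path \<Rightarrow> 'k::field mat" where
  "eta_path Q \<rho> \<theta> =
    mat (path_length \<rho> + 1) (path_length \<rho> + 1) (\<lambda>(x, y).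
      if snd \<theta> = [] then (if x = y \<and> path_vertices Q \<rho> ! x = fst \<theta> then 1 else 0)
      else (if \<exists>u v. 1 \<le> u \<and> u \<le> v \<and> v \<le> path_length \<rho> \<and> (x, y) = (u - 1, v) \<and>
                  snd \<theta> = map (\<lambda>w. snd \<rho> ! (w - 1)) [u..<Suc v]
            then 1 else 0))"

text \<open>
  \<open>eta_KQ\<close> is the \<open>K\<close>-linear map on \<open>KQ\<close> given by the prescribed values on paths (paths in \<open>I\<close> are
  sent to \<open>0\<close>, since no subpath of a maximal path lies in \<open>I\<close>); \<open>eta\<close> is the map it induces on
  \<open>A = KQ/I\<close>.
\<close>

definition eta_KQ ::
  "('v, 'a) pre_digraph \<Rightarrow> (('v, 'a) path \<Rightarrow>\<^sub>0 'k::field) set \<Rightarrow>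
    (('v, 'a) path \<Rightarrow>\<^sub>0 'k) \<Rightarrow> ('v, 'a, 'k) V_elt" where
  "eta_KQ Q I f =
    ((\<lambda>\<rho> \<in> maximal_paths Q I. mat (path_length \<rho> + 1) (path_length \<rho> + 1) (\<lambda>xy.
        \<Sum>\<theta> \<in> Poly_Mapping.keys f. Poly_Mapping.lookup f \<theta> * eta_path Q \<rho> \<theta> $$ xy)),
     (\<lambda>a \<in> trivial_vertices Q I.
        \<Sum>\<theta> \<in> Poly_Mapping.keys f. Poly_Mapping.lookup f \<theta> * (if \<theta> = (a, []) then 1 else 0)))"

definition eta ::
  "('v, 'a) pre_digraph \<Rightarrow> (('v, 'a) path \<Rightarrow>\<^sub>0 'k::field) set \<Rightarrow>
    (('v, 'a) path \<Rightarrow>\<^sub>0 'k) set \<Rightarrow> ('v, 'a, 'k) V_elt" where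
  "eta Q I X = the_elem (eta_KQ Q I ` X)"

section \<open>Blossoming\<close>

text \<open>Truncated subtraction is harmless: all in-degrees are at most \<open>2\<close>, so \<open>|Q\<^sub>1| \<le> 2|Q\<^sub>0|\<close>.\<close>

definition blossom_number :: "('v, 'a) pre_digraph \<Rightarrow> nat" where
  "blossom_number Q = 2 * card (verts Q) - card (arcs Q)"

datatype 'v blossom_vertex = Old_Vertex 'v | New_Source nat | New_Sink nat

datatype 'a blossom_arrow = Old_Arrow 'a | Sigma_Arrow nat | Tau_Arrow nat

text \<open>
  The arrow \<open>\<sigma>\<^sub>p\<close> runs from the new source \<open>s\<^sub>p\<close> to \<open>sg p \<in> Q\<^sub>0\<close> and \<open>\<tau>\<^sub>p\<close> runs from
  \<open>tu p \<in> Q\<^sub>0\<close> to the new sink \<open>t\<^sub>p\<close>, for \<open>1 \<le> p \<le> d\<close>.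
\<close>

definition blossom_quiver ::
  "('v, 'a) pre_digraph \<Rightarrow> (nat \<Rightarrow> 'v) \<Rightarrow> (nat \<Rightarrow> 'v) \<Rightarrow>
    ('v blossom_vertex, 'a blossom_arrow) pre_digraph" where
  "blossom_quiver Q sg tu =
    \<lparr> verts = Old_Vertex ` verts Q \<union> New_Source ` {1..blossom_number Q}
        \<union> New_Sink ` {1..blossom_number Q},
      arcs = Old_Arrow ` arcs Q \<union> Sigma_Arrow ` {1..blossom_number Q}
        \<union> Tau_Arrow ` {1..blossom_number Q},
      tail = (\<lambda>e. case e of Old_Arrow \<alpha> \<Rightarrow> Old_Vertex (tail Q \<alpha>)
        | Sigma_Arrow p \<Rightarrow> New_Source p | Tau_Arrow p \<Rightarrow> Old_Vertex (tu p)),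
      head = (\<lambda>e. case e of Old_Arrow \<alpha> \<Rightarrow> Old_Vertex (head Q \<alpha>)
        | Sigma_Arrow p \<Rightarrow> Old_Vertex (sg p) | Tau_Arrow p \<Rightarrow> New_Sink p) \<rparr>"

text \<open>
  \<open>blossoming Q I sg tu Ibl\<close>: the data describe a blossoming of \<open>(Q, I)\<close> whose new sources and
  sinks are labeled compatibly.
\<close>

definition blossoming ::
  "('v, 'a) pre_digraph \<Rightarrow> (('v, 'a) path \<Rightarrow>\<^sub>0 'k::field) set \<Rightarrow> (nat \<Rightarrow> 'v) \<Rightarrow> (nat \<Rightarrow> 'v) \<Rightarrow>
    (('v blossom_vertex, 'a blossom_arrow) path \<Rightarrow>\<^sub>0 'k) set \<Rightarrow> bool" where
  "blossoming Q I sg tu Ibl \<longleftrightarrow>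
    (\<forall>p \<in> {1..blossom_number Q}. sg p \<in> verts Q \<and> tu p \<in> verts Q) \<and>
    (\<forall>v \<in> verts Q.
      card {p \<in> {1..blossom_number Q}. sg p = v} = 2 - in_degree Q v \<and>
      card {p \<in> {1..blossom_number Q}. tu p = v} = 2 - out_degree Q v) \<and>
    locally_gentle (blossom_quiver Q sg tu) Ibl \<and>
    (\<forall>\<alpha> \<in> arcs Q. \<forall>\<beta> \<in> arcs Q.
      length_two_in Q I \<alpha> \<beta> \<longleftrightarrow>
      length_two_in (blossom_quiver Q sg tu) Ibl (Old_Arrow \<alpha>) (Old_Arrow \<beta>)) \<and>
    (\<forall>p \<in> {1..blossom_number Q}. \<exists>\<rho> \<in> maximal_paths (blossom_quiver Q sg tu) Ibl.
      fst \<rho> = New_Source p \<and> path_target (blossom_quiver Q sg tu) \<rho> = New_Sink p)"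

section \<open>The finite gentle repetition \<open>A\<^bsup>(k)\<^esup>\<close>\<close>

datatype 'a repetition_arrow = Copy 'a nat | Varpi nat nat

definition repetition_quiver ::
  "('v, 'a) pre_digraph \<Rightarrow> (nat \<Rightarrow> 'v) \<Rightarrow> (nat \<Rightarrow> 'v) \<Rightarrow> nat \<Rightarrow>
    ('v \<times> nat, 'a repetition_arrow) pre_digraph" where
  "repetition_quiver Q sg tu k =
    \<lparr> verts = verts Q \<times> {1..k},
      arcs = {Copy \<alpha> i | \<alpha> i. \<alpha> \<in> arcs Q \<and> i \<in> {1..k}} \<union>
        {Varpi p i | p i. p \<in> {1..blossom_number Q} \<and> i \<in> {1..<k}},
      tail = (\<lambda>e. case e of Copy \<alpha> i \<Rightarrow> (tail Q \<alpha>, i) | Varpi p i \<Rightarrow> (tu p, i)),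
      head = (\<lambda>e. case e of Copy \<alpha> i \<Rightarrow> (head Q \<alpha>, i) | Varpi p i \<Rightarrow> (sg p, i + 1)) \<rparr>"

definition repetition_relations ::
  "('v, 'a) pre_digraph \<Rightarrow> (('v, 'a) path \<Rightarrow>\<^sub>0 'k::field) set \<Rightarrow> (nat \<Rightarrow> 'v) \<Rightarrow> (nat \<Rightarrow> 'v) \<Rightarrow>
    (('v blossom_vertex, 'a blossom_arrow) path \<Rightarrow>\<^sub>0 'k) set \<Rightarrow> nat \<Rightarrow>
    ('v \<times> nat, 'a repetition_arrow) path set" where
  "repetition_relations Q I sg tu Ibl k =
    {((tail Q \<alpha>, i), [Copy \<alpha> i, Copy \<beta> i]) | \<alpha> \<beta> i.
      \<alpha> \<in> arcs Q \<and> \<beta> \<in> arcs Q \<and> i \<in> {1..k} \<and> length_two_in Q I \<alpha> \<beta>} \<union>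
    {((tail Q \<alpha>, i), [Copy \<alpha> i, Varpi p i]) | \<alpha> p i.
      \<alpha> \<in> arcs Q \<and> p \<in> {1..blossom_number Q} \<and> i \<in> {1..<k} \<and>
      length_two_in (blossom_quiver Q sg tu) Ibl (Old_Arrow \<alpha>) (Tau_Arrow p)} \<union>
    {((tu p, i), [Varpi p i, Copy \<beta> (i + 1)]) | p \<beta> i.
      p \<in> {1..blossom_number Q} \<and> \<beta> \<in> arcs Q \<and> i \<in> {1..<k} \<and>
      length_two_in (blossom_quiver Q sg tu) Ibl (Sigma_Arrow p) (Old_Arrow \<beta>)} \<union>
    {((tu p, i), [Varpi p i, Varpi p' (i + 1)]) | p p' i.
      p \<in> {1..blossom_number Q} \<and> p' \<in> {1..blossom_number Q} \<and> 1 \<le> i \<and> i + 1 < k \<and>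
      length_two_in (blossom_quiver Q sg tu) Ibl (Sigma_Arrow p) (Tau_Arrow p')}"

definition repetition_algebra ::
  "('v, 'a) pre_digraph \<Rightarrow> (('v, 'a) path \<Rightarrow>\<^sub>0 'k::field) set \<Rightarrow> (nat \<Rightarrow> 'v) \<Rightarrow> (nat \<Rightarrow> 'v) \<Rightarrow>
    (('v blossom_vertex, 'a blossom_arrow) path \<Rightarrow>\<^sub>0 'k) set \<Rightarrow> nat \<Rightarrow>
    ('k, (('v \<times> nat, 'a repetition_arrow) path \<Rightarrow>\<^sub>0 'k) set) module" where
  "repetition_algebra Q I sg tu Ibl k =
    (let KQk = path_algebra (repetition_quiver Q sg tu k)
     in quotient_algebra KQk (Idl\<^bsub>KQk\<^esub> (basis_elt ` repetition_relations Q I sg tu Ibl k)))"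

section \<open>The upper triangular matrix algebra\<close>

text \<open>
  As \<open>A\<close> and \<open>V(A)\<close> are different types, an upper triangular matrix \<open>[x\<^sub>i\<^sub>j]\<close> is the pair of its
  diagonal \<open>i \<mapsto> x\<^sub>i\<^sub>i\<close> and its strictly upper triangular part \<open>(i, j) \<mapsto> x\<^sub>i\<^sub>j\<close>; the zero entries
  below the diagonal are not stored.
\<close>

definition strict_upper :: "nat \<Rightarrow> (nat \<times> nat) set" where
  "strict_upper k = {(i, j). 1 \<le> i \<and> i < j \<and> j \<le> k}"

definition triangular_algebra ::
  "('v, 'a) pre_digraph \<Rightarrow> (('v, 'a) path \<Rightarrow>\<^sub>0 'k::field) set \<Rightarrow> nat \<Rightarrow>
    ('k, (nat \<Rightarrow> (('v, 'a) path \<Rightarrow>\<^sub>0 'k) set) \<times> (nat \<times> nat \<Rightarrow> ('v, 'a, 'k) V_elt)) module" where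
  "triangular_algebra Q I k =
    (let A = quotient_algebra (path_algebra Q) I; V = V_algebra Q I;
         vec = binary_product (family_product {1..k} (\<lambda>i. A))
                              (family_product (strict_upper k) (\<lambda>ij. V))
     in \<lparr> carrier = carrier vec,
          mult = (\<lambda>(x, x') (y, y').
            (\<lambda>i\<in>{1..k}. x i \<otimes>\<^bsub>A\<^esub> y i,
             \<lambda>(i, j)\<in>strict_upper k.
               eta Q I (x i) \<otimes>\<^bsub>V\<^esub> y' (i, j)
               \<oplus>\<^bsub>V\<^esub> (\<Oplus>\<^bsub>V\<^esub>m\<in>{i<..<j}. x' (i, m) \<otimes>\<^bsub>V\<^esub> y' (m, j))
               \<oplus>\<^bsub>V\<^esub> x' (i, j) \<otimes>\<^bsub>V\<^esub> eta Q I (y j))),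
          one = (\<lambda>i\<in>{1..k}. \<one>\<^bsub>A\<^esub>, \<lambda>ij\<in>strict_upper k. \<zero>\<^bsub>V\<^esub>),
          zero = zero vec,
          add = add vec,
          smult = smult vec \<rparr>)"

end

theory Submission
  imports Defs
begin

text \<open>
  An ideal generated by paths of length two is monomial: the paths outside the ideal form a basis
  of the quotient, and the coefficient of a product at such a path is the sum, over all ways to cut
  the path into two, of the products of the coefficients of the factors. The isomorphism is
  therefore found by matching a basis of \<open>A\<^bsup>(k)\<^esup>\<close> with coordinates on the triangular algebra in such a
  way that both products are given by the same sum over cuts.

  In the blossomed quiver every vertex of \<open>Q\<close> has two incoming and two outgoing arrows, and the
  gentle conditions pair them off: every arrow into an old vertex has exactly one nonzero
  continuation. So \<open>\<sigma>\<^sub>p\<close> extends in only one way, and by the choice of the labels it ends with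
  \<open>\<tau>\<^sub>p\<close>. This gives a path \<open>\<sigma>\<^sub>p \<rho>\<^sub>p \<tau>\<^sub>p\<close>, and \<open>p \<mapsto> \<rho>\<^sub>p\<close>, the core of \<open>p\<close>, is a bijection from the labels
  onto the maximal paths of \<open>A\<close> together with the trivial paths at the vertices of \<open>T\<^sub>A\<close>
  (\<open>nontrivial_core_is_maximal\<close>, \<open>trivial_core_at_trivial_vertex\<close>, \<open>maximal_path_is_core\<close>,
  \<open>trivial_vertex_has_trivial_core\<close>, \<open>core_path_inj\<close>). Connectedness enters here: at an isolated
  vertex, two labels would share one trivial core. Hence \<open>V(A)\<close> is a product of one matrix algebra
  per label, and the \<open>(x, y)\<close> entry of \<open>\<eta>\<^sub>A\<close> at \<open>p\<close> is, for \<open>x \<le> y\<close>, the coefficient at the segment of \<open>\<rho>\<^sub>p\<close> from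
  position \<open>x\<close> to position \<open>y\<close> (\<open>entry_eta\<close>).

  In the repetition, \<open>\<varpi>\<^sub>p\<close> plays the roles of \<open>\<tau>\<^sub>p\<close> and of \<open>\<sigma>\<^sub>p\<close> at once. As continuations
  are unique in both directions, a nonzero path through some \<open>\<varpi>\<^sub>p\<close> stays on the track of \<open>p\<close>, which
  is the path that runs through the copies of \<open>\<rho>\<^sub>p\<close> in all blocks, joined by the arrows \<open>\<varpi>\<^sub>p\<close>.
  So the nonzero paths are the copies of nonzero paths of \<open>A\<close> in a single block and, for
  \<open>i < j\<close>, the stretches of tracks from position \<open>x\<close> in block \<open>i\<close> to position \<open>y\<close> in block \<open>j\<close>
  (\<open>bij_betw_cell_path\<close>). The stretches correspond to the matrix units of \<open>V(A)\<close> at place \<open>(i, j)\<close>. A cut of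
  such a stretch is a position on the track, which lies in block \<open>i\<close>, in a block strictly
  between, or in block \<open>j\<close>; these three cases are the three summands in the product of
  triangular matrices (\<open>rep_coef_mult\<close>, \<open>tri_coef_mult\<close>).
\<close>

section \<open>Walks in a quiver\<close>

definition walk_target :: "('v, 'a) pre_digraph \<Rightarrow> 'v \<Rightarrow> 'a list \<Rightarrow> 'v" where
  "walk_target Q v as = (if as = [] then v else head Q (last as))"

text \<open>
  Walks whose consecutive arrows satisfy \<open>P\<close>. With composability as \<open>P\<close> these are all paths of the
  quiver; with "composable and not a relation" they are the paths of the quotient algebra.
\<close>
definition walks ::
  "('v, 'a) pre_digraph \<Rightarrow> ('a \<Rightarrow> 'a \<Rightarrow> bool) \<Rightarrow> ('v, 'a) path set" where
  "walks Q P = {(v, as). v \<in> verts Q \<and> set as \<subseteq> arcs Q \<and> (as \<noteq> [] \<longrightarrow> tail Q (hd as) = v) \<and>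
     successively P as}"

lemma path_target_eq: "path_target Q (v, as) = walk_target Q v as"
  by (simp add: path_target_def path_vertices_def walk_target_def pre_digraph.awalk_verts_conv)

lemma walk_target_Nil [simp]: "walk_target Q v [] = v"
  by (simp add: walk_target_def)

lemma walk_target_append: "walk_target Q (walk_target Q v as) bs = walk_target Q v (as @ bs)"
  by (simp add: walk_target_def)

lemma cas_iff:
  "pre_digraph.cas Q v as w \<longleftrightarrow> (as \<noteq> [] \<longrightarrow> tail Q (hd as) = v) \<and>
     successively (\<lambda>\<alpha> \<beta>. head Q \<alpha> = tail Q \<beta>) as \<and> w = walk_target Q v as"
proof (induction as arbitrary: v)
  case (Cons a as)
  have target: "walk_target Q v (a # as) = walk_target Q (head Q a) as"
    by (simp add: walk_target_def)
  have "pre_digraph.cas Q v (a # as) w \<longleftrightarrow> tail Q a = v \<and> pre_digraph.cas Q (head Q a) as w"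
    by (rule pre_digraph.cas.simps)
  then show ?case
    unfolding Cons.IH target successively_Cons by (cases as) auto
qed (auto simp: pre_digraph.cas.simps walk_target_def)

lemma quiver_paths_eq: "quiver_paths Q = walks Q (\<lambda>\<alpha> \<beta>. head Q \<alpha> = tail Q \<beta>)"
  by (auto simp: quiver_paths_def walks_def pre_digraph.awalk_def cas_iff)

lemma (in wf_digraph) walk_target_in_verts:
  "(v, as) \<in> walks G P \<Longrightarrow> walk_target G v as \<in> verts G"
  by (auto simp: walks_def walk_target_def intro!: head_in_verts)

lemma (in wf_digraph) walks_append_iff:
  assumes "\<And>\<alpha> \<beta>. P \<alpha> \<beta> \<Longrightarrow> head G \<alpha> = tail G \<beta>"
  shows "(v, as @ bs) \<in> walks G P \<longleftrightarrow> (v, as) \<in> walks G P \<and> (walk_target G v as, bs) \<in> walks G P \<and>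
    (as \<noteq> [] \<longrightarrow> bs \<noteq> [] \<longrightarrow> P (last as) (hd bs))"
  using assms by (cases "as = []"; cases "bs = []")
    (auto simp: walks_def walk_target_def successively_append_iff intro!: head_in_verts tail_in_verts)

lemma (in wf_digraph) quiver_paths_append_iff:
  "(v, as @ bs) \<in> quiver_paths G \<longleftrightarrow>
     (v, as) \<in> quiver_paths G \<and> (walk_target G v as, bs) \<in> quiver_paths G"
  unfolding quiver_paths_eq
  by (subst walks_append_iff) (auto simp: walks_def walk_target_def)

section \<open>The path algebra in coordinates\<close>

lemma carrier_path_algebra [simp]:
  "f \<in> carrier (path_algebra Q) \<longleftrightarrow> (\<forall>\<theta>. Poly_Mapping.lookup f \<theta> \<noteq> 0 \<longrightarrow> \<theta> \<in> quiver_paths Q)"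
  by (auto simp: path_algebra_def in_keys_iff)

text \<open>
  The product is defined as a sum over pairs of basis paths; only the pairs obtained by cutting
  \<open>as\<close> after \<open>n\<close> arrows contribute to the coefficient at \<open>(v, as)\<close>. The right-hand side
  may include pairs that are not in the supports, but their terms vanish.
\<close>
lemma lookup_path_mult:
  fixes f g :: "('v, 'a) path \<Rightarrow>\<^sub>0 'k::field"
  shows "Poly_Mapping.lookup (f \<otimes>\<^bsub>path_algebra Q\<^esub> g) (v, as) =
    (\<Sum>n\<le>length as. Poly_Mapping.lookup f (v, take n as) *
       Poly_Mapping.lookup g (walk_target Q v (take n as), drop n as))"
proof -
  let ?F = "\<lambda>(\<theta>, \<theta>'). Poly_Mapping.lookup f \<theta> * Poly_Mapping.lookup g \<theta>'"
  let ?c = "\<lambda>(\<theta>, \<theta>'). path_target Q \<theta> = fst \<theta>' \<and> (fst \<theta>, snd \<theta> @ snd \<theta>') = (v, as)"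
  let ?s = "\<lambda>n. ((v, take n as), (walk_target Q v (take n as), drop n as))"
  let ?K = "Poly_Mapping.keys f \<times> Poly_Mapping.keys g"
  have "Poly_Mapping.lookup (f \<otimes>\<^bsub>path_algebra Q\<^esub> g) (v, as)
     = (\<Sum>\<theta>\<in>Poly_Mapping.keys f. \<Sum>\<theta>'\<in>Poly_Mapping.keys g. if ?c (\<theta>, \<theta>') then ?F (\<theta>, \<theta>') else 0)"
    by (auto simp: path_algebra_def lookup_sum lookup_single when_def intro!: sum.cong)
  also have "\<dots> = (\<Sum>z\<in>?K. if ?c z then ?F z else 0)"
    by (subst sum.cartesian_product) (auto intro!: sum.cong)
  also have "\<dots> = (\<Sum>z\<in>{z\<in>?K. ?c z}. ?F z)"
    by (intro sum.inter_filter[symmetric]) simp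
  also have "\<dots> = (\<Sum>z\<in>?s ` {..length as}. ?F z)"
  proof (rule sum.mono_neutral_left)
    show "{z \<in> ?K. ?c z} \<subseteq> ?s ` {..length as}"
    proof
      fix z assume "z \<in> {z \<in> ?K. ?c z}"
      then obtain a xs b ys where z: "z = ((a, xs), (b, ys))" "?c z"
        by (cases z) auto
      then show "z \<in> ?s ` {..length as}"
        by (auto simp: path_target_eq intro!: image_eqI[of _ _ "length xs"])
    qed
    show "\<forall>z\<in>?s ` {..length as} - {z \<in> ?K. ?c z}. ?F z = 0"
      by (auto simp: path_target_eq in_keys_iff)
  qed simp
  also have "\<dots> = (\<Sum>n\<le>length as. ?F (?s n))"
  proof -
    have "inj_on ?s {..length as}"
    proof (rule inj_onI)
      fix m n assume "m \<in> {..length as}" "n \<in> {..length as}" "?s m = ?s n"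
      then have "length (take m as) = length (take n as)"
        by auto
      then show "m = n"
        using \<open>m \<in> _\<close> \<open>n \<in> _\<close> by simp
    qed
    then show ?thesis
      by (subst sum.reindex) auto
  qed
  finally show ?thesis
    by simp
qed

lemma lookup_path_one:
  assumes "finite (verts Q)"
  shows "Poly_Mapping.lookup (\<one>\<^bsub>path_algebra Q\<^esub> :: ('v, 'a) path \<Rightarrow>\<^sub>0 'k::field) (v, as)
    = (if as = [] \<and> v \<in> verts Q then 1 else 0)"
proof -
  have "Poly_Mapping.lookup (\<one>\<^bsub>path_algebra Q\<^esub> :: ('v, 'a) path \<Rightarrow>\<^sub>0 'k) (v, as)
     = (\<Sum>a\<in>verts Q. if a = v then (if as = [] then 1 else 0) else 0)"
    by (auto simp: path_algebra_def lookup_sum lookup_single when_def intro!: sum.cong)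
  also have "\<dots> = (if as = [] \<and> v \<in> verts Q then 1 else 0)"
    using assms by simp
  finally show ?thesis .
qed

lemma path_algebra_simps [simp]:
  "f \<oplus>\<^bsub>path_algebra Q\<^esub> g = f + g" "\<zero>\<^bsub>path_algebra Q\<^esub> = 0"
  by (simp_all add: path_algebra_def)

lemma lookup_path_smult [simp]:
  "Poly_Mapping.lookup (c \<odot>\<^bsub>path_algebra Q\<^esub> f) \<theta> = c * Poly_Mapping.lookup f \<theta>"
  by (simp add: path_algebra_def Poly_Mapping.map.rep_eq when_def)

lemma (in wf_digraph) path_mult_closed:
  assumes "f \<in> carrier (path_algebra G)" "g \<in> carrier (path_algebra G)"
  shows "f \<otimes>\<^bsub>path_algebra G\<^esub> g \<in> carrier (path_algebra G)"
proof -
  have "(v, as) \<in> quiver_paths G"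
    if nz: "Poly_Mapping.lookup (f \<otimes>\<^bsub>path_algebra G\<^esub> g) (v, as) \<noteq> 0" for v as
  proof -
    from nz obtain n where "Poly_Mapping.lookup f (v, take n as) *
       Poly_Mapping.lookup g (walk_target G v (take n as), drop n as) \<noteq> 0"
      unfolding lookup_path_mult by (meson sum.not_neutral_contains_not_neutral)
    then have "(v, take n as @ drop n as) \<in> quiver_paths G"
      using assms by (subst quiver_paths_append_iff) auto
    then show ?thesis
      by simp
  qed
  then show ?thesis
    by (subst carrier_path_algebra) auto
qed

text \<open>
  Both sides are the sum over all ways to cut a path twice; they differ in which cut is made first.
\<close>
lemma path_mult_assoc:
  fixes f g h :: "('v, 'a) path \<Rightarrow>\<^sub>0 'k::field"
  shows "(f \<otimes>\<^bsub>path_algebra Q\<^esub> g) \<otimes>\<^bsub>path_algebra Q\<^esub> h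
    = f \<otimes>\<^bsub>path_algebra Q\<^esub> (g \<otimes>\<^bsub>path_algebra Q\<^esub> h)"
proof (rule poly_mapping_eqI)
  fix \<theta> :: "('v, 'a) path"
  obtain v as where \<theta>: "\<theta> = (v, as)"
    by (cases \<theta>)
  let ?L = "length as"
  let ?t = "\<lambda>m n. (walk_target Q v (take m as), drop m (take n as))"
  let ?F = "\<lambda>m n. Poly_Mapping.lookup f (?t 0 m) * Poly_Mapping.lookup g (?t m n) *
     Poly_Mapping.lookup h (?t n ?L)"
  have "Poly_Mapping.lookup ((f \<otimes>\<^bsub>path_algebra Q\<^esub> g) \<otimes>\<^bsub>path_algebra Q\<^esub> h) (v, as)
     = (\<Sum>n\<le>?L. \<Sum>m\<le>n. ?F m n)"
    by (auto simp: lookup_path_mult sum_distrib_right min_def intro!: sum.cong)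
  also have "\<dots> = (\<Sum>n\<in>{0..?L}. \<Sum>m | m \<in> {0..?L} \<and> m \<le> n. ?F m n)"
    by (intro sum.cong) auto
  also have "\<dots> = (\<Sum>m\<in>{0..?L}. \<Sum>n | n \<in> {0..?L} \<and> m \<le> n. ?F m n)"
    by (rule sum.swap_restrict) auto
  also have "\<dots> = (\<Sum>m\<le>?L. \<Sum>r\<le>?L - m. ?F m (m + r))"
  proof (rule sum.cong)
    fix m assume "m \<in> {..?L}"
    then show "(\<Sum>n | n \<in> {0..?L} \<and> m \<le> n. ?F m n) = (\<Sum>r\<le>?L - m. ?F m (m + r))"
      by (intro sum.reindex_bij_witness[of _ "\<lambda>r. m + r" "\<lambda>n. n - m"]) auto
  qed auto
  also have "\<dots> = Poly_Mapping.lookup (f \<otimes>\<^bsub>path_algebra Q\<^esub> (g \<otimes>\<^bsub>path_algebra Q\<^esub> h)) (v, as)"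
  proof -
    have "walk_target Q v (take (m + r) as) =
        walk_target Q (walk_target Q v (take m as)) (take r (drop m as))" for m r
      by (simp add: walk_target_append take_add)
    then show ?thesis
      by (auto simp: lookup_path_mult sum_distrib_left mult.assoc drop_take add.commute intro!: sum.cong)
  qed
  finally show "Poly_Mapping.lookup ((f \<otimes>\<^bsub>path_algebra Q\<^esub> g) \<otimes>\<^bsub>path_algebra Q\<^esub> h) \<theta> =
     Poly_Mapping.lookup (f \<otimes>\<^bsub>path_algebra Q\<^esub> (g \<otimes>\<^bsub>path_algebra Q\<^esub> h)) \<theta>"
    by (simp add: \<theta>)
qed

lemma (in fin_digraph) ring_path_algebra:
  "ring (path_algebra G :: ('k::field, ('a, 'b) path \<Rightarrow>\<^sub>0 'k) module)"
proof -
  let ?A = "path_algebra G :: ('k, ('a, 'b) path \<Rightarrow>\<^sub>0 'k) module"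
  have trivial: "(v, []) \<in> quiver_paths G \<longleftrightarrow> v \<in> verts G" for v
    by (simp add: quiver_paths_eq walks_def)
  have ends: "v \<in> verts G" "walk_target G v as \<in> verts G" if "(v, as) \<in> quiver_paths G" for v as
    using that walk_target_in_verts[of v as] by (auto simp: quiver_paths_eq walks_def)
  have one: "\<one>\<^bsub>?A\<^esub> \<in> carrier ?A"
    by (subst carrier_path_algebra) (auto simp: lookup_path_one trivial)
  show ?thesis
  proof (rule ringI)
    show "abelian_group ?A"
    proof (rule abelian_groupI)
      fix x y assume "x \<in> carrier ?A" "y \<in> carrier ?A"
      then have "\<theta> \<in> quiver_paths G" if "Poly_Mapping.lookup (x + y) \<theta> \<noteq> 0" for \<theta>
        using that by (cases "Poly_Mapping.lookup x \<theta> = 0") (auto simp: lookup_add simp del: split_paired_All)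
      then show "x \<oplus>\<^bsub>?A\<^esub> y \<in> carrier ?A"
        by simp
    next
      fix x assume x: "x \<in> carrier ?A"
      then show "\<exists>y\<in>carrier ?A. y \<oplus>\<^bsub>?A\<^esub> x = \<zero>\<^bsub>?A\<^esub>"
        by (intro bexI[of _ "- x"]) auto
    qed (auto simp: lookup_add algebra_simps)
    show "Group.monoid ?A"
    proof (rule monoidI)
      fix x assume x: "x \<in> carrier ?A"
      have "Poly_Mapping.lookup (\<one>\<^bsub>?A\<^esub> \<otimes>\<^bsub>?A\<^esub> x) (v, as) = Poly_Mapping.lookup x (v, as)" for v as
      proof -
        have "Poly_Mapping.lookup (\<one>\<^bsub>?A\<^esub> \<otimes>\<^bsub>?A\<^esub> x) (v, as)
           = (\<Sum>n\<le>length as. if n = 0 then Poly_Mapping.lookup x (v, as) else 0)"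
          unfolding lookup_path_mult lookup_path_one[OF finite_verts]
          using x ends(1)[of v as] by (intro sum.cong) (auto simp del: carrier_path_algebra
              simp: carrier_path_algebra[of x])
        then show ?thesis
          by simp
      qed
      then show "\<one>\<^bsub>?A\<^esub> \<otimes>\<^bsub>?A\<^esub> x = x"
        by (intro poly_mapping_eqI) auto
      have "Poly_Mapping.lookup (x \<otimes>\<^bsub>?A\<^esub> \<one>\<^bsub>?A\<^esub>) (v, as) = Poly_Mapping.lookup x (v, as)" for v as
      proof -
        have "Poly_Mapping.lookup (x \<otimes>\<^bsub>?A\<^esub> \<one>\<^bsub>?A\<^esub>) (v, as)
           = (\<Sum>n\<le>length as. if n = length as then Poly_Mapping.lookup x (v, as) else 0)"
          unfolding lookup_path_mult lookup_path_one[OF finite_verts]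
          using x ends(2)[of v as] by (intro sum.cong) auto
        then show ?thesis
          by simp
      qed
      then show "x \<otimes>\<^bsub>?A\<^esub> \<one>\<^bsub>?A\<^esub> = x"
        by (intro poly_mapping_eqI) auto
    qed (use one in \<open>auto simp: path_mult_assoc path_mult_closed simp del: carrier_path_algebra\<close>)
    fix x y z
    show "(x \<oplus>\<^bsub>?A\<^esub> y) \<otimes>\<^bsub>?A\<^esub> z = x \<otimes>\<^bsub>?A\<^esub> z \<oplus>\<^bsub>?A\<^esub> y \<otimes>\<^bsub>?A\<^esub> z"
      by (intro poly_mapping_eqI) (auto simp: lookup_add lookup_path_mult algebra_simps sum.distrib)
    show "z \<otimes>\<^bsub>?A\<^esub> (x \<oplus>\<^bsub>?A\<^esub> y) = z \<otimes>\<^bsub>?A\<^esub> x \<oplus>\<^bsub>?A\<^esub> z \<otimes>\<^bsub>?A\<^esub> y"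
      by (intro poly_mapping_eqI) (auto simp: lookup_add lookup_path_mult algebra_simps sum.distrib)
  qed
qed

lemma path_mult_single:
  assumes "path_target Q \<theta> = fst \<theta>'"
  shows "Poly_Mapping.single \<theta> c \<otimes>\<^bsub>path_algebra Q\<^esub> Poly_Mapping.single \<theta>' d
    = Poly_Mapping.single (fst \<theta>, snd \<theta> @ snd \<theta>') (c * d)"
  using assms by (auto simp: path_algebra_def)

section \<open>Quotients by quadratic monomial ideals\<close>

lemma sum_in_path_algebra_ideal:
  assumes "ideal J (path_algebra Q)" "finite S" "\<And>s. s \<in> S \<Longrightarrow> g s \<in> J"
  shows "sum g S \<in> J"
proof -
  interpret ideal J "path_algebra Q"
    by fact
  show ?thesis
    using assms(2,3)
  proof (induction S)
    case empty
    then show ?case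
      using additive_subgroup.zero_closed[OF is_additive_subgroup] by simp
  next
    case (insert x S)
    then show ?case
      using additive_subgroup.a_closed[OF is_additive_subgroup, of "g x" "sum g S"] by simp
  qed
qed

text \<open>
  The right-hand side is an ideal because a subwalk of a walk in \<open>W\<close> is again in \<open>W\<close>, so all
  terms of the cut formula vanish. Conversely a path outside \<open>W\<close> contains a generator as a
  factor, so each monomial of an element of the right-hand side lies in the generated ideal.
\<close>
lemma (in fin_digraph) quadratic_monomial_ideal:
  fixes R :: "('a, 'b) path set"
  assumes R: "R \<subseteq> {\<theta> \<in> quiver_paths G. path_length \<theta> = 2}"
  defines "W \<equiv> walks G (\<lambda>\<alpha> \<beta>. head G \<alpha> = tail G \<beta> \<and> (tail G \<alpha>, [\<alpha>, \<beta>]) \<notin> R)"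
  shows "Idl\<^bsub>path_algebra G\<^esub> (basis_elt ` R :: (('a, 'b) path \<Rightarrow>\<^sub>0 'k::field) set) =
    {f \<in> carrier (path_algebra G). \<forall>\<theta>\<in>W. Poly_Mapping.lookup f \<theta> = 0}"
    (is "Idl\<^bsub>?A\<^esub> ?B = ?J")
proof
  interpret ring ?A
    by (rule ring_path_algebra)
  have W_append: "(v, as @ bs) \<in> W \<Longrightarrow> (v, as) \<in> W" "(v, as @ bs) \<in> W \<Longrightarrow> (walk_target G v as, bs) \<in> W" for v as bs
    unfolding W_def by (subst (asm) walks_append_iff; auto)+
  have B: "?B \<subseteq> carrier ?A"
    using R by (auto simp: lookup_single when_def)
  show "Idl\<^bsub>?A\<^esub> ?B \<subseteq> ?J"
  proof (rule genideal_minimal)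
    show "ideal ?J ?A"
    proof (rule idealI)
      show "subgroup ?J (add_monoid ?A)"
      proof (rule add.subgroupI)
        fix a assume a: "a \<in> ?J"
        then have "a \<in> carrier ?A" "- a \<in> carrier ?A"
          by auto
        then have "\<ominus>\<^bsub>?A\<^esub> a = - a"
          by (intro minus_equality) (simp_all del: carrier_path_algebra)
        then show "\<ominus>\<^bsub>?A\<^esub> a \<in> ?J"
          using a by (simp del: split_paired_All)
      next
        show "?J \<noteq> {}"
          by (auto intro!: exI[of _ 0])
      next
        fix a b assume "a \<in> ?J" "b \<in> ?J"
        then show "a \<oplus>\<^bsub>?A\<^esub> b \<in> ?J"
          using a_closed[of a b] by (simp add: lookup_add del: carrier_path_algebra)
      qed blast
    next
      fix a x assume ax: "a \<in> ?J" "x \<in> carrier ?A"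
      have "Poly_Mapping.lookup (x \<otimes>\<^bsub>?A\<^esub> a) (v, as) = 0" "Poly_Mapping.lookup (a \<otimes>\<^bsub>?A\<^esub> x) (v, as) = 0"
        if "(v, as) \<in> W" for v as
        using ax W_append[of v "take n as" "drop n as" for n] that
        by (simp_all add: lookup_path_mult)
      then show "x \<otimes>\<^bsub>?A\<^esub> a \<in> ?J" "a \<otimes>\<^bsub>?A\<^esub> x \<in> ?J"
        using ax by (auto simp del: carrier_path_algebra)
    qed (rule ring_axioms)
    have "\<theta> \<notin> W" if "\<theta> \<in> R" for \<theta>
    proof -
      from R that have "\<theta> \<in> quiver_paths G" "path_length \<theta> = 2"
        by auto
      then obtain v \<alpha> \<beta> where "\<theta> = (v, [\<alpha>, \<beta>])"
        by (cases \<theta>) (auto simp: numeral_2_eq_2 length_Suc_conv)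
      then show ?thesis
        using that by (auto simp: W_def walks_def)
    qed
    then show "?B \<subseteq> ?J"
      using B by (auto simp: lookup_single when_def simp del: carrier_path_algebra split_paired_All)
  qed
next
  interpret ring ?A
    by (rule ring_path_algebra)
  have B: "?B \<subseteq> carrier ?A"
    using R by (auto simp: lookup_single when_def)
  interpret I: ideal "Idl\<^bsub>?A\<^esub> ?B" ?A
    by (rule genideal_ideal[OF B])
  show "?J \<subseteq> Idl\<^bsub>?A\<^esub> ?B"
  proof
    fix f assume f: "f \<in> ?J"
    have "Poly_Mapping.single \<theta> (Poly_Mapping.lookup f \<theta>) \<in> Idl\<^bsub>?A\<^esub> ?B" if "\<theta> \<in> Poly_Mapping.keys f" for \<theta>
    proof -
      obtain v as where \<theta>: "\<theta> = (v, as)"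
        by (cases \<theta>)
      have path: "(v, as) \<in> quiver_paths G" and "(v, as) \<notin> W"
        using f that by (auto simp: \<theta> in_keys_iff)
      then obtain i where i: "Suc i < length as" "(tail G (as ! i), [as ! i, as ! Suc i]) \<in> R"
        by (auto simp: W_def quiver_paths_eq walks_def successively_conv_nth)
      \<comment> \<open>the generator contained in the path, with the remaining left and right factors\<close>
      let ?r = "[as ! i, as ! Suc i]"
      have as: "as = take i as @ ?r @ drop (Suc (Suc i)) as"
        using i(1) by (simp add: Cons_nth_drop_Suc)
      define w where "w = walk_target G v (take i as)"
      have paths: "(v, take i as) \<in> quiver_paths G" "(w, ?r) \<in> quiver_paths G"
        "(walk_target G w ?r, drop (Suc (Suc i)) as) \<in> quiver_paths G"
        using path unfolding w_def by (subst (asm) as, simp only: quiver_paths_append_iff)+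
      have w: "w = tail G (as ! i)"
        using paths(2) by (simp add: quiver_paths_eq walks_def)
      define c where "c = Poly_Mapping.lookup f \<theta>"
      have "Poly_Mapping.single (v, take i as) c \<otimes>\<^bsub>?A\<^esub> basis_elt (w, ?r)
          \<otimes>\<^bsub>?A\<^esub> basis_elt (walk_target G w ?r, drop (Suc (Suc i)) as) = Poly_Mapping.single (v, as) c"
        by (subst as) (simp add: path_mult_single path_target_eq w_def walk_target_append)
      moreover have r: "basis_elt (w, ?r) \<in> Idl\<^bsub>?A\<^esub> ?B"
        using genideal_self[OF B] i(2) w by auto
      moreover have s: "Poly_Mapping.single (v, take i as) c \<in> carrier ?A"
        "basis_elt (walk_target G w ?r, drop (Suc (Suc i)) as) \<in> carrier ?A"
        using paths by (auto simp: lookup_single when_def)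
      ultimately show ?thesis
        using I.I_r_closed[OF I.I_l_closed[OF r s(1)] s(2)] by (simp only: \<theta> c_def)
    qed
    then have "(\<Sum>\<theta>\<in>Poly_Mapping.keys f. Poly_Mapping.single \<theta> (Poly_Mapping.lookup f \<theta>)) \<in> Idl\<^bsub>?A\<^esub> ?B"
      by (intro sum_in_path_algebra_ideal[OF I.is_ideal]) auto
    also have "(\<Sum>\<theta>\<in>Poly_Mapping.keys f. Poly_Mapping.single \<theta> (Poly_Mapping.lookup f \<theta>)) = f"
      by (intro poly_mapping_eqI) (auto simp: lookup_sum lookup_single when_def in_keys_iff)
    finally show "f \<in> Idl\<^bsub>?A\<^esub> ?B" .
  qed
qed

lemma (in fin_digraph) quadratic_monomial_links:
  fixes R :: "('a, 'b) path set"
  assumes R: "R \<subseteq> {\<theta> \<in> quiver_paths G. path_length \<theta> = 2}"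
    and arcs: "\<alpha> \<in> arcs G" "\<beta> \<in> arcs G"
  shows "length_two_notin G (Idl\<^bsub>path_algebra G\<^esub> (basis_elt ` R :: (('a, 'b) path \<Rightarrow>\<^sub>0 'k::field) set)) \<alpha> \<beta> \<longleftrightarrow>
    head G \<alpha> = tail G \<beta> \<and> (tail G \<alpha>, [\<alpha>, \<beta>]) \<notin> R"
proof (cases "head G \<alpha> = tail G \<beta>")
  case True
  then have "(tail G \<alpha>, [\<alpha>, \<beta>]) \<in> quiver_paths G"
    using arcs by (auto simp: quiver_paths_eq walks_def)
  then show ?thesis
    unfolding length_two_notin_def quadratic_monomial_ideal[OF R]
    using True arcs by (auto simp: lookup_single when_def walks_def)
qed (simp add: length_two_notin_def)

text \<open>
  The quotient by an ideal generated by paths of length two. It is used three times: for \<open>A\<close>, for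
  its blossoming and for the gentle repetition.
\<close>
locale quadratic_monomial = fin_digraph Q for Q :: "('v, 'a) pre_digraph" +
  fixes I :: "(('v, 'a) path \<Rightarrow>\<^sub>0 'k::field) set"
  assumes quadratic: "\<exists>R \<subseteq> {\<theta> \<in> quiver_paths Q. path_length \<theta> = 2}. I = Idl\<^bsub>path_algebra Q\<^esub> (basis_elt ` R)"
begin

abbreviation "KQ \<equiv> path_algebra Q :: ('k, ('v, 'a) path \<Rightarrow>\<^sub>0 'k) module"
abbreviation "A \<equiv> quotient_algebra KQ I"
abbreviation "B \<equiv> paths_in_algebra Q I"

lemma paths_in_algebra_eq: "B = walks Q (length_two_notin Q I)"
  and ideal_eq: "I = {f \<in> carrier KQ. \<forall>\<theta>\<in>B. Poly_Mapping.lookup f \<theta> = 0}"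
  and ideal: "ideal I KQ"
proof -
  interpret ring KQ
    by (rule ring_path_algebra)
  from quadratic obtain R where R: "R \<subseteq> {\<theta> \<in> quiver_paths Q. path_length \<theta> = 2}"
    and I: "I = Idl\<^bsub>KQ\<^esub> (basis_elt ` R)"
    by blast
  let ?P = "\<lambda>\<alpha> \<beta>. head Q \<alpha> = tail Q \<beta> \<and> (tail Q \<alpha>, [\<alpha>, \<beta>]) \<notin> R"
  have eq: "I = {f \<in> carrier KQ. \<forall>\<theta>\<in>walks Q ?P. Poly_Mapping.lookup f \<theta> = 0}"
    unfolding I by (rule quadratic_monomial_ideal[OF R])
  have "basis_elt \<theta> \<in> I \<longleftrightarrow> \<theta> \<notin> walks Q ?P" if "\<theta> \<in> quiver_paths Q" for \<theta>
    using that unfolding eq by (auto simp: lookup_single when_def)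
  moreover have "walks Q ?P \<subseteq> quiver_paths Q"
    unfolding quiver_paths_eq walks_def by (auto elim: successively_mono)
  ultimately have B: "B = walks Q ?P"
    by (auto simp: paths_in_algebra_def)
  then show "I = {f \<in> carrier KQ. \<forall>\<theta>\<in>B. Poly_Mapping.lookup f \<theta> = 0}"
    using eq by simp
  have "successively ?P as \<longleftrightarrow> successively (length_two_notin Q I) as" if "set as \<subseteq> arcs Q" for as
    using that quadratic_monomial_links[OF R] unfolding I by (intro successively_cong) auto
  then show "B = walks Q (length_two_notin Q I)"
    unfolding B walks_def by auto
  have "basis_elt ` R \<subseteq> carrier KQ"
    using R by (auto simp: lookup_single when_def)
  then show "ideal I KQ"
    unfolding I by (rule genideal_ideal)
qed

lemma paths_append_iff:
  "(v, as @ bs) \<in> B \<longleftrightarrow> (v, as) \<in> B \<and> (walk_target Q v as, bs) \<in> B \<and>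
    (as \<noteq> [] \<longrightarrow> bs \<noteq> [] \<longrightarrow> length_two_notin Q I (last as) (hd bs))"
  unfolding paths_in_algebra_eq by (rule walks_append_iff) (simp add: length_two_notin_def)

lemma trivial_path_iff: "(v, []) \<in> B \<longleftrightarrow> v \<in> verts Q"
  by (simp add: paths_in_algebra_eq walks_def)

lemma path_splits:
  assumes "(v, as) \<in> B"
  shows "(v, take n as) \<in> B" "(walk_target Q v (take n as), drop n as) \<in> B"
  using assms paths_append_iff[of v "take n as" "drop n as"] by auto

lemma coset_eq_iff:
  assumes "f \<in> carrier KQ" "g \<in> carrier KQ"
  shows "I +>\<^bsub>KQ\<^esub> f = I +>\<^bsub>KQ\<^esub> g \<longleftrightarrow> (\<forall>\<theta>\<in>B. Poly_Mapping.lookup f \<theta> = Poly_Mapping.lookup g \<theta>)"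
proof -
  interpret ideal I KQ
    by (rule ideal)
  have g': "- g \<in> carrier KQ"
    using assms by auto
  then have "\<ominus>\<^bsub>KQ\<^esub> g = - g"
    using assms by (intro minus_equality) (simp_all del: carrier_path_algebra)
  then have "f \<ominus>\<^bsub>KQ\<^esub> g = f - g" "f - g \<in> carrier KQ"
    using a_closed[OF assms(1) g'] by (simp_all add: a_minus_def del: carrier_path_algebra)
  then have "f \<ominus>\<^bsub>KQ\<^esub> g \<in> I \<longleftrightarrow> (\<forall>\<theta>\<in>B. Poly_Mapping.lookup (f - g) \<theta> = 0)"
    by (subst (1) ideal_eq) (simp del: carrier_path_algebra)
  then show ?thesis
    using quotient_eq_iff_same_a_r_cos[OF ideal assms] by (simp add: lookup_minus)
qed

text \<open>
  At a path outside the ideal all representatives of a coset have the same coefficient, so the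
  choice is immaterial there; at other paths the value is meaningless.
\<close>
definition coef :: "(('v, 'a) path \<Rightarrow>\<^sub>0 'k) set \<Rightarrow> ('v, 'a) path \<Rightarrow> 'k" where
  "coef X \<theta> = Poly_Mapping.lookup (SOME f. f \<in> X) \<theta>"

lemma coset_members:
  assumes "f \<in> carrier KQ" "g \<in> I +>\<^bsub>KQ\<^esub> f"
  shows "g \<in> carrier KQ" "\<And>\<theta>. \<theta> \<in> B \<Longrightarrow> Poly_Mapping.lookup g \<theta> = Poly_Mapping.lookup f \<theta>"
proof -
  interpret ideal I KQ
    by (rule ideal)
  show g: "g \<in> carrier KQ"
    using a_r_coset_subset_G[OF a_subset assms(1)] assms(2) by blast
  have "I +>\<^bsub>KQ\<^esub> f = I +>\<^bsub>KQ\<^esub> g"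
    by (rule a_repr_independence'[OF assms(2,1)])
  then show "Poly_Mapping.lookup g \<theta> = Poly_Mapping.lookup f \<theta>" if "\<theta> \<in> B" for \<theta>
    using coset_eq_iff[OF assms(1) g] that by auto
qed

lemma coset_self: "f \<in> carrier KQ \<Longrightarrow> f \<in> I +>\<^bsub>KQ\<^esub> f"
proof -
  interpret ideal I KQ
    by (rule ideal)
  show "f \<in> carrier KQ \<Longrightarrow> f \<in> I +>\<^bsub>KQ\<^esub> f"
    by (rule a_rcos_self)
qed

lemma coef_coset:
  assumes "f \<in> carrier KQ" "\<theta> \<in> B"
  shows "coef (I +>\<^bsub>KQ\<^esub> f) \<theta> = Poly_Mapping.lookup f \<theta>"
  unfolding coef_def
  by (rule coset_members(2)[OF assms(1) someI[of "\<lambda>g. g \<in> I +>\<^bsub>KQ\<^esub> f", OF coset_self[OF assms(1)]] assms(2)])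

lemma carrier_quotient: "carrier A = {I +>\<^bsub>KQ\<^esub> f | f. f \<in> carrier KQ}"
  by (auto simp: quotient_algebra_def FactRing_def A_RCOSETS_def' simp del: carrier_path_algebra)

lemma quotient_eqI:
  assumes "X \<in> carrier A" "Y \<in> carrier A" "\<And>\<theta>. \<theta> \<in> B \<Longrightarrow> coef X \<theta> = coef Y \<theta>"
  shows "X = Y"
proof -
  obtain f g where "f \<in> carrier KQ" "X = I +>\<^bsub>KQ\<^esub> f" "g \<in> carrier KQ" "Y = I +>\<^bsub>KQ\<^esub> g"
    using assms(1,2) unfolding carrier_quotient by blast
  then show ?thesis
    using assms(3) coset_eq_iff[of f g] by (simp add: coef_coset del: carrier_path_algebra)
qed

text \<open>
  Together with \<open>quotient_eqI\<close> and \<open>finite_coef_support\<close> this says that \<open>coef\<close> identifies the quotient with the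
  finitely supported functions on the nonzero paths; the lemmas that follow describe the operations
  under this identification.
\<close>
lemma quotient_exists:
  assumes "finite {\<theta> \<in> B. \<phi> \<theta> \<noteq> 0}"
  obtains X where "X \<in> carrier A" "\<And>\<theta>. \<theta> \<in> B \<Longrightarrow> coef X \<theta> = \<phi> \<theta>"
proof -
  define f where "f = Poly_Mapping.Abs_poly_mapping (\<lambda>\<theta>. if \<theta> \<in> B then \<phi> \<theta> else 0)"
  have "Poly_Mapping.lookup f = (\<lambda>\<theta>. if \<theta> \<in> B then \<phi> \<theta> else 0)"
    unfolding f_def using assms by (intro Abs_poly_mapping_inverse) (auto elim: rev_finite_subset)
  moreover from this have f: "f \<in> carrier KQ"
    by (auto simp: paths_in_algebra_def)
  moreover from f have "I +>\<^bsub>KQ\<^esub> f \<in> carrier A"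
    unfolding carrier_quotient by blast
  ultimately show ?thesis
    using that[of "I +>\<^bsub>KQ\<^esub> f"] coef_coset[of f] by simp
qed

lemma finite_coef_support:
  assumes "X \<in> carrier A"
  shows "finite {\<theta> \<in> B. coef X \<theta> \<noteq> 0}"
proof -
  obtain f where f: "f \<in> carrier KQ" "X = I +>\<^bsub>KQ\<^esub> f"
    using assms by (auto simp: carrier_quotient)
  then have "{\<theta> \<in> B. coef X \<theta> \<noteq> 0} \<subseteq> Poly_Mapping.keys f"
    by (auto simp: coef_coset in_keys_iff simp del: carrier_path_algebra)
  then show ?thesis
    by (rule finite_subset) simp
qed

lemma coef_mult:
  assumes "X \<in> carrier A" "Y \<in> carrier A"
  shows "X \<otimes>\<^bsub>A\<^esub> Y \<in> carrier A"
    and "(v, as) \<in> B \<Longrightarrow> coef (X \<otimes>\<^bsub>A\<^esub> Y) (v, as) =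
      (\<Sum>n\<le>length as. coef X (v, take n as) * coef Y (walk_target Q v (take n as), drop n as))"
proof -
  interpret ideal I KQ
    by (rule ideal)
  obtain f g where fg: "f \<in> carrier KQ" "X = I +>\<^bsub>KQ\<^esub> f" "g \<in> carrier KQ" "Y = I +>\<^bsub>KQ\<^esub> g"
    using assms by (auto simp: carrier_quotient)
  have eq: "X \<otimes>\<^bsub>A\<^esub> Y = I +>\<^bsub>KQ\<^esub> (f \<otimes>\<^bsub>KQ\<^esub> g)" "f \<otimes>\<^bsub>KQ\<^esub> g \<in> carrier KQ"
    using fg by (simp_all add: quotient_algebra_def FactRing_def rcoset_mult_add del: carrier_path_algebra)
  then show "X \<otimes>\<^bsub>A\<^esub> Y \<in> carrier A"
    by (auto simp: carrier_quotient simp del: carrier_path_algebra)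
  assume "(v, as) \<in> B"
  then show "coef (X \<otimes>\<^bsub>A\<^esub> Y) (v, as) =
      (\<Sum>n\<le>length as. coef X (v, take n as) * coef Y (walk_target Q v (take n as), drop n as))"
    using path_splits[of v as] coef_coset[OF fg(1)] coef_coset[OF fg(3)] coef_coset[OF eq(2)]
    by (simp add: eq(1) fg(2)[symmetric] fg(4)[symmetric] lookup_path_mult)
qed

lemma coef_add:
  assumes "X \<in> carrier A" "Y \<in> carrier A"
  shows "X \<oplus>\<^bsub>A\<^esub> Y \<in> carrier A"
    and "\<theta> \<in> B \<Longrightarrow> coef (X \<oplus>\<^bsub>A\<^esub> Y) \<theta> = coef X \<theta> + coef Y \<theta>"
proof -
  interpret ideal I KQ
    by (rule ideal)
  obtain f g where fg: "f \<in> carrier KQ" "X = I +>\<^bsub>KQ\<^esub> f" "g \<in> carrier KQ" "Y = I +>\<^bsub>KQ\<^esub> g"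
    using assms by (auto simp: carrier_quotient)
  have eq: "X \<oplus>\<^bsub>A\<^esub> Y = I +>\<^bsub>KQ\<^esub> (f + g)" "f + g \<in> carrier KQ"
    using fg a_rcos_sum[of f g] a_closed[of f g]
    by (simp_all add: quotient_algebra_def FactRing_def del: carrier_path_algebra)
  then show "X \<oplus>\<^bsub>A\<^esub> Y \<in> carrier A"
    by (auto simp: carrier_quotient simp del: carrier_path_algebra)
  show "\<theta> \<in> B \<Longrightarrow> coef (X \<oplus>\<^bsub>A\<^esub> Y) \<theta> = coef X \<theta> + coef Y \<theta>"
    unfolding eq(1) using fg eq(2) by (simp add: coef_coset lookup_add del: carrier_path_algebra)
qed

lemma coef_one:
  shows "\<one>\<^bsub>A\<^esub> \<in> carrier A"
    and "(v, as) \<in> B \<Longrightarrow> coef \<one>\<^bsub>A\<^esub> (v, as) = (if as = [] then 1 else 0)"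
proof -
  interpret ideal I KQ
    by (rule ideal)
  have eq: "\<one>\<^bsub>A\<^esub> = I +>\<^bsub>KQ\<^esub> \<one>\<^bsub>KQ\<^esub>"
    by (simp add: quotient_algebra_def FactRing_def)
  show "\<one>\<^bsub>A\<^esub> \<in> carrier A"
    using one_closed by (auto simp: carrier_quotient eq simp del: carrier_path_algebra)
  show "(v, as) \<in> B \<Longrightarrow> coef \<one>\<^bsub>A\<^esub> (v, as) = (if as = [] then 1 else 0)"
    unfolding eq using trivial_path_iff
    by (auto simp: coef_coset[OF one_closed] lookup_path_one)
qed

lemma coef_smult:
  assumes "X \<in> carrier A"
  shows "c \<odot>\<^bsub>A\<^esub> X \<in> carrier A"
    and "\<theta> \<in> B \<Longrightarrow> coef (c \<odot>\<^bsub>A\<^esub> X) \<theta> = c * coef X \<theta>"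
proof -
  obtain f where f: "f \<in> carrier KQ" "X = I +>\<^bsub>KQ\<^esub> f"
    using assms by (auto simp: carrier_quotient)
  have cf: "c \<odot>\<^bsub>KQ\<^esub> g \<in> carrier KQ" if "g \<in> carrier KQ" for g
    using that by auto
  have "I +>\<^bsub>KQ\<^esub> (c \<odot>\<^bsub>KQ\<^esub> g) = I +>\<^bsub>KQ\<^esub> (c \<odot>\<^bsub>KQ\<^esub> f)" if "g \<in> X" for g
    using coset_members[OF f(1)] that f
    by (subst coset_eq_iff) (auto intro!: cf simp del: carrier_path_algebra)
  then have "(\<Union>g\<in>X. I +>\<^bsub>KQ\<^esub> (c \<odot>\<^bsub>KQ\<^esub> g)) = (\<Union>g\<in>X. I +>\<^bsub>KQ\<^esub> (c \<odot>\<^bsub>KQ\<^esub> f))"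
    by (intro SUP_cong) auto
  moreover have "f \<in> X"
    using coset_self[OF f(1)] f(2) by simp
  ultimately have eq: "c \<odot>\<^bsub>A\<^esub> X = I +>\<^bsub>KQ\<^esub> (c \<odot>\<^bsub>KQ\<^esub> f)"
    by (simp add: quotient_algebra_def, blast)
  show "c \<odot>\<^bsub>A\<^esub> X \<in> carrier A"
    using cf[OF f(1)] by (auto simp: carrier_quotient eq simp del: carrier_path_algebra)
  show "\<theta> \<in> B \<Longrightarrow> coef (c \<odot>\<^bsub>A\<^esub> X) \<theta> = c * coef X \<theta>"
    unfolding eq using f by (simp add: coef_coset cf del: carrier_path_algebra)
qed

end

section \<open>Blossoming paths\<close>

locale blossomed_gentle =
  fixes Q :: "('v, 'a) pre_digraph"
    and I :: "(('v, 'a) path \<Rightarrow>\<^sub>0 'k::field) set"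
    and sg tu :: "nat \<Rightarrow> 'v"
    and Ibl :: "(('v blossom_vertex, 'a blossom_arrow) path \<Rightarrow>\<^sub>0 'k) set"
  assumes gentle: "locally_gentle Q I"
    and connected: "Digraph_Component.connected Q"
    and arcs_nonempty: "arcs Q \<noteq> {}"
    and blossoming: "blossoming Q I sg tu Ibl"
begin

abbreviation "Labels \<equiv> {1..blossom_number Q}"
abbreviation "Qbl \<equiv> blossom_quiver Q sg tu"
abbreviation "link \<equiv> length_two_notin Q I"
abbreviation "link_bl \<equiv> length_two_notin Qbl Ibl"

lemma gentle_bl: "locally_gentle Qbl Ibl"
  using blossoming by (simp add: blossoming_def)

end

lemma locally_gentle_quadratic: "locally_gentle Q I \<Longrightarrow> quadratic_monomial Q I"
  by (simp add: locally_gentle_def quadratic_monomial_def quadratic_monomial_axioms_def)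

lemma length_two_notin_iff: "length_two_notin Q I \<alpha> \<beta> \<longleftrightarrow> head Q \<alpha> = tail Q \<beta> \<and> \<not> length_two_in Q I \<alpha> \<beta>"
  by (auto simp: length_two_in_def length_two_notin_def)

lemma locally_gentle_unique:
  assumes "locally_gentle Q I" "\<alpha> \<in> arcs Q" "\<beta> \<in> arcs Q" "\<gamma> \<in> arcs Q"
  shows "length_two_notin Q I \<alpha> \<gamma> \<Longrightarrow> length_two_notin Q I \<beta> \<gamma> \<Longrightarrow> \<alpha> = \<beta>"
    and "length_two_in Q I \<alpha> \<gamma> \<Longrightarrow> length_two_in Q I \<beta> \<gamma> \<Longrightarrow> \<alpha> = \<beta>"
    and "length_two_notin Q I \<gamma> \<alpha> \<Longrightarrow> length_two_notin Q I \<gamma> \<beta> \<Longrightarrow> \<alpha> = \<beta>"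
    and "length_two_in Q I \<gamma> \<alpha> \<Longrightarrow> length_two_in Q I \<gamma> \<beta> \<Longrightarrow> \<alpha> = \<beta>"
  using assms unfolding locally_gentle_def Uniq_def by blast+

text \<open>
  If each element has at most one continuation, two chains with the same start can only differ in
  length.
\<close>
lemma successively_deterministic_prefix:
  assumes "\<And>a b c. a \<in> S \<Longrightarrow> b \<in> S \<Longrightarrow> c \<in> S \<Longrightarrow> P a b \<Longrightarrow> P a c \<Longrightarrow> b = c"
    and "successively P (x # xs)" "successively P (x # ys)" "set (x # xs) \<subseteq> S" "set (x # ys) \<subseteq> S"
  shows "\<exists>zs. xs = ys @ zs \<or> ys = xs @ zs"
  using assms(2-)
proof (induction xs arbitrary: x ys)
  case step: (Cons x' xs)
  show ?case
  proof (cases ys)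
    case (Cons y' ys')
    then have "y' = x'"
      using step.prems assms(1)[of x x' y'] by auto
    then show ?thesis
      using Cons step.prems step.IH[of x' ys'] by auto
  qed simp
next
  case Nil
  then show ?case
    by simp blast
qed

sublocale blossomed_gentle \<subseteq> base: quadratic_monomial Q I
  using gentle by (rule locally_gentle_quadratic)

sublocale blossomed_gentle \<subseteq> bl: quadratic_monomial "blossom_quiver Q sg tu" Ibl
  using gentle_bl by (rule locally_gentle_quadratic)

context blossomed_gentle
begin

lemma Qbl_simps [simp]:
  "tail Qbl (Old_Arrow \<alpha>) = Old_Vertex (tail Q \<alpha>)" "head Qbl (Old_Arrow \<alpha>) = Old_Vertex (head Q \<alpha>)"
  "tail Qbl (Sigma_Arrow p) = New_Source p" "head Qbl (Sigma_Arrow p) = Old_Vertex (sg p)"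
  "tail Qbl (Tau_Arrow p) = Old_Vertex (tu p)" "head Qbl (Tau_Arrow p) = New_Sink p"
  "Old_Arrow \<alpha> \<in> arcs Qbl \<longleftrightarrow> \<alpha> \<in> arcs Q"
  "Sigma_Arrow p \<in> arcs Qbl \<longleftrightarrow> p \<in> Labels"
  "Tau_Arrow p \<in> arcs Qbl \<longleftrightarrow> p \<in> Labels"
  "Old_Vertex v \<in> verts Qbl \<longleftrightarrow> v \<in> verts Q"
  by (auto simp: blossom_quiver_def)

lemma arcs_Qbl_cases:
  assumes "e \<in> arcs Qbl"
  obtains (old) \<alpha> where "e = Old_Arrow \<alpha>" "\<alpha> \<in> arcs Q"
    | (sigma) p where "e = Sigma_Arrow p" "p \<in> Labels"
    | (tau) p where "e = Tau_Arrow p" "p \<in> Labels"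
  using assms by (auto simp: blossom_quiver_def)

lemma ends_in_verts: "p \<in> Labels \<Longrightarrow> sg p \<in> verts Q" "p \<in> Labels \<Longrightarrow> tu p \<in> verts Q"
  using blossoming by (simp_all add: blossoming_def)

lemma link_old: "\<alpha> \<in> arcs Q \<Longrightarrow> \<beta> \<in> arcs Q \<Longrightarrow> link_bl (Old_Arrow \<alpha>) (Old_Arrow \<beta>) \<longleftrightarrow> link \<alpha> \<beta>"
  using blossoming by (simp add: length_two_notin_iff blossoming_def)

lemma link_ends: "link_bl e e' \<Longrightarrow> head Qbl e = tail Qbl e'"
  by (simp add: length_two_notin_def)

lemmas pred_unique = locally_gentle_unique(1)[OF gentle_bl]
  and rel_pred_unique = locally_gentle_unique(2)[OF gentle_bl]
  and succ_unique = locally_gentle_unique(3)[OF gentle_bl]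
  and rel_succ_unique = locally_gentle_unique(4)[OF gentle_bl]

lemma degree_le: "v \<in> verts Q \<Longrightarrow> in_degree Q v \<le> 2" "v \<in> verts Q \<Longrightarrow> out_degree Q v \<le> 2"
  using gentle by (auto simp: locally_gentle_def)

lemma card_new_arrows:
  assumes "v \<in> verts Q"
  shows "card {p \<in> Labels. sg p = v} = 2 - in_degree Q v"
    and "card {p \<in> Labels. tu p = v} = 2 - out_degree Q v"
  using blossoming assms by (auto simp: blossoming_def)

text \<open>
  The new arrows fill up the degrees. Truncated subtraction in \<^term>\<open>2 - in_degree Q v\<close> is exact
  since degrees are at most two.
\<close>
lemma two_arrows_at_old_vertex:
  assumes "v \<in> verts Q"
  shows "card {e \<in> arcs Qbl. head Qbl e = Old_Vertex v} = 2"
    and "card {e \<in> arcs Qbl. tail Qbl e = Old_Vertex v} = 2"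
proof -
  have "{e \<in> arcs Qbl. head Qbl e = Old_Vertex v} =
      Old_Arrow ` in_arcs Q v \<union> Sigma_Arrow ` {p \<in> Labels. sg p = v}"
    by (auto elim!: arcs_Qbl_cases)
  also have "card \<dots> = in_degree Q v + card {p \<in> Labels. sg p = v}"
    unfolding in_degree_def
    by (subst card_Un_disjoint) (auto simp: card_image inj_on_def)
  finally show "card {e \<in> arcs Qbl. head Qbl e = Old_Vertex v} = 2"
    using degree_le[OF assms] card_new_arrows[OF assms] by simp
  have "{e \<in> arcs Qbl. tail Qbl e = Old_Vertex v} =
      Old_Arrow ` out_arcs Q v \<union> Tau_Arrow ` {p \<in> Labels. tu p = v}"
    by (auto elim!: arcs_Qbl_cases)
  also have "card \<dots> = out_degree Q v + card {p \<in> Labels. tu p = v}"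
    unfolding out_degree_def
    by (subst card_Un_disjoint) (auto simp: card_image inj_on_def)
  finally show "card {e \<in> arcs Qbl. tail Qbl e = Old_Vertex v} = 2"
    using degree_le[OF assms] card_new_arrows[OF assms] by simp
qed

text \<open>
  At most one of the two arrows into \<open>v\<close> can form a relation with \<open>e\<close>, so the other one does not.
  With \<open>pred_unique\<close>, nonzero predecessors of arrows starting at old vertices exist uniquely; dually for
  successors.
\<close>
lemma pred_exists:
  assumes "e \<in> arcs Qbl" "tail Qbl e = Old_Vertex v" "v \<in> verts Q"
  obtains e' where "e' \<in> arcs Qbl" "link_bl e' e"
proof -
  obtain e1 e2 where e: "{e \<in> arcs Qbl. head Qbl e = Old_Vertex v} = {e1, e2}" "e1 \<noteq> e2"
    using two_arrows_at_old_vertex(1)[OF assms(3)] by (auto simp: card_2_iff)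
  have "e1 \<in> {e1, e2}" "e2 \<in> {e1, e2}"
    by auto
  then have "e1 \<in> arcs Qbl" "e2 \<in> arcs Qbl" "head Qbl e1 = tail Qbl e" "head Qbl e2 = tail Qbl e"
    using assms unfolding e(1)[symmetric] by auto
  then show ?thesis
    using that[of e1] that[of e2] rel_pred_unique[of e1 e2 e] e(2) assms(1) by (auto simp: length_two_notin_iff)
qed

lemma succ_exists:
  assumes "e \<in> arcs Qbl" "head Qbl e = Old_Vertex v" "v \<in> verts Q"
  obtains e' where "e' \<in> arcs Qbl" "link_bl e e'"
proof -
  obtain e1 e2 where e: "{e \<in> arcs Qbl. tail Qbl e = Old_Vertex v} = {e1, e2}" "e1 \<noteq> e2"
    using two_arrows_at_old_vertex(2)[OF assms(3)] by (auto simp: card_2_iff)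
  have "e1 \<in> {e1, e2}" "e2 \<in> {e1, e2}"
    by auto
  then have "e1 \<in> arcs Qbl" "e2 \<in> arcs Qbl" "head Qbl e = tail Qbl e1" "head Qbl e = tail Qbl e2"
    using assms unfolding e(1)[symmetric] by auto
  then show ?thesis
    using that[of e1] that[of e2] rel_succ_unique[of e1 e2 e] e(2) assms(1) by (auto simp: length_two_notin_iff)
qed

text \<open>
  Only \<open>\<sigma>\<^sub>p\<close> starts at \<open>s\<^sub>p\<close> and only \<open>\<tau>\<^sub>p\<close> ends at \<open>t\<^sub>p\<close>. No arrow ends at a new source or starts
  at a new sink, so the arrows in between are old.
\<close>
lemma blossom_path_exists:
  assumes p: "p \<in> Labels"
  shows "\<exists>as. (New_Source p, Sigma_Arrow p # map Old_Arrow as @ [Tau_Arrow p]) \<in> bl.B"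
proof -
  obtain \<rho> where \<rho>: "\<rho> \<in> maximal_paths Qbl Ibl" "fst \<rho> = New_Source p" "path_target Qbl \<rho> = New_Sink p"
    using blossoming p unfolding blossoming_def by blast
  obtain es where es: "(New_Source p, es) \<in> bl.B" "es \<noteq> []" "walk_target Qbl (New_Source p) es = New_Sink p"
    using \<rho> by (cases \<rho>) (auto simp: maximal_paths_def path_target_eq)
  have arcs: "set es \<subseteq> arcs Qbl" and succ: "successively link_bl es"
    using es(1) by (auto simp: bl.paths_in_algebra_eq walks_def)
  have "hd es \<in> arcs Qbl" "tail Qbl (hd es) = New_Source p"
    using arcs es(1,2) by (auto simp: bl.paths_in_algebra_eq walks_def)
  then have hd: "hd es = Sigma_Arrow p"
    by (auto elim: arcs_Qbl_cases)
  have "last es \<in> arcs Qbl" "head Qbl (last es) = New_Sink p"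
    using arcs es(2,3) by (auto simp: walk_target_def)
  then have last: "last es = Tau_Arrow p"
    by (auto elim: arcs_Qbl_cases)
  obtain ms where ms: "es = Sigma_Arrow p # ms @ [Tau_Arrow p]"
  proof -
    obtain x xs where x: "es = x # xs"
      using es(2) by (cases es) auto
    then have "x = Sigma_Arrow p" "xs \<noteq> []"
      using hd last by auto
    then have "es = Sigma_Arrow p # butlast xs @ [Tau_Arrow p]"
      using x last append_butlast_last_id[of xs] by (metis last_ConsR)
    then show ?thesis
      by (rule that)
  qed
  have "\<exists>\<alpha>. e = Old_Arrow \<alpha>" if "e \<in> set ms" for e
  proof -
    obtain xs ys where "ms = xs @ e # ys"
      using split_list[OF \<open>e \<in> set ms\<close>] by blast
    then have es': "es = (Sigma_Arrow p # xs) @ e # (ys @ [Tau_Arrow p])"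
      by (simp add: ms)
    let ?x = "last (Sigma_Arrow p # xs)" and ?y = "hd (ys @ [Tau_Arrow p])"
    have "link_bl ?x e" "link_bl e ?y"
      using succ successively_append_iff[of link_bl "Sigma_Arrow p # xs" "e # (ys @ [Tau_Arrow p])"]
        successively_Cons[of link_bl e "ys @ [Tau_Arrow p]"]
      unfolding es' by (simp_all only: list.simps append_is_Nil_conv list.sel not_True_eq_False simp_thms)
    moreover have "?x \<in> arcs Qbl" "?y \<in> arcs Qbl" "e \<in> arcs Qbl"
      using arcs last_in_set[of "Sigma_Arrow p # xs"] hd_in_set[of "ys @ [Tau_Arrow p]"]
      unfolding es' by (auto simp del: last.simps last_in_set hd_in_set)
    ultimately show ?thesis
      using link_ends[of ?x e] link_ends[of e ?y]
      by (elim arcs_Qbl_cases) auto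
  qed
  then obtain as where "ms = map Old_Arrow as"
    by (metis ex_map_conv)
  then show ?thesis
    using es(1) ms by blast
qed

text \<open>
  The path that remains when the blossom arrows at both ends of the path from \<open>s\<^sub>p\<close> to \<open>t\<^sub>p\<close> are
  cut off. It may have length zero; the path \<open>core_path p\<close> then still remembers the vertex.
\<close>
definition core :: "nat \<Rightarrow> 'a list" where
  "core p = (SOME as. (New_Source p, Sigma_Arrow p # map Old_Arrow as @ [Tau_Arrow p]) \<in> bl.B)"

definition bpath :: "nat \<Rightarrow> 'a blossom_arrow list" where
  "bpath p = Sigma_Arrow p # map Old_Arrow (core p) @ [Tau_Arrow p]"

abbreviation core_path :: "nat \<Rightarrow> ('v, 'a) path" where
  "core_path p \<equiv> (sg p, core p)"

lemma bpath:
  assumes "p \<in> Labels"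
  shows "set (bpath p) \<subseteq> arcs Qbl" "successively link_bl (bpath p)"
proof -
  have "(New_Source p, bpath p) \<in> bl.B"
    unfolding bpath_def core_def using blossom_path_exists[OF assms] by (rule someI_ex)
  then show "set (bpath p) \<subseteq> arcs Qbl" "successively link_bl (bpath p)"
    by (auto simp: bl.paths_in_algebra_eq walks_def)
qed

lemma successively_link_old:
  assumes "set as \<subseteq> arcs Q"
  shows "successively link_bl (map Old_Arrow as) \<longleftrightarrow> successively link as"
  using assms unfolding successively_map by (intro successively_cong) (auto simp: link_old subset_iff)

lemma core_arcs: "p \<in> Labels \<Longrightarrow> set (core p) \<subseteq> arcs Q"
  using bpath(1)[of p] by (auto simp: bpath_def)

lemma core_path:
  assumes "p \<in> Labels"
  shows "core_path p \<in> base.B" "walk_target Q (sg p) (core p) = tu p"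
proof -
  have succ: "successively link_bl (map Old_Arrow (core p))"
    "core p \<noteq> [] \<Longrightarrow> link_bl (Sigma_Arrow p) (Old_Arrow (hd (core p)))"
    "core p \<noteq> [] \<Longrightarrow> link_bl (Old_Arrow (last (core p))) (Tau_Arrow p)"
    "core p = [] \<Longrightarrow> link_bl (Sigma_Arrow p) (Tau_Arrow p)"
    using bpath(2)[OF assms]
    by (auto simp: bpath_def successively_Cons successively_append_iff hd_map last_map hd_append)
  show "core_path p \<in> base.B"
    using succ(1,2) core_arcs[OF assms] ends_in_verts[OF assms] link_ends[of "Sigma_Arrow p" "Old_Arrow (hd (core p))"]
    by (auto simp: base.paths_in_algebra_eq walks_def successively_link_old)
  show "walk_target Q (sg p) (core p) = tu p"
    using succ(3,4) link_ends[of "Sigma_Arrow p" "Tau_Arrow p"]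
      link_ends[of "Old_Arrow (last (core p))" "Tau_Arrow p"]
    by (auto simp: walk_target_def)
qed

lemma no_isolated_vertex:
  assumes "a \<in> verts Q"
  shows "in_degree Q a \<noteq> 0 \<or> out_degree Q a \<noteq> 0"
proof (rule ccontr)
  assume "\<not> ?thesis"
  then have none: "\<And>e. e \<in> arcs Q \<Longrightarrow> head Q e \<noteq> a \<and> tail Q e \<noteq> a"
    using base.finite_in_arcs base.finite_out_arcs by (auto simp: in_degree_def out_degree_def)
  obtain e where e: "e \<in> arcs Q"
    using arcs_nonempty by blast
  have "a \<rightarrow>\<^sup>*\<^bsub>mk_symmetric Q\<^esub> tail Q e"
    using connected assms e
    by (auto simp: Digraph_Component.connected_def strongly_connected_def)
  moreover have "a \<noteq> tail Q e"
    using none[OF e] by auto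
  ultimately obtain b where "a \<rightarrow>\<^bsub>mk_symmetric Q\<^esub> b"
    by (auto elim: pre_digraph.converse_reachable_cases)
  then show False
    using none by (auto simp: mk_symmetric_def arcs_ends_def arc_to_ends_def)
qed

lemma pred_of_old_arrow:
  assumes "\<alpha> \<in> arcs Q" "\<And>\<beta>. \<beta> \<in> arcs Q \<Longrightarrow> \<not> link \<beta> \<alpha>"
  obtains p where "p \<in> Labels" "link_bl (Sigma_Arrow p) (Old_Arrow \<alpha>)"
proof -
  obtain e where e: "e \<in> arcs Qbl" "link_bl e (Old_Arrow \<alpha>)"
    using pred_exists[of "Old_Arrow \<alpha>" "tail Q \<alpha>"] assms(1) by auto
  from e(1) show ?thesis
    using e(2) assms that link_ends[OF e(2)] by (cases rule: arcs_Qbl_cases) (auto simp: link_old)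
qed

text \<open>
  Successors are unique, so every nonzero walk that starts with \<open>\<sigma>\<^sub>p\<close> is comparable to the
  path from \<open>s\<^sub>p\<close> to \<open>t\<^sub>p\<close>.
\<close>
lemma bpath_determined:
  assumes "p \<in> Labels" "set es \<subseteq> arcs Qbl" "successively link_bl (Sigma_Arrow p # es)"
  shows "\<exists>zs. tl (bpath p) = es @ zs \<or> es = tl (bpath p) @ zs"
proof (rule successively_deterministic_prefix[where P = link_bl and S = "arcs Qbl" and x = "Sigma_Arrow p"])
  show "successively link_bl (Sigma_Arrow p # tl (bpath p))" "set (Sigma_Arrow p # tl (bpath p)) \<subseteq> arcs Qbl"
    using bpath[OF assms(1)] by (simp_all add: bpath_def)
qed (use assms succ_unique in auto)

text \<open>
  The core is already continued by \<open>\<sigma>\<^sub>p\<close> on the left and by \<open>\<tau>\<^sub>p\<close> on the right, and continuations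
  are unique, so no arrow of \<open>Q\<close> continues it.
\<close>
lemma nontrivial_core_is_maximal:
  assumes p: "p \<in> Labels" and nonempty: "core p \<noteq> []"
  shows "core_path p \<in> maximal_paths Q I"
proof -
  have links: "link_bl (Sigma_Arrow p) (Old_Arrow (hd (core p)))"
    "link_bl (Old_Arrow (last (core p))) (Tau_Arrow p)"
    using bpath(2)[OF p] nonempty
    by (auto simp: bpath_def successively_Cons successively_append_iff hd_map last_map hd_append)
  have arcs: "hd (core p) \<in> arcs Q" "last (core p) \<in> arcs Q"
    using core_arcs[OF p] nonempty by auto
  have "\<not> link \<alpha> (hd (core p))" "\<not> link (last (core p)) \<alpha>" if "\<alpha> \<in> arcs Q" for \<alpha>
    using pred_unique[of "Old_Arrow \<alpha>" "Sigma_Arrow p" "Old_Arrow (hd (core p))"]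
      succ_unique[of "Old_Arrow \<alpha>" "Tau_Arrow p" "Old_Arrow (last (core p))"] links that arcs p
    by (auto simp: link_old)
  then have "(v, \<alpha> # core p) \<notin> base.B" "(v, core p @ [\<alpha>]) \<notin> base.B" if "\<alpha> \<in> arcs Q" for v \<alpha>
    using that nonempty base.paths_append_iff[of v "[\<alpha>]" "core p"] base.paths_append_iff[of v "core p" "[\<alpha>]"]
    by auto
  then show ?thesis
    using core_path[OF p] nonempty by (auto simp: maximal_paths_def)
qed

text \<open>
  Both \<open>\<sigma>\<^sub>p\<close> and \<open>\<tau>\<^sub>p\<close> sit at the vertex, which leaves room for at most one old arrow on each side.
  If \<open>\<beta>\<close> and \<open>\<gamma>\<close> are such arrows, then \<open>\<sigma>\<^sub>p\<tau>\<^sub>p\<close> is nonzero, hence \<open>\<beta>\<tau>\<^sub>p\<close> is a relation, hence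
  \<open>\<beta>\<gamma>\<close> is not.
\<close>
lemma trivial_core_at_trivial_vertex:
  assumes p: "p \<in> Labels" and empty: "core p = []"
  shows "sg p \<in> trivial_vertices Q I"
proof -
  have link: "link_bl (Sigma_Arrow p) (Tau_Arrow p)"
    using bpath(2)[OF p] empty by (simp add: bpath_def)
  then have tu: "tu p = sg p"
    using link_ends by fastforce
  have v: "sg p \<in> verts Q"
    using ends_in_verts p by simp
  have "card {q \<in> Labels. sg q = sg p} \<noteq> 0" "card {q \<in> Labels. tu q = sg p} \<noteq> 0"
    using p tu by auto
  then have "in_degree Q (sg p) \<le> 1" "out_degree Q (sg p) \<le> 1"
    unfolding card_new_arrows[OF v] by auto
  moreover have "link \<beta> \<gamma>" if \<beta>: "\<beta> \<in> arcs Q" "head Q \<beta> = sg p" and \<gamma>: "\<gamma> \<in> arcs Q" "tail Q \<gamma> = sg p" for \<beta> \<gamma>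
  proof -
    have "length_two_in Qbl Ibl (Old_Arrow \<beta>) (Tau_Arrow p)"
      using pred_unique[of "Old_Arrow \<beta>" "Sigma_Arrow p" "Tau_Arrow p"] link p \<beta> tu
      by (auto simp: length_two_notin_iff)
    then have "link_bl (Old_Arrow \<beta>) (Old_Arrow \<gamma>)"
      using rel_succ_unique[of "Tau_Arrow p" "Old_Arrow \<gamma>" "Old_Arrow \<beta>"] p \<beta> \<gamma>
      by (auto simp: length_two_notin_iff)
    then show ?thesis
      using \<beta> \<gamma> by (simp add: link_old)
  qed
  ultimately show ?thesis
    using v by (auto simp: trivial_vertices_def)
qed

text \<open>
  By maximality the nonzero predecessor of the first arrow is some \<open>\<sigma>\<^sub>p\<close>. Then the maximal path,
  and the core of \<open>p\<close> followed by \<open>\<tau>\<^sub>p\<close>, both continue \<open>\<sigma>\<^sub>p\<close>, so one is a prefix of the other; the maximal path contains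
  no blossom arrow, and by maximality it is not a proper prefix of the core.
\<close>
lemma maximal_path_is_core:
  assumes "\<rho> \<in> maximal_paths Q I"
  shows "\<exists>p\<in>Labels. core_path p = \<rho>"
proof -
  obtain v as where \<rho>: "\<rho> = (v, as)"
    by (cases \<rho>)
  have B: "(v, as) \<in> base.B" and nonempty: "as \<noteq> []"
    using assms by (auto simp: \<rho> maximal_paths_def)
  then have arcs: "set as \<subseteq> arcs Q" and v: "tail Q (hd as) = v" and succ: "successively link as"
    by (auto simp: base.paths_in_algebra_eq walks_def)
  have ends: "hd as \<in> arcs Q" "last as \<in> arcs Q"
    using arcs nonempty by auto
  have left: "\<not> link \<beta> (hd as)" if "\<beta> \<in> arcs Q" for \<beta>
  proof
    assume link: "link \<beta> (hd as)"
    then have "head Q \<beta> = v"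
      using v by (simp add: length_two_notin_def)
    moreover from this have "(tail Q \<beta>, \<beta> # as) \<in> base.B"
      using base.paths_append_iff[of "tail Q \<beta>" "[\<beta>]" as] B link that
      by (auto simp: base.paths_in_algebra_eq[symmetric] walk_target_def)
        (auto simp: base.paths_in_algebra_eq walks_def)
    ultimately show False
      using assms that by (auto simp: \<rho> maximal_paths_def)
  qed
  have right: "\<not> link (last as) \<beta>" if "\<beta> \<in> arcs Q" for \<beta>
  proof
    assume link: "link (last as) \<beta>"
    then have target: "walk_target Q v as = tail Q \<beta>"
      using nonempty by (simp add: length_two_notin_def walk_target_def)
    moreover have "(v, as @ [\<beta>]) \<in> base.B"
      using base.paths_append_iff[of v as "[\<beta>]"] B link that
      by (auto simp: target) (auto simp: base.paths_in_algebra_eq walks_def)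
    ultimately show False
      using assms that by (auto simp: \<rho> maximal_paths_def path_target_eq)
  qed
  obtain p where p: "p \<in> Labels" "link_bl (Sigma_Arrow p) (Old_Arrow (hd as))"
    using pred_of_old_arrow[OF ends(1) left] by blast
  have "successively link_bl (Sigma_Arrow p # map Old_Arrow as)"
    using p(2) succ nonempty arcs by (simp add: successively_Cons successively_link_old hd_map)
  moreover have "set (map Old_Arrow as) \<subseteq> arcs Qbl"
    using arcs by auto
  ultimately obtain zs where zs: "map Old_Arrow (core p) @ [Tau_Arrow p] = map Old_Arrow as @ zs
      \<or> map Old_Arrow as = map Old_Arrow (core p) @ [Tau_Arrow p] @ zs"
    using bpath_determined[OF p(1), of "map Old_Arrow as"] by (auto simp: bpath_def)
  moreover have "map Old_Arrow as \<noteq> map Old_Arrow (core p) @ [Tau_Arrow p] @ zs"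
  proof
    assume eq: "map Old_Arrow as = map Old_Arrow (core p) @ [Tau_Arrow p] @ zs"
    have "Tau_Arrow p \<in> set (map Old_Arrow as)"
      unfolding eq by simp
    then show False
      by auto
  qed
  ultimately have zs: "map Old_Arrow (core p) @ [Tau_Arrow p] = map Old_Arrow as @ zs"
    by blast
  then have "zs \<noteq> []"
  proof -
    have "Tau_Arrow p \<in> set (map Old_Arrow as @ zs)"
      unfolding zs[symmetric] by simp
    then show ?thesis
      by auto
  qed
  then have core: "map Old_Arrow (core p) = map Old_Arrow as @ butlast zs"
    using arg_cong[OF zs, of butlast] by (simp add: butlast_append)
  have "butlast zs = []"
  proof (rule ccontr)
    assume ne: "butlast zs \<noteq> []"
    have "set (butlast zs) \<subseteq> Old_Arrow ` set (core p)"
      using arg_cong[OF core, of set] by auto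
    then obtain \<beta> where \<beta>: "hd (butlast zs) = Old_Arrow \<beta>" "\<beta> \<in> arcs Q"
      using core_arcs[OF p(1)] hd_in_set[OF ne] by blast
    have "successively link_bl (map Old_Arrow (core p))"
      using bpath(2)[OF p(1)] by (simp add: bpath_def successively_Cons successively_append_iff)
    then have "link_bl (Old_Arrow (last as)) (Old_Arrow \<beta>)"
      unfolding core using ne nonempty \<beta>(1) by (simp add: successively_append_iff last_map)
    then show False
      using right[OF \<beta>(2)] \<beta>(2) ends(2) by (simp add: link_old)
  qed
  then have "core p = as"
    using core by (simp add: inj_map_eq_map inj_on_def)
  moreover have "sg p = v"
    using link_ends[OF p(2)] v by simp
  ultimately show ?thesis
    using p(1) \<rho> by blast
qed

text \<open>
  If every \<open>\<sigma>\<^sub>p\<close> at \<open>a\<close> were continued by an old arrow \<open>\<gamma>\<close>, then no old arrow could end at \<open>a\<close>, because all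
  compositions of old arrows at \<open>a\<close> are nonzero and \<open>\<gamma>\<close> has only one nonzero predecessor. So two
  arrows \<open>\<sigma>\<^sub>p\<close>, \<open>\<sigma>\<^sub>q\<close> end at \<open>a\<close>, and they need two different old continuations, contrary to
  the bound on the out-degree.
\<close>
lemma trivial_vertex_has_trivial_core:
  assumes a: "a \<in> trivial_vertices Q I"
  shows "\<exists>p\<in>Labels. core_path p = (a, [])"
proof -
  have v: "a \<in> verts Q" and deg: "in_degree Q a \<le> 1" "out_degree Q a \<le> 1"
    and comp: "\<And>\<beta> \<gamma>. \<beta> \<in> arcs Q \<Longrightarrow> \<gamma> \<in> arcs Q \<Longrightarrow> head Q \<beta> = a \<Longrightarrow> tail Q \<gamma> = a \<Longrightarrow> link \<beta> \<gamma>"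
    using a by (auto simp: trivial_vertices_def)
  have "\<exists>p\<in>Labels. \<exists>q\<in>Labels. sg p = a \<and> link_bl (Sigma_Arrow p) (Tau_Arrow q)"
  proof (rule ccontr)
    assume no_tau: "\<not> ?thesis"
    have succ: "\<exists>\<gamma>\<in>arcs Q. tail Q \<gamma> = a \<and> link_bl (Sigma_Arrow p) (Old_Arrow \<gamma>)"
      if "p \<in> Labels" "sg p = a" for p
    proof -
      obtain e where e: "e \<in> arcs Qbl" "link_bl (Sigma_Arrow p) e"
        using succ_exists[of "Sigma_Arrow p" a] \<open>p \<in> Labels\<close> \<open>sg p = a\<close> v by auto
      from e(1) show ?thesis
        using e(2) link_ends[OF e(2)] that no_tau by (cases rule: arcs_Qbl_cases) auto
    qed
    have "card {p \<in> Labels. sg p = a} \<noteq> 0"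
      using card_new_arrows(1)[OF v] deg by simp
    then obtain p where p: "p \<in> Labels" "sg p = a"
      by (metis (mono_tags, lifting) card.empty empty_Collect_eq)
    obtain \<gamma> where \<gamma>: "\<gamma> \<in> arcs Q" "tail Q \<gamma> = a" "link_bl (Sigma_Arrow p) (Old_Arrow \<gamma>)"
      using succ[OF p] by blast
    have "\<beta> \<notin> in_arcs Q a" for \<beta>
      using pred_unique[of "Old_Arrow \<beta>" "Sigma_Arrow p" "Old_Arrow \<gamma>"] \<gamma> p comp[of \<beta> \<gamma>]
      by (auto simp: link_old)
    then have "in_arcs Q a = {}"
      by blast
    then have "in_degree Q a = 0"
      by (simp add: in_degree_def)
    then have "card {p \<in> Labels. sg p = a} = 2"
      using card_new_arrows(1)[OF v] by simp
    then obtain q where q: "q \<in> Labels" "sg q = a" "q \<noteq> p"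
      unfolding card_2_iff by (metis (mono_tags, lifting) insertI1 insert_commute mem_Collect_eq)
    obtain \<gamma>' where \<gamma>': "\<gamma>' \<in> arcs Q" "tail Q \<gamma>' = a" "link_bl (Sigma_Arrow q) (Old_Arrow \<gamma>')"
      using succ[OF q(1,2)] by blast
    have "\<gamma>' \<noteq> \<gamma>"
      using pred_unique[of "Sigma_Arrow p" "Sigma_Arrow q" "Old_Arrow \<gamma>"] \<gamma> \<gamma>' p q by auto
    moreover have "{\<gamma>, \<gamma>'} \<subseteq> out_arcs Q a"
      using \<gamma> \<gamma>' by auto
    ultimately have "2 \<le> out_degree Q a"
      unfolding out_degree_def using card_mono[OF base.finite_out_arcs, of "{\<gamma>, \<gamma>'}" a] by simp
    then show False
      using deg by simp
  qed
  then obtain p q where pq: "p \<in> Labels" "q \<in> Labels" "sg p = a" "link_bl (Sigma_Arrow p) (Tau_Arrow q)"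
    by blast
  then obtain zs where zs: "map Old_Arrow (core p) @ [Tau_Arrow p] = [Tau_Arrow q] @ zs
      \<or> [Tau_Arrow q] = map Old_Arrow (core p) @ [Tau_Arrow p] @ zs"
    using bpath_determined[OF pq(1), of "[Tau_Arrow q]"] by (auto simp: bpath_def)
  then have "core p = []"
    by (cases "core p") auto
  then show ?thesis
    using pq by auto
qed

text \<open>
  A nontrivial core has only one nonzero predecessor, which determines the label. Two labels with
  the same trivial core would use up all four arrows at its vertex, which would then be isolated in
  \<open>Q\<close>.
\<close>
lemma core_path_inj: "inj_on core_path Labels"
proof (rule inj_onI)
  fix p q assume pq: "p \<in> Labels" "q \<in> Labels" "core_path p = core_path q"
  then have eq: "sg p = sg q" "core p = core q"
    by auto
  show "p = q"
  proof (cases "core p = []")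
    case False
    then have "link_bl (Sigma_Arrow p) (Old_Arrow (hd (core p)))" "link_bl (Sigma_Arrow q) (Old_Arrow (hd (core p)))"
      using bpath(2)[OF pq(1)] bpath(2)[OF pq(2)] eq
      by (auto simp: bpath_def successively_Cons hd_map hd_append)
    moreover have "hd (core p) \<in> arcs Q"
      using core_arcs[OF pq(1)] False by auto
    ultimately show ?thesis
      using pred_unique[of "Sigma_Arrow p" "Sigma_Arrow q" "Old_Arrow (hd (core p))"] pq by auto
  next
    case True
    then have tu: "tu p = sg p" "tu q = sg p"
      using core_path(2)[OF pq(1)] core_path(2)[OF pq(2)] eq by auto
    have v: "sg p \<in> verts Q"
      using ends_in_verts pq by simp
    show ?thesis
    proof (rule ccontr)
      assume "p \<noteq> q"
      then have two: "card {p, q} = 2"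
        by simp
      have "{p, q} \<subseteq> {r \<in> Labels. sg r = sg p}" "{p, q} \<subseteq> {r \<in> Labels. tu r = sg p}"
        using pq tu eq by auto
      then have "2 \<le> card {r \<in> Labels. sg r = sg p}" "2 \<le> card {r \<in> Labels. tu r = sg p}"
        unfolding two[symmetric] by (auto intro!: card_mono)
      then show False
        using no_isolated_vertex[OF v] unfolding card_new_arrows[OF v] by auto
    qed
  qed
qed

end

section \<open>Paths in the gentle repetition\<close>

text \<open>
  As the left factor of a composition \<open>\<varpi>\<^sub>p\<close> behaves like \<open>\<sigma>\<^sub>p\<close>, and as the right factor like \<open>\<tau>\<^sub>p\<close>. With
  these labels the four kinds of relations of the repetition become a single rule,
  \<open>in_relations_iff\<close> below.
\<close>
primrec left_label :: "'a repetition_arrow \<Rightarrow> 'a blossom_arrow" where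
  "left_label (Copy \<alpha> i) = Old_Arrow \<alpha>"
| "left_label (Varpi p i) = Sigma_Arrow p"

primrec right_label :: "'a repetition_arrow \<Rightarrow> 'a blossom_arrow" where
  "right_label (Copy \<alpha> i) = Old_Arrow \<alpha>"
| "right_label (Varpi p i) = Tau_Arrow p"

text \<open>
  Indices of the basis elements: \<open>Inl (i, \<theta>)\<close> stands for the path \<open>\<theta>\<close> of \<open>A\<close> in block \<open>i\<close>, and
  \<open>Inr (p, i, x, j, y)\<close> for the \<open>(x, y)\<close> matrix unit of label \<open>p\<close> at place \<open>(i, j)\<close> above the
  diagonal.
\<close>
type_synonym ('v, 'a) cell = "nat \<times> ('v, 'a) path + nat \<times> nat \<times> nat \<times> nat \<times> nat"

locale gentle_repetition = blossomed_gentle Q I sg tu Ibl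
  for Q :: "('v, 'a) pre_digraph"
    and I :: "(('v, 'a) path \<Rightarrow>\<^sub>0 'k::field) set"
    and sg tu :: "nat \<Rightarrow> 'v"
    and Ibl :: "(('v blossom_vertex, 'a blossom_arrow) path \<Rightarrow>\<^sub>0 'k) set" +
  fixes k :: nat
begin

abbreviation "Qk \<equiv> repetition_quiver Q sg tu k"
abbreviation "Rk \<equiv> repetition_relations Q I sg tu Ibl k"
abbreviation "Ik \<equiv> Idl\<^bsub>path_algebra Qk\<^esub> (basis_elt ` Rk) :: (('v \<times> nat, 'a repetition_arrow) path \<Rightarrow>\<^sub>0 'k) set"
abbreviation "link_rep \<equiv> length_two_notin Qk Ik"

lemma Qk_simps [simp]:
  "tail Qk (Copy \<alpha> i) = (tail Q \<alpha>, i)" "head Qk (Copy \<alpha> i) = (head Q \<alpha>, i)"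
  "tail Qk (Varpi p i) = (tu p, i)" "head Qk (Varpi p i) = (sg p, Suc i)"
  "Copy \<alpha> i \<in> arcs Qk \<longleftrightarrow> \<alpha> \<in> arcs Q \<and> i \<in> {1..k}"
  "Varpi p i \<in> arcs Qk \<longleftrightarrow> p \<in> Labels \<and> i \<in> {1..<k}"
  "verts Qk = verts Q \<times> {1..k}"
  by (auto simp: repetition_quiver_def)

lemma fin_digraph_Qk: "fin_digraph Qk"
proof
  have "arcs Qk = (\<lambda>(\<alpha>, i). Copy \<alpha> i) ` (arcs Q \<times> {1..k}) \<union> (\<lambda>(p, i). Varpi p i) ` (Labels \<times> {1..<k})"
    by (auto simp: repetition_quiver_def)
  then show "finite (arcs Qk)"
    by simp
  show "finite (verts Qk)"
    by simp
  fix e assume "e \<in> arcs Qk"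
  then show "tail Qk e \<in> verts Qk" "head Qk e \<in> verts Qk"
    using ends_in_verts by (cases e; auto)+
qed

lemma relations_Qk: "Rk \<subseteq> {\<theta> \<in> quiver_paths Qk. path_length \<theta> = 2}"
proof
  fix \<theta> assume "\<theta> \<in> Rk"
  then show "\<theta> \<in> {\<theta> \<in> quiver_paths Qk. path_length \<theta> = 2}"
    unfolding repetition_relations_def
    using ends_in_verts
    by (auto simp: quiver_paths_eq walks_def length_two_in_def)
qed

lemma in_relations_iff:
  assumes "e \<in> arcs Qk" "e' \<in> arcs Qk" "head Qk e = tail Qk e'"
  shows "(tail Qk e, [e, e']) \<in> Rk \<longleftrightarrow> length_two_in Qbl Ibl (left_label e) (right_label e')"
proof -
  have "length_two_in Q I \<alpha> \<beta> \<longleftrightarrow> length_two_in Qbl Ibl (Old_Arrow \<alpha>) (Old_Arrow \<beta>)"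
    if "\<alpha> \<in> arcs Q" "\<beta> \<in> arcs Q" for \<alpha> \<beta>
    using blossoming that by (simp add: blossoming_def)
  then show ?thesis
    using assms by (cases e; cases e') (auto simp: repetition_relations_def)
qed

lemma labels_in_Qbl: "e \<in> arcs Qk \<Longrightarrow> left_label e \<in> arcs Qbl" "e \<in> arcs Qk \<Longrightarrow> right_label e \<in> arcs Qbl"
  by (cases e; auto)+

lemma labels_composable:
  assumes "head Qk e = tail Qk e'"
  shows "head Qbl (left_label e) = tail Qbl (right_label e')"
  using assms by (cases e; cases e') auto

lemma link_rep_iff:
  assumes "e \<in> arcs Qk" "e' \<in> arcs Qk"
  shows "link_rep e e' \<longleftrightarrow> head Qk e = tail Qk e' \<and> link_bl (left_label e) (right_label e')"
  using assms in_relations_iff[OF assms] labels_composable[of e e']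
  unfolding fin_digraph.quadratic_monomial_links[OF fin_digraph_Qk relations_Qk assms]
  by (auto simp: length_two_notin_iff)

sublocale rep: quadratic_monomial Qk Ik
  using fin_digraph_Qk relations_Qk by (auto simp: quadratic_monomial_def quadratic_monomial_axioms_def)

lemma repetition_algebra_eq: "repetition_algebra Q I sg tu Ibl k = rep.A"
  by (simp add: repetition_algebra_def Let_def)

abbreviation period :: "nat \<Rightarrow> nat" where
  "period p \<equiv> Suc (length (core p))"

text \<open>
  The track of \<open>p\<close> is the infinite periodic path that runs through the core of \<open>p\<close> in block \<open>1\<close>,
  then along \<open>\<varpi>\<^sub>p\<close> into block \<open>2\<close>, through the core there, and so on. Its vertices are numbered from
  \<open>0\<close>; a core with \<open>l\<close> arrows has \<open>l + 1\<close> vertices, so vertex \<open>N\<close> is at position \<open>N mod (l + 1)\<close> in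
  block \<open>N div (l + 1) + 1\<close>, and arrow \<open>N\<close> leads from vertex \<open>N\<close> to vertex \<open>N + 1\<close>. Only the
  part with \<open>N < k (l + 1)\<close> lies in the repetition with \<open>k\<close> blocks.
\<close>
definition track_vertex :: "nat \<Rightarrow> nat \<Rightarrow> 'v \<times> nat" where
  "track_vertex p N = (walk_target Q (sg p) (take (N mod period p) (core p)), Suc (N div period p))"

definition track_arrow :: "nat \<Rightarrow> nat \<Rightarrow> 'a repetition_arrow" where
  "track_arrow p N = (if N mod period p < length (core p)
     then Copy (core p ! (N mod period p)) (Suc (N div period p)) else Varpi p (Suc (N div period p)))"

definition track_path :: "nat \<Rightarrow> nat \<Rightarrow> nat \<Rightarrow> ('v \<times> nat, 'a repetition_arrow) path" where
  "track_path p m n = (track_vertex p m, map (track_arrow p) [m..<n])"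

lemma mod_period_cases:
  obtains (inner) "N mod period p < length (core p)" "Suc N mod period p = Suc (N mod period p)"
      "Suc N div period p = N div period p"
    | (last) "N mod period p = length (core p)" "Suc N mod period p = 0"
      "Suc N div period p = Suc (N div period p)"
proof (cases "N mod period p = length (core p)")
  case True
  then show ?thesis
    using last by (simp add: mod_Suc div_Suc)
next
  case False
  moreover have "N mod period p < period p"
    by simp
  ultimately have "N mod period p < length (core p)"
    by linarith
  then show ?thesis
    using inner by (simp add: mod_Suc div_Suc)
qed

lemma track_arrow_in_arcs_iff:
  assumes "p \<in> Labels"
  shows "track_arrow p N \<in> arcs Qk \<longleftrightarrow> Suc N < k * period p"
proof (cases N p rule: mod_period_cases)
  case inner
  then have "core p ! (N mod period p) \<in> arcs Q"
    using core_arcs[OF assms] by auto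
  moreover have "N div period p < k \<longleftrightarrow> Suc N < k * period p"
    using inner(3) by (metis div_less_iff_less_mult zero_less_Suc)
  ultimately show ?thesis
    using inner by (simp add: track_arrow_def Suc_le_eq)
next
  case last
  then have "Suc (N div period p) < k \<longleftrightarrow> Suc N < k * period p"
    by (metis div_less_iff_less_mult zero_less_Suc)
  then show ?thesis
    using last assms by (simp add: track_arrow_def)
qed

lemma tail_track_arrow:
  assumes "p \<in> Labels"
  shows "tail Qk (track_arrow p N) = track_vertex p N"
proof (cases N p rule: mod_period_cases)
  case inner
  then have "drop (N mod period p) (core p) \<noteq> []" "hd (drop (N mod period p) (core p)) = core p ! (N mod period p)"
    by (simp_all add: hd_drop_conv_nth)
  moreover have "(walk_target Q (sg p) (take (N mod period p) (core p)), drop (N mod period p) (core p)) \<in> base.B"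
    using base.path_splits(2)[OF core_path(1)[OF assms]] .
  ultimately show ?thesis
    using inner by (simp add: track_arrow_def track_vertex_def base.paths_in_algebra_eq walks_def)
next
  case last
  then show ?thesis
    using core_path(2)[OF assms] by (simp add: track_arrow_def track_vertex_def)
qed

lemma head_track_arrow: "head Qk (track_arrow p N) = track_vertex p (Suc N)"
proof (cases N p rule: mod_period_cases)
  case inner
  then have "take (Suc (N mod period p)) (core p) = take (N mod period p) (core p) @ [core p ! (N mod period p)]"
    by (simp add: take_Suc_conv_app_nth)
  then show ?thesis
    using inner by (simp add: track_arrow_def track_vertex_def walk_target_def)
qed (simp add: track_arrow_def track_vertex_def)

text \<open>
  The junction of arrows \<open>N\<close> and \<open>N + 1\<close> of the track looks like a junction of two consecutive arrows of
  the path from \<open>s\<^sub>p\<close> to \<open>t\<^sub>p\<close>: the index \<open>0\<close> is \<open>\<sigma>\<^sub>p\<close> and the last index is \<open>\<tau>\<^sub>p\<close>, whence the shift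
  by one. This is why the track is a nonzero path.
\<close>
lemma right_label_track_arrow: "right_label (track_arrow p N) = bpath p ! Suc (N mod period p)"
  by (cases N p rule: mod_period_cases) (simp_all add: track_arrow_def bpath_def nth_append)

lemma left_label_track_arrow: "left_label (track_arrow p N) = bpath p ! (Suc N mod period p)"
  by (cases N p rule: mod_period_cases) (simp_all add: track_arrow_def bpath_def nth_append)

lemma track_labels_linked:
  assumes "p \<in> Labels"
  shows "link_bl (left_label (track_arrow p N)) (right_label (track_arrow p (Suc N)))"
  unfolding left_label_track_arrow right_label_track_arrow
  using bpath(2)[OF assms] by (rule successively_nth) (simp add: bpath_def)

lemma track_vertex_in_verts:
  assumes "p \<in> Labels" "N < k * period p"
  shows "track_vertex p N \<in> verts Qk"
proof -
  have "N div period p < k"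
    using assms(2) by (simp add: less_mult_imp_div_less)
  then show ?thesis
    using base.walk_target_in_verts base.path_splits(1)[OF core_path(1)[OF assms(1)]]
    unfolding track_vertex_def base.paths_in_algebra_eq by (auto simp: Suc_le_eq)
qed

lemma track_path_in_B:
  assumes "p \<in> Labels" "m \<le> n" "n < k * period p"
  shows "track_path p m n \<in> rep.B"
proof -
  have arcs: "track_arrow p N \<in> arcs Qk" if "N < n" for N
    using that assms by (simp add: track_arrow_in_arcs_iff)
  have "link_rep (track_arrow p N) (track_arrow p (Suc N))" if "Suc N < n" for N
    using that arcs assms(1) track_labels_linked
    by (simp add: link_rep_iff tail_track_arrow head_track_arrow)
  then have "successively link_rep (map (track_arrow p) [m..<n])"
    by (simp add: successively_conv_nth)
  moreover have "track_vertex p m \<in> verts Qk"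
    using assms by (intro track_vertex_in_verts) auto
  ultimately show ?thesis
    using arcs assms(1)
    by (auto simp: track_path_def rep.paths_in_algebra_eq walks_def tail_track_arrow hd_map)
qed

lemma track_path_target:
  "m \<le> n \<Longrightarrow> walk_target Qk (track_vertex p m) (map (track_arrow p) [m..<n]) = track_vertex p n"
  by (cases n) (auto simp: walk_target_def last_map head_track_arrow le_Suc_eq)

lemma eq_if_right_label_eq: "right_label e = right_label e' \<Longrightarrow> snd (tail Qk e) = snd (tail Qk e') \<Longrightarrow> e = e'"
  by (cases e; cases e') auto

lemma eq_if_left_label_eq: "left_label e = left_label e' \<Longrightarrow> snd (head Qk e) = snd (head Qk e') \<Longrightarrow> e = e'"
  by (cases e; cases e') auto

lemma bpath_nth_in_arcs:
  assumes "p \<in> Labels" "i < Suc (period p)"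
  shows "bpath p ! i \<in> arcs Qbl"
proof -
  have "bpath p ! i \<in> set (bpath p)"
    using assms(2) by (intro nth_mem) (simp add: bpath_def)
  then show ?thesis
    using bpath(1)[OF assms(1)] by blast
qed

lemma track_labels_in_Qbl:
  assumes "p \<in> Labels"
  shows "left_label (track_arrow p N) \<in> arcs Qbl" "right_label (track_arrow p N) \<in> arcs Qbl"
  unfolding left_label_track_arrow right_label_track_arrow
   apply (rule bpath_nth_in_arcs[OF assms], rule less_SucI, rule mod_less_divisor, simp)
  apply (rule bpath_nth_in_arcs[OF assms], rule Suc_mono, rule mod_less_divisor, simp)
  done

text \<open>
  Uniqueness of successors in the blossoming determines the label of \<open>e\<close>; the block in which \<open>e\<close>
  starts determines the copy.
\<close>
lemma track_successor:
  assumes p: "p \<in> Labels" and arcs: "track_arrow p N \<in> arcs Qk" "e \<in> arcs Qk"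
    and link: "link_rep (track_arrow p N) e"
  shows "e = track_arrow p (Suc N)"
proof (rule eq_if_right_label_eq)
  have "link_bl (left_label (track_arrow p N)) (right_label e)" and tail: "tail Qk e = track_vertex p (Suc N)"
    using link link_rep_iff[OF arcs] by (auto simp: head_track_arrow)
  then show "right_label e = right_label (track_arrow p (Suc N))"
    using succ_unique[OF _ _ _ _ track_labels_linked[OF p]] track_labels_in_Qbl[OF p] labels_in_Qbl(2)[OF arcs(2)]
    by blast
  show "snd (tail Qk e) = snd (tail Qk (track_arrow p (Suc N)))"
    by (simp add: tail tail_track_arrow[OF p])
qed

text \<open>
  Dual to \<open>track_successor\<close>, with one additional case: nothing precedes vertex \<open>0\<close>, since the predecessor
  would be a copy of \<open>\<varpi>\<^sub>p\<close>, and those end in block \<open>2\<close> or later.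
\<close>
lemma track_predecessor:
  assumes p: "p \<in> Labels" and arcs: "e \<in> arcs Qk" "track_arrow p N \<in> arcs Qk"
    and link: "link_rep e (track_arrow p N)"
  obtains M where "N = Suc M" "e = track_arrow p M"
proof (cases N)
  case 0
  have "link_bl (left_label e) (right_label (track_arrow p N))" and head: "head Qk e = track_vertex p N"
    using link link_rep_iff[OF arcs] by (auto simp: tail_track_arrow[OF p])
  moreover have "link_bl (Sigma_Arrow p) (right_label (track_arrow p N))"
    using bpath(2)[OF p] unfolding right_label_track_arrow 0
    by (simp add: bpath_def successively_Cons hd_conv_nth)
  ultimately have "left_label e = Sigma_Arrow p"
    using pred_unique[of "left_label e" "Sigma_Arrow p"] p labels_in_Qbl[OF arcs(1)] track_labels_in_Qbl[OF p]
    by auto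
  then have "snd (head Qk e) \<ge> 2"
    using arcs(1) by (cases e) auto
  then show ?thesis
    using head by (simp add: track_vertex_def 0)
next
  case (Suc M)
  have "e = track_arrow p M"
  proof (rule eq_if_left_label_eq)
    have "link_bl (left_label e) (right_label (track_arrow p N))" and head: "head Qk e = track_vertex p N"
      using link link_rep_iff[OF arcs] by (auto simp: tail_track_arrow[OF p])
    then show "left_label e = left_label (track_arrow p M)"
      using pred_unique[OF _ _ _ _ track_labels_linked[OF p, of M]] track_labels_in_Qbl[OF p] labels_in_Qbl(1)[OF arcs(1)]
      unfolding Suc by blast
    show "snd (head Qk e) = snd (head Qk (track_arrow p M))"
      by (simp add: head head_track_arrow Suc)
  qed
  then show ?thesis
    using that Suc by simp
qed

lemma track_forward:
  assumes "p \<in> Labels" "successively link_rep (track_arrow p N # es)" "set (track_arrow p N # es) \<subseteq> arcs Qk"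
  shows "es = map (track_arrow p) [Suc N..<Suc N + length es]"
  using assms(2,3)
proof (induction es arbitrary: N)
  case (Cons e es)
  then have "e = track_arrow p (Suc N)"
    using track_successor[OF assms(1), of N e] by auto
  moreover have "es = map (track_arrow p) [Suc (Suc N)..<Suc (Suc N) + length es]"
    using Cons.IH[of "Suc N"] Cons.prems calculation by auto
  ultimately show ?case
    by (simp add: upt_conv_Cons del: upt_Suc)
qed simp

lemma track_backward:
  assumes "p \<in> Labels" "successively link_rep (es @ [track_arrow p N])" "set (es @ [track_arrow p N]) \<subseteq> arcs Qk"
  shows "\<exists>m\<le>N. es = map (track_arrow p) [m..<N]"
  using assms(2,3)
proof (induction es arbitrary: N rule: rev_induct)
  case (snoc e es)
  then have "link_rep e (track_arrow p N)"
    by (simp add: successively_append_iff)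
  then obtain M where M: "N = Suc M" "e = track_arrow p M"
    using track_predecessor[OF assms(1), of e N] snoc.prems by auto
  then obtain m where "m \<le> M" "es = map (track_arrow p) [m..<M]"
    using snoc.IH[of M] snoc.prems by (auto simp: successively_append_iff)
  then show ?case
    using M by (intro exI[of _ m]) auto
qed auto

text \<open>
  The given arrow lies on the track of \<open>p\<close>; following the path from there in both directions never
  leaves the track. The bounds say that the path crosses from block \<open>i\<close> to block \<open>i + 1\<close>.
\<close>
lemma path_through_varpi_is_track_path:
  assumes B: "(v, es) \<in> rep.B" and varpi: "Varpi p i \<in> set es"
  shows "\<exists>m n. m < i * period p \<and> i * period p \<le> n \<and> n < k * period p \<and> (v, es) = track_path p m n"
proof -
  have arcs: "set es \<subseteq> arcs Qk" and succ: "successively link_rep es" and v: "tail Qk (hd es) = v"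
    using B varpi by (auto simp: rep.paths_in_algebra_eq walks_def)
  have p: "p \<in> Labels" and i: "1 \<le> i"
    using arcs varpi by auto
  \<comment> \<open>the number of the given arrow on the track\<close>
  define N where "N = (i - 1) * period p + length (core p)"
  have SN: "Suc N = i * period p"
    using i by (cases i) (simp_all add: N_def)
  have N: "Varpi p i = track_arrow p N"
  proof -
    have "N mod period p = length (core p)" "N div period p = i - 1"
      unfolding N_def by (simp_all add: div_mult_self3 del: mult_Suc_right)
    then show ?thesis
      using i by (simp add: track_arrow_def)
  qed
  obtain xs ys where es: "es = xs @ track_arrow p N # ys"
    using split_list[OF varpi] N by auto
  have "successively link_rep (xs @ [track_arrow p N])" "successively link_rep (track_arrow p N # ys)"
    using succ unfolding es by (auto simp: successively_append_iff)
  moreover have "set (xs @ [track_arrow p N]) \<subseteq> arcs Qk" "set (track_arrow p N # ys) \<subseteq> arcs Qk"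
    using arcs by (auto simp: es)
  ultimately obtain m where m: "m \<le> N" "xs = map (track_arrow p) [m..<N]"
    and ys: "ys = map (track_arrow p) [Suc N..<Suc N + length ys]"
    using track_backward[OF p, of xs N] track_forward[OF p, of N ys] by blast
  let ?n = "Suc N + length ys"
  have es': "es = map (track_arrow p) [m..<?n]"
  proof -
    have "[m..<?n] = [m..<N] @ N # [Suc N..<?n]"
      using m(1) upt_add_eq_append[of m N "Suc (length ys)"] upt_conv_Cons[of N ?n] by simp
    then show ?thesis
      using m(2) ys by (simp add: es)
  qed
  have "track_arrow p (N + length ys) \<in> set es"
    unfolding es' using m(1) by auto
  then have "?n < k * period p"
    using arcs track_arrow_in_arcs_iff[OF p, of "N + length ys"] by auto
  moreover have "v = track_vertex p m"
    using v m(1) by (simp add: es' upt_conv_Cons tail_track_arrow[OF p] del: upt_Suc)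
  ultimately show ?thesis
    using es' m(1) SN by (intro exI[of _ m] exI[of _ ?n]) (auto simp: track_path_def)
qed

definition copy_path :: "nat \<Rightarrow> ('v, 'a) path \<Rightarrow> ('v \<times> nat, 'a repetition_arrow) path" where
  "copy_path i \<theta> = ((fst \<theta>, i), map (\<lambda>\<alpha>. Copy \<alpha> i) (snd \<theta>))"

lemma copy_path_in_B_iff:
  assumes "i \<in> {1..k}"
  shows "copy_path i (v, as) \<in> rep.B \<longleftrightarrow> (v, as) \<in> base.B"
proof -
  have "link_rep (Copy \<alpha> i) (Copy \<beta> i) \<longleftrightarrow> link \<alpha> \<beta>" if "\<alpha> \<in> arcs Q" "\<beta> \<in> arcs Q" for \<alpha> \<beta>
    using that assms link_old[OF that] by (auto simp: link_rep_iff length_two_notin_iff[of Q])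
  then have "set as \<subseteq> arcs Q \<Longrightarrow> successively link_rep (map (\<lambda>\<alpha>. Copy \<alpha> i) as) \<longleftrightarrow> successively link as"
    unfolding successively_map by (intro successively_cong) (auto simp: subset_iff)
  moreover have "set (map (\<lambda>\<alpha>. Copy \<alpha> i) as) \<subseteq> arcs Qk \<longleftrightarrow> set as \<subseteq> arcs Q"
    using assms by auto
  ultimately show ?thesis
    using assms by (auto simp: copy_path_def rep.paths_in_algebra_eq base.paths_in_algebra_eq walks_def hd_map
        simp del: set_map)
qed

lemma path_without_varpi_is_copy_path:
  assumes "(v, es) \<in> rep.B" "\<And>p i. Varpi p i \<notin> set es"
  shows "snd v \<in> {1..k}" "\<exists>as. (v, es) = copy_path (snd v) (fst v, as)"
proof -
  show "snd v \<in> {1..k}"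
    using assms(1) by (auto simp: rep.paths_in_algebra_eq walks_def)
  have "\<exists>as. es = map (\<lambda>\<alpha>. Copy \<alpha> (snd v)) as"
    using assms
  proof (induction es arbitrary: v)
    case (Cons e es)
    obtain \<alpha> i where e: "e = Copy \<alpha> i"
      using Cons.prems(2) by (cases e) auto
    have "(head Qk e, es) \<in> rep.B" "tail Qk e = v"
      using Cons.prems(1) rep.paths_append_iff[of v "[e]" es] by (auto simp: walk_target_def)
        (auto simp: rep.paths_in_algebra_eq walks_def)
    then have "i = snd v" "\<exists>as. es = map (\<lambda>\<alpha>. Copy \<alpha> i) as"
      using Cons.IH[of "head Qk e"] Cons.prems(2) e by auto
    then show ?case
      using e by (metis list.simps(9))
  qed simp
  then show "\<exists>as. (v, es) = copy_path (snd v) (fst v, as)"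
    by (auto simp: copy_path_def)
qed

section \<open>A basis of the gentle repetition\<close>

definition Cells :: "('v, 'a) cell set" where
  "Cells = Inl ` ({1..k} \<times> base.B) \<union>
     Inr ` {(p, i, x, j, y). p \<in> Labels \<and> (i, j) \<in> strict_upper k \<and> x < period p \<and> y < period p}"

abbreviation position :: "nat \<Rightarrow> nat \<Rightarrow> nat \<Rightarrow> nat" where
  "position p i x \<equiv> (i - 1) * period p + x"

primrec cell_path :: "('v, 'a) cell \<Rightarrow> ('v \<times> nat, 'a repetition_arrow) path" where
  "cell_path (Inl z) = copy_path (fst z) (snd z)"
| "cell_path (Inr z) = (case z of (p, i, x, j, y) \<Rightarrow> track_path p (position p i x) (position p j y))"

lemma position_less:
  assumes "1 \<le> i" "i \<le> k" "x < period p"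
  shows "position p i x < k * period p"
proof -
  have "position p i x < (i - 1) * period p + period p"
    using assms by simp
  also have "\<dots> = i * period p"
    using assms by (cases i) auto
  also have "\<dots> \<le> k * period p"
    using assms(2) by (rule mult_le_mono1)
  finally show ?thesis .
qed

lemma position_block_bounds:
  assumes "1 \<le> i" "i < j" "x < period p"
  shows "position p i x < i * period p" "i * period p \<le> position p j y"
proof -
  show "position p i x < i * period p"
    using assms by (cases i) auto
  have "i * period p \<le> (j - 1) * period p"
    using assms by (intro mult_right_mono) auto
  then show "i * period p \<le> position p j y"
    by simp
qed

lemma position_le_iff:
  assumes "1 \<le> i" "1 \<le> j" "x < period p" "y < period p"
  shows "position p i x \<le> position p j y \<longleftrightarrow> i < j \<or> (i = j \<and> x \<le> y)"
  using position_block_bounds(1)[of i j x p] position_block_bounds(2)[of i j x p y] position_block_bounds(1)[of j i y p] position_block_bounds(2)[of j i y p x] assms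
  by (cases i j rule: linorder_cases) auto

lemma position_div_mod:
  assumes "x < period p"
  shows "position p i x mod period p = x" "position p i x div period p = i - 1"
  using assms by (simp_all add: div_mult_self3 del: mult_Suc_right)

lemma exists_position:
  assumes "m < k * period p"
  obtains i x where "1 \<le> i" "i \<le> k" "x < period p" "m = position p i x"
proof
  show "m = position p (Suc (m div period p)) (m mod period p)"
    by (simp add: div_mult_mod_eq del: mult_Suc_right)
  show "Suc (m div period p) \<le> k"
    using assms less_mult_imp_div_less[OF assms] by simp
qed auto

lemma varpi_in_track_path:
  assumes "m < i * period p" "i * period p \<le> n"
  shows "i * period p - Suc m < length (snd (track_path p m n))"
    "snd (track_path p m n) ! (i * period p - Suc m) = Varpi p i"
proof -
  obtain i' where i: "i = Suc i'"
    using assms(1) by (cases i) auto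
  show *: "i * period p - Suc m < length (snd (track_path p m n))"
    using assms by (simp add: track_path_def)
  have "m + (i * period p - Suc m) = i' * period p + length (core p)"
    using assms(1) by (simp add: i)
  moreover have "track_arrow p (i' * period p + length (core p)) = Varpi p i"
    using position_div_mod[of "length (core p)" p i] by (simp add: track_arrow_def i)
  ultimately show "snd (track_path p m n) ! (i * period p - Suc m) = Varpi p i"
    using * by (simp add: track_path_def)
qed

text \<open>
  A single arrow \<open>\<varpi>\<^sub>p\<close> on a stretch, with its distance from the start, determines the track and
  the number of the starting vertex; this is what makes the enumeration of basis paths injective.
\<close>
lemma varpi_in_track_path_unique:
  assumes "s < length (snd (track_path q m n))" "snd (track_path q m n) ! s = Varpi p i"
  shows "q = p" "m + Suc s = i * period p"
proof -
  have eq: "track_arrow q (m + s) = Varpi p i"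
    using assms by (simp add: track_path_def)
  then show q: "q = p"
    by (auto simp: track_arrow_def split: if_splits)
  have "(m + s) mod period p < period p"
    by simp
  then have "(m + s) mod period p = length (core p)" "i = Suc ((m + s) div period p)"
    using eq by (auto simp: track_arrow_def q less_Suc_eq split: if_splits)
  then show "m + Suc s = i * period p"
    using div_mult_mod_eq[of "m + s" "period p"] by simp
qed

lemma copy_path_no_varpi: "Varpi p i \<notin> set (snd (copy_path j \<theta>))"
  by (auto simp: copy_path_def)

text \<open>
  The basis of the repetition: a nonzero path without arrows \<open>\<varpi>\<close> stays in one block, and any other
  one is a stretch of a track between different blocks.
\<close>
lemma bij_betw_cell_path: "bij_betw cell_path Cells rep.B"
proof (rule bij_betwI')
  fix c c' assume c: "c \<in> Cells" "c' \<in> Cells"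
  have varpi: "\<exists>s<length (snd (cell_path c)). snd (cell_path c) ! s = Varpi p i \<and> position p i x + Suc s = i * period p"
    if "c = Inr (p, i, x, j, y)" "c \<in> Cells" for c p i x j y
  proof -
    have bounds: "position p i x < i * period p" "i * period p \<le> position p j y"
      using that position_block_bounds(1)[of i j x p] position_block_bounds(2)[of i j x p y] by (auto simp: Cells_def strict_upper_def)
    show ?thesis
      unfolding that(1) cell_path.simps prod.case
    proof (intro exI conjI)
      show "position p i x + Suc (i * period p - Suc (position p i x)) = i * period p"
        using bounds(1) by linarith
    qed (rule varpi_in_track_path[OF bounds])+
  qed
  show "cell_path c = cell_path c' \<longleftrightarrow> c = c'"
  proof
    assume eq: "cell_path c = cell_path c'"
    show "c = c'"
    proof (cases c)
      case c1: (Inl z)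
      show ?thesis
      proof (cases c')
        case c2: (Inl z')
        have "inj (\<lambda>\<alpha> :: 'a. Copy \<alpha> (fst z))"
          by (auto simp: inj_def)
        then show ?thesis
          using eq by (cases z; cases z') (auto simp: c1 c2 copy_path_def inj_map_eq_map)
      next
        case c2: (Inr z')
        then show ?thesis
          using varpi[of c'] c(2) eq copy_path_no_varpi[of _ _ "fst z" "snd z"]
          by (cases z') (metis c1 cell_path.simps(1) nth_mem)
      qed
    next
      case c1: (Inr z)
      obtain p i x j y where z: "z = (p, i, x, j, y)"
        by (cases z)
      obtain s where s: "s < length (snd (cell_path c))" "snd (cell_path c) ! s = Varpi p i"
          "position p i x + Suc s = i * period p"
        using varpi[of c p i x j y] c(1) c1 z by auto
      show ?thesis
      proof (cases c')
        case c2: (Inl z')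
        then show ?thesis
          using s(1,2) eq copy_path_no_varpi[of p i "fst z'" "snd z'"] nth_mem[OF s(1)] by simp
      next
        case c2: (Inr z')
        obtain q i' x' j' y' where z': "z' = (q, i', x', j', y')"
          by (cases z')
        have s': "s < length (snd (track_path q (position q i' x') (position q j' y')))"
          "snd (track_path q (position q i' x') (position q j' y')) ! s = Varpi p i"
          using s(1,2) unfolding eq c2 z' by simp_all
        have q: "q = p" and start: "position p i' x' = position p i x"
          using varpi_in_track_path_unique[OF s'] s(3) by auto
        have cells: "1 \<le> i" "i < j" "1 \<le> i'" "i' < j'" "x < period p" "y < period p" "x' < period p" "y' < period p"
          using c by (auto simp: c1 c2 z z' q Cells_def strict_upper_def)
        have "length (snd (cell_path c)) = length (snd (cell_path c'))"
          by (simp only: eq)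
        then have "position p j y - position p i x = position p j' y' - position p i x"
          unfolding c1 c2 z z' q cell_path.simps prod.case start by (simp add: track_path_def)
        moreover have "position p i x < position p j y" "position p i' x' < position p j' y'"
          using position_block_bounds(1)[of i j x p] position_block_bounds(2)[of i j x p y] position_block_bounds(1)[of i' j' x' p] position_block_bounds(2)[of i' j' x' p y'] cells by linarith+
        ultimately have "position p j y = position p j' y'"
          using start by linarith
        then have "i - 1 = i' - 1" "x = x'" "j - 1 = j' - 1" "y = y'"
          using position_div_mod cells start by metis+
        moreover from this have "i = i'" "j = j'"
          using cells by linarith+
        ultimately show ?thesis
          by (simp add: c1 c2 z z' q)
      qed
    qed
  qed simp
next
  fix c assume "c \<in> Cells"
  then show "cell_path c \<in> rep.B"
  proof (cases c)
    case (Inl z)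
    then show ?thesis
      using \<open>c \<in> Cells\<close> copy_path_in_B_iff by (cases z) (auto simp: Cells_def)
  next
    case (Inr z)
    obtain p i x j y where z: "z = (p, i, x, j, y)"
      by (cases z)
    then have "p \<in> Labels" "1 \<le> i" "i < j" "j \<le> k" "x < period p" "y < period p"
      using \<open>c \<in> Cells\<close> Inr by (auto simp: Cells_def strict_upper_def)
    then show ?thesis
      using position_less[of j y p] position_le_iff[of i j x p y]
      unfolding Inr z cell_path.simps prod.case by (intro track_path_in_B) auto
  qed
next
  fix \<theta> assume \<theta>: "\<theta> \<in> rep.B"
  obtain v es where ves: "\<theta> = (v, es)"
    by (cases \<theta>)
  show "\<exists>c\<in>Cells. \<theta> = cell_path c"
  proof (cases "\<exists>p i. Varpi p i \<in> set es")
    case True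
    then obtain p i where varpi: "Varpi p i \<in> set es"
      by blast
    then obtain m n where mn: "m < i * period p" "i * period p \<le> n" "n < k * period p" "\<theta> = track_path p m n"
      using path_through_varpi_is_track_path[of v es p i] \<theta> ves by auto
    have p: "p \<in> Labels"
      using \<theta> varpi by (auto simp: ves rep.paths_in_algebra_eq walks_def)
    have "m < k * period p"
      using mn(1-3) by linarith
    then obtain i1 x where x: "1 \<le> i1" "i1 \<le> k" "x < period p" "m = position p i1 x"
      by (rule exists_position)
    obtain j y where y: "1 \<le> j" "j \<le> k" "y < period p" "n = position p j y"
      using mn(3) by (rule exists_position)
    have "i1 - 1 = m div period p"
      unfolding x(4) by (rule position_div_mod(2)[OF x(3), symmetric])
    also have "\<dots> < i"
      using mn(1) by (rule less_mult_imp_div_less)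
    also have "i = i * period p div period p"
      by (rule nonzero_mult_div_cancel_right[symmetric]) simp
    also have "\<dots> \<le> n div period p"
      using mn(2) by (rule div_le_mono)
    also have "\<dots> = j - 1"
      unfolding y(4) by (rule position_div_mod(2)[OF y(3)])
    finally have "i1 < j"
      by linarith
    then have "Inr (p, i1, x, j, y) \<in> Cells"
      using p x y by (auto simp: Cells_def strict_upper_def)
    then show ?thesis
      using mn(4) x(4) y(4) by (intro bexI[of _ "Inr (p, i1, x, j, y)"]) simp_all
  next
    case False
    then obtain as where as: "snd v \<in> {1..k}" "\<theta> = copy_path (snd v) (fst v, as)"
      using path_without_varpi_is_copy_path[of v es] \<theta> ves by auto
    then have "(fst v, as) \<in> base.B"
      using \<theta> copy_path_in_B_iff[OF as(1)] by simp
    then show ?thesis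
      using as by (intro bexI[of _ "Inl (snd v, (fst v, as))"]) (auto simp: Cells_def)
  qed
qed


section \<open>Products along tracks\<close>
lemma Cells_simps [simp]:
  "Inl (i, \<theta>) \<in> Cells \<longleftrightarrow> i \<in> {1..k} \<and> \<theta> \<in> base.B"
  "Inr (p, i, x, j, y) \<in> Cells \<longleftrightarrow>
    p \<in> Labels \<and> (i, j) \<in> strict_upper k \<and> x < period p \<and> y < period p"
  by (auto simp: Cells_def)

definition core_segment :: "nat \<Rightarrow> nat \<Rightarrow> nat \<Rightarrow> ('v, 'a) path" where
  "core_segment p x y = (walk_target Q (sg p) (take x (core p)), take (y - x) (drop x (core p)))"

lemma core_segment_in_B: "p \<in> Labels \<Longrightarrow> core_segment p x y \<in> base.B"
  unfolding core_segment_def by (intro base.path_splits core_path)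

text \<open>
  A cut of a stretch that starts in block \<open>i\<close> may fall into block \<open>i\<close> itself; the first part is then
  a copy of a segment of the core, that is, a basis element of the first kind.
\<close>
lemma track_path_within_block:
  assumes "1 \<le> i" "x \<le> y" "y < period p"
  shows "track_path p (position p i x) (position p i y) = copy_path i (core_segment p x y)"
proof -
  have "track_arrow p (position p i x + s) = Copy (core p ! (x + s)) i" if "s < y - x" for s
  proof -
    have "position p i x + s = position p i (x + s)"
      by simp
    moreover have "x + s < period p" "x + s < length (core p)"
      using that assms by auto
    ultimately show ?thesis
      using position_div_mod[of "x + s" p i] assms by (simp only: track_arrow_def) simp
  qed
  then have "map (track_arrow p) [position p i x..<position p i y]
      = map (\<lambda>\<alpha>. Copy \<alpha> i) (take (y - x) (drop x (core p)))"
    using assms by (intro nth_equalityI) auto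
  moreover have "track_vertex p (position p i x) = (walk_target Q (sg p) (take x (core p)), i)"
    using position_div_mod[of x p i] assms by (simp only: track_vertex_def) simp
  ultimately show ?thesis
    by (simp add: track_path_def copy_path_def core_segment_def)
qed

text \<open>
  The coefficient at the stretch from position \<open>x\<close> in block \<open>i\<close> to position \<open>y\<close> in block \<open>j\<close>, read
  as \<open>0\<close> if the second vertex precedes the first. For \<open>i = j\<close> this is an entry of \<open>\<eta>\<^sub>A\<close> of the diagonal
  part. So all cuts of a stretch are handled by one sum over all vertices of the track, and the
  product becomes a product of matrices.
\<close>
definition track_coef ::
  "(('v, 'a) cell \<Rightarrow> 'k) \<Rightarrow> nat \<Rightarrow> nat \<Rightarrow> nat \<Rightarrow> nat \<Rightarrow> nat \<Rightarrow> 'k" where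
  "track_coef \<phi> p i x j y =
    (if i < j then \<phi> (Inr (p, i, x, j, y))
     else if i = j \<and> x \<le> y then \<phi> (Inl (i, core_segment p x y)) else 0)"

text \<open>
  The common product rule: both algebras multiply their coordinates in this way.
\<close>
definition cell_mult ::
  "(('v, 'a) cell \<Rightarrow> 'k) \<Rightarrow>
   (('v, 'a) cell \<Rightarrow> 'k) \<Rightarrow>
   ('v, 'a) cell \<Rightarrow> 'k" where
  "cell_mult \<phi> \<chi> c = (case c of
      Inl (i, v, as) \<Rightarrow> \<Sum>n\<le>length as. \<phi> (Inl (i, v, take n as)) * \<chi> (Inl (i, walk_target Q v (take n as), drop n as))
    | Inr (p, i, x, j, y) \<Rightarrow> \<Sum>m\<in>{1..k}. \<Sum>z<period p. track_coef \<phi> p i x m z * track_coef \<chi> p m z j y)"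

lemma track_coef_cong:
  assumes "\<And>c. c \<in> Cells \<Longrightarrow> \<phi> c = \<phi>' c"
    and "p \<in> Labels" "i \<in> {1..k}" "j \<in> {1..k}" "x < period p" "y < period p"
  shows "track_coef \<phi> p i x j y = track_coef \<phi>' p i x j y"
  using assms by (auto simp: track_coef_def strict_upper_def core_segment_in_B)

lemma cell_mult_cong:
  assumes \<phi>: "\<And>c. c \<in> Cells \<Longrightarrow> \<phi> c = \<phi>' c" and \<chi>: "\<And>c. c \<in> Cells \<Longrightarrow> \<chi> c = \<chi>' c" and c: "c \<in> Cells"
  shows "cell_mult \<phi> \<chi> c = cell_mult \<phi>' \<chi>' c"
proof (cases c)
  case (Inl z)
  obtain i v as where z: "z = (i, v, as)"
    by (cases z)
  then have "i \<in> {1..k}" "(v, as) \<in> base.B"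
    using c Inl by auto
  then show ?thesis
    using base.path_splits[of v as] by (auto simp: Inl z cell_mult_def \<phi> \<chi> intro!: sum.cong)
next
  case (Inr z)
  obtain p i x j y where z: "z = (p, i, x, j, y)"
    by (cases z)
  then have "p \<in> Labels" "i \<in> {1..k}" "j \<in> {1..k}" "x < period p" "y < period p"
    using c Inr by (auto simp: strict_upper_def)
  then show ?thesis
    using track_coef_cong[OF \<phi>] track_coef_cong[OF \<chi>]
    by (auto simp: Inr z cell_mult_def intro!: sum.cong)
qed

definition rep_coef :: "(('v \<times> nat, 'a repetition_arrow) path \<Rightarrow>\<^sub>0 'k) set \<Rightarrow>
    ('v, 'a) cell \<Rightarrow> 'k" where
  "rep_coef X c = rep.coef X (cell_path c)"

lemma cell_path_in_B: "c \<in> Cells \<Longrightarrow> cell_path c \<in> rep.B"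
  using bij_betw_cell_path by (auto simp: bij_betw_def)

lemma track_coef_rep:
  assumes "1 \<le> i" "1 \<le> j" "x < period p" "y < period p"
  shows "track_coef (rep_coef X) p i x j y =
    (if position p i x \<le> position p j y then rep.coef X (track_path p (position p i x) (position p j y)) else 0)"
  unfolding track_coef_def position_le_iff[OF assms]
  using assms track_path_within_block[of i x y p] by (auto simp: rep_coef_def)

lemma sum_positions:
  "(\<Sum>m\<in>{1..k}. \<Sum>z<period p. g (position p m z)) = (\<Sum>Z<k * period p. g Z)"
proof -
  have "(\<Sum>Z<k * period p. g Z) = (\<Sum>m<k. \<Sum>z\<in>{m * period p..<m * period p + period p}. g z)"
    by (rule sum.nat_group[symmetric])
  also have "\<dots> = (\<Sum>m<k. \<Sum>z<period p. g (m * period p + z))"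
  proof (rule sum.cong)
    fix m
    show "(\<Sum>z\<in>{m * period p..<m * period p + period p}. g z) = (\<Sum>z<period p. g (m * period p + z))"
      by (rule sum.reindex_bij_witness[of _ "\<lambda>z. m * period p + z" "\<lambda>z. z - m * period p"]) auto
  qed simp
  also have "\<dots> = (\<Sum>m\<in>{1..k}. \<Sum>z<period p. g (position p m z))"
    by (simp add: sum.atLeast1_atMost_eq)
  finally show ?thesis
    by simp
qed

lemma sum_from_start: "M \<le> N \<Longrightarrow> (\<Sum>n\<le>N - M. f (M + n)) = (\<Sum>Z\<in>{M..N :: nat}. f Z)"
  by (intro sum.reindex_bij_witness[of _ "\<lambda>Z. Z - M" "\<lambda>n. M + n"]) auto

lemma rep_coef_mult:
  assumes X: "X \<in> carrier rep.A" and Y: "Y \<in> carrier rep.A" and c: "c \<in> Cells"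
  shows "rep_coef (X \<otimes>\<^bsub>rep.A\<^esub> Y) c = cell_mult (rep_coef X) (rep_coef Y) c"
proof (cases c)
  case (Inl z)
  obtain i v as where z: "z = (i, v, as)"
    by (cases z)
  have B: "((v, i), map (\<lambda>\<alpha>. Copy \<alpha> i) as) \<in> rep.B"
    using cell_path_in_B[OF c] by (simp add: Inl z copy_path_def)
  have "walk_target Qk (v, i) (map (\<lambda>\<alpha>. Copy \<alpha> i) bs) = (walk_target Q v bs, i)" for bs
    by (simp add: walk_target_def last_map)
  then show ?thesis
    using rep.coef_mult(2)[OF X Y B]
    by (simp add: rep_coef_def cell_mult_def Inl z copy_path_def take_map drop_map)
next
  case (Inr z)
  obtain p i x j y where z: "z = (p, i, x, j, y)"
    by (cases z)
  have cell: "p \<in> Labels" "1 \<le> i" "i < j" "j \<le> k" "x < period p" "y < period p"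
    using c by (auto simp: Inr z strict_upper_def)
  let ?M = "position p i x" and ?N = "position p j y"
  have MN: "?M \<le> ?N" "?N < k * period p"
    using cell by (intro iffD2[OF position_le_iff] position_less; simp)+
  have B: "track_path p ?M ?N \<in> rep.B"
    using cell MN by (intro track_path_in_B)
  have "rep_coef (X \<otimes>\<^bsub>rep.A\<^esub> Y) c = (\<Sum>n\<le>?N - ?M. rep.coef X (track_path p ?M (?M + n)) * rep.coef Y (track_path p (?M + n) ?N))"
  proof -
    have "take n [?M..<?N] = [?M..<?M + n]" if "n \<le> ?N - ?M" for n
      by (rule take_upt) (use that MN(1) in linarith)
    moreover have "walk_target Qk (track_vertex p ?M) (map (track_arrow p) [?M..<?M + n]) = track_vertex p (?M + n)" for n
      by (rule track_path_target) simp
    moreover have "drop n [?M..<?N] = [?M + n..<?N]" for n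
      by simp
    ultimately show ?thesis
      using rep.coef_mult(2)[OF X Y, of "track_vertex p ?M" "map (track_arrow p) [?M..<?N]"] B
      unfolding rep_coef_def Inr z cell_path.simps prod.case track_path_def
      by (simp add: take_map drop_map del: mult_Suc_right)
  qed
  also have "\<dots> = (\<Sum>Z\<in>{?M..?N}. rep.coef X (track_path p ?M Z) * rep.coef Y (track_path p Z ?N))"
    using MN(1) by (rule sum_from_start[where f = "\<lambda>Z. rep.coef X (track_path p ?M Z) * rep.coef Y (track_path p Z ?N)"])
  also have "\<dots> = (\<Sum>Z<k * period p. (if ?M \<le> Z then rep.coef X (track_path p ?M Z) else 0) *
      (if Z \<le> ?N then rep.coef Y (track_path p Z ?N) else 0))"
    using MN(2) by (intro sum.mono_neutral_cong_left) auto
  also have "\<dots> = (\<Sum>m\<in>{1..k}. \<Sum>z<period p. track_coef (rep_coef X) p i x m z * track_coef (rep_coef Y) p m z j y)"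
    unfolding sum_positions[symmetric] using cell by (intro sum.cong refl) (simp add: track_coef_rep del: mult_Suc_right)
  also have "\<dots> = cell_mult (rep_coef X) (rep_coef Y) c"
    by (simp add: Inr z cell_mult_def)
  finally show ?thesis .
qed

section \<open>The algebra \<open>V(A)\<close> in coordinates\<close>

abbreviation "V \<equiv> V_algebra Q I"
abbreviation "MP \<equiv> maximal_paths Q I"
abbreviation "TV \<equiv> trivial_vertices Q I"

text \<open>
  The two kinds of factors of \<open>V(A)\<close> are treated alike: a trivial core contributes the \<open>1 \<times> 1\<close>
  matrix algebra \<open>K\<close>.
\<close>
definition entry :: "('v, 'a, 'k) V_elt \<Rightarrow> nat \<Rightarrow> nat \<Rightarrow> nat \<Rightarrow> 'k" where
  "entry w p x y = (if core p = [] then snd w (sg p) else fst w (core_path p) $$ (x, y))"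

lemma carrier_V:
  "w \<in> carrier V \<longleftrightarrow> fst w \<in> (\<Pi>\<^sub>E \<rho>\<in>MP. carrier_mat (Suc (path_length \<rho>)) (Suc (path_length \<rho>))) \<and> snd w \<in> extensional TV"
  by (cases w) (auto simp: V_algebra_def binary_product_def family_product_def module_mat_def field_algebra_def
      PiE_def)

lemma V_eqI:
  assumes "w \<in> carrier V" "w' \<in> carrier V"
    and entries: "\<And>p x y. p \<in> Labels \<Longrightarrow> x < period p \<Longrightarrow> y < period p \<Longrightarrow> entry w p x y = entry w' p x y"
  shows "w = w'"
proof (rule prod_eqI)
  show "fst w = fst w'"
  proof (rule PiE_ext)
    show "fst w \<in> (\<Pi>\<^sub>E \<rho>\<in>MP. carrier_mat (Suc (path_length \<rho>)) (Suc (path_length \<rho>)))"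
      "fst w' \<in> (\<Pi>\<^sub>E \<rho>\<in>MP. carrier_mat (Suc (path_length \<rho>)) (Suc (path_length \<rho>)))"
      using assms by (auto simp: carrier_V)
    fix \<rho> assume \<rho>: "\<rho> \<in> MP"
    then obtain p where p: "p \<in> Labels" "core_path p = \<rho>"
      using maximal_path_is_core by blast
    have "fst w \<rho> \<in> carrier_mat (period p) (period p)" "fst w' \<rho> \<in> carrier_mat (period p) (period p)"
      using assms(1,2) \<rho> p by (auto simp: carrier_V PiE_def Pi_def)
    moreover have "core p \<noteq> []"
      using \<rho> p by (auto simp: maximal_paths_def)
    then have "fst w \<rho> $$ (x, y) = fst w' \<rho> $$ (x, y)" if "x < period p" "y < period p" for x y
      using entries[OF p(1) that] p(2) by (simp add: entry_def)
    ultimately show "fst w \<rho> = fst w' \<rho>"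
      by (intro eq_matI) auto
  qed
  show "snd w = snd w'"
  proof (rule extensionalityI)
    show "snd w \<in> extensional TV" "snd w' \<in> extensional TV"
      using assms by (auto simp: carrier_V)
    fix a assume "a \<in> TV"
    then obtain p where "p \<in> Labels" "core_path p = (a, [])"
      using trivial_vertex_has_trivial_core by blast
    then show "snd w a = snd w' a"
      using entries[of p 0 0] by (auto simp: entry_def)
  qed
qed

lemma core_path_cases:
  assumes "p \<in> Labels"
  obtains (maximal) "core p \<noteq> []" "core_path p \<in> MP" | (trivial) "core p = []" "sg p \<in> TV"
  using nontrivial_core_is_maximal[OF assms] trivial_core_at_trivial_vertex[OF assms] by blast

text \<open>
  Entries can be prescribed freely, since different labels have different cores; they determine
  the element by \<open>V_eqI\<close>, since every maximal path and every vertex of \<open>T\<^sub>A\<close> comes from a label.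
\<close>
lemma V_exists: "\<exists>w\<in>carrier V. \<forall>p\<in>Labels. \<forall>x<period p. \<forall>y<period p. entry w p x y = \<epsilon> p x y"
proof -
  define label where "label = inv_into Labels core_path"
  have label: "label (core_path p) = p" if "p \<in> Labels" for p
    unfolding label_def using that by (intro inv_into_f_f core_path_inj)
  define w where "w = ((\<lambda>\<rho>\<in>MP. mat (Suc (path_length \<rho>)) (Suc (path_length \<rho>)) (\<lambda>(x, y). \<epsilon> (label \<rho>) x y)),
    (\<lambda>a\<in>TV. \<epsilon> (label (a, [])) 0 0))"
  have "w \<in> carrier V"
    by (auto simp: carrier_V w_def)
  moreover have "entry w p x y = \<epsilon> p x y" if "p \<in> Labels" "x < period p" "y < period p" for p x y
    using that(1)
  proof (cases rule: core_path_cases)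
    case maximal
    then show ?thesis
      using that label[of p] by (simp add: entry_def w_def)
  next
    case trivial
    then show ?thesis
      using that label[of p] by (simp add: entry_def w_def)
  qed
  ultimately show ?thesis
    by blast
qed

lemma V_simps:
  "\<zero>\<^bsub>V\<^esub> = ((\<lambda>\<rho>\<in>MP. 0\<^sub>m (Suc (path_length \<rho>)) (Suc (path_length \<rho>))), (\<lambda>a\<in>TV. 0))"
  "w \<otimes>\<^bsub>V\<^esub> w' = ((\<lambda>\<rho>\<in>MP. fst w \<rho> * fst w' \<rho>), (\<lambda>a\<in>TV. snd w a * snd w' a))"
  "w \<oplus>\<^bsub>V\<^esub> w' = ((\<lambda>\<rho>\<in>MP. fst w \<rho> + fst w' \<rho>), (\<lambda>a\<in>TV. snd w a + snd w' a))"
  "c \<odot>\<^bsub>V\<^esub> w = ((\<lambda>\<rho>\<in>MP. c \<cdot>\<^sub>m fst w \<rho>), (\<lambda>a\<in>TV. c * snd w a))"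
  by (auto simp: V_algebra_def binary_product_def family_product_def module_mat_def field_algebra_def
      case_prod_beta)

lemma V_closed [simp]:
  "\<zero>\<^bsub>V\<^esub> \<in> carrier V"
  "w \<in> carrier V \<Longrightarrow> w' \<in> carrier V \<Longrightarrow> w \<otimes>\<^bsub>V\<^esub> w' \<in> carrier V"
  "w \<in> carrier V \<Longrightarrow> w' \<in> carrier V \<Longrightarrow> w \<oplus>\<^bsub>V\<^esub> w' \<in> carrier V"
  "w \<in> carrier V \<Longrightarrow> c \<odot>\<^bsub>V\<^esub> w \<in> carrier V"
  by (auto simp: carrier_V V_simps PiE_iff intro!: mult_carrier_mat)

lemma V_component_dim:
  assumes "w \<in> carrier V" "core_path p \<in> MP"
  shows "dim_row (fst w (core_path p)) = period p" "dim_col (fst w (core_path p)) = period p"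
  using assms by (auto simp: carrier_V PiE_def Pi_def)

lemma entry_zero [simp]: "p \<in> Labels \<Longrightarrow> x < period p \<Longrightarrow> y < period p \<Longrightarrow> entry \<zero>\<^bsub>V\<^esub> p x y = 0"
  by (cases p rule: core_path_cases) (auto simp: entry_def V_simps)

lemma entry_add:
  assumes "w \<in> carrier V" "w' \<in> carrier V" "p \<in> Labels" "x < period p" "y < period p"
  shows "entry (w \<oplus>\<^bsub>V\<^esub> w') p x y = entry w p x y + entry w' p x y"
  using assms(3) by (cases rule: core_path_cases) (use assms in \<open>auto simp: entry_def V_simps V_component_dim\<close>)

lemma entry_smult:
  assumes "w \<in> carrier V" "p \<in> Labels" "x < period p" "y < period p"
  shows "entry (c \<odot>\<^bsub>V\<^esub> w) p x y = c * entry w p x y"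
  using assms(2) by (cases rule: core_path_cases) (use assms in \<open>auto simp: entry_def V_simps V_component_dim\<close>)

lemma entry_mult:
  assumes "w \<in> carrier V" "w' \<in> carrier V" "p \<in> Labels" "x < period p" "y < period p"
  shows "entry (w \<otimes>\<^bsub>V\<^esub> w') p x y = (\<Sum>z<period p. entry w p x z * entry w' p z y)"
  using assms(3)
proof (cases rule: core_path_cases)
  case maximal
  then show ?thesis
    using assms by (simp add: entry_def V_simps V_component_dim scalar_prod_def atLeast0LessThan del: sum.lessThan_Suc)
next
  case trivial
  then show ?thesis
    using assms by (simp add: entry_def V_simps)
qed

lemma abelian_monoid_V: "abelian_monoid V"
proof (rule abelian_monoidI)
  fix x y z assume "x \<in> carrier V" "y \<in> carrier V" "z \<in> carrier V"
  then show "x \<oplus>\<^bsub>V\<^esub> y \<oplus>\<^bsub>V\<^esub> z = x \<oplus>\<^bsub>V\<^esub> (y \<oplus>\<^bsub>V\<^esub> z)"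
    by (intro V_eqI) (auto simp: entry_add)
next
  fix x y assume "x \<in> carrier V" "y \<in> carrier V"
  then show "x \<oplus>\<^bsub>V\<^esub> y = y \<oplus>\<^bsub>V\<^esub> x"
    by (intro V_eqI) (auto simp: entry_add)
next
  fix x assume "x \<in> carrier V"
  then show "\<zero>\<^bsub>V\<^esub> \<oplus>\<^bsub>V\<^esub> x = x"
    by (intro V_eqI) (auto simp: entry_add)
qed auto

lemma entry_finsum:
  assumes "finite S" "\<And>s. s \<in> S \<Longrightarrow> f s \<in> carrier V" "p \<in> Labels" "x < period p" "y < period p"
  shows "entry (finsum V f S) p x y = (\<Sum>s\<in>S. entry (f s) p x y)"
proof -
  interpret abelian_monoid V
    by (rule abelian_monoid_V)
  show ?thesis
    using assms(1,2)
  proof (induction S)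
    case (insert s S)
    then show ?case
      using assms(3-) by (auto simp: entry_add finsum_insert Pi_def)
  qed (use assms in auto)
qed

lemma path_vertices_nth:
  assumes "(v, as) \<in> quiver_paths Q" "x \<le> length as"
  shows "path_vertices Q (v, as) ! x = walk_target Q v (take x as)"
proof (cases x)
  case 0
  then show ?thesis
    using assms by (cases as) (auto simp: path_vertices_def quiver_paths_eq walks_def base.awalk_verts.simps)
next
  case (Suc x')
  then have "take x as = take x' as @ [as ! x']"
    using assms by (simp add: take_Suc_conv_app_nth)
  then show ?thesis
    using assms Suc base.awalk_verts_conv'[of v as "walk_target Q v as"]
    by (cases "as = []") (simp_all add: path_vertices_def walk_target_def quiver_paths_eq walks_def cas_iff nth_append)
qed

text \<open>
  A path is recorded at \<open>(x, y)\<close> exactly if it is the segment of the core from vertex \<open>x\<close> to vertex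
  \<open>y\<close>. Hence the \<open>(x, y)\<close> entry of the image of \<open>f\<close> is a single coefficient of \<open>f\<close>, at a path
  outside the ideal, and \<open>\<eta>\<close> is well defined on cosets.
\<close>
lemma eta_path_entry:
  assumes p: "p \<in> Labels" and xy: "x < period p" "y < period p" and \<theta>: "\<theta> \<in> quiver_paths Q"
  shows "eta_path Q (core_path p) \<theta> $$ (x, y) = (if x \<le> y \<and> \<theta> = core_segment p x y then 1 else (0 :: 'k))"
proof (cases "snd \<theta> = []")
  case True
  have "core_path p \<in> quiver_paths Q"
    using core_path(1)[OF p] by (simp add: paths_in_algebra_def)
  then have "path_vertices Q (core_path p) ! x = walk_target Q (sg p) (take x (core p))"
    using xy by (intro path_vertices_nth) auto
  then show ?thesis
    using True xy by (cases \<theta>) (auto simp: eta_path_def core_segment_def)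
next
  case False
  have slice: "map (\<lambda>w. core p ! (w - 1)) [Suc x..<Suc y] = take (y - x) (drop x (core p))" if "x \<le> y"
    using that xy by (intro nth_equalityI) (auto simp del: upt_Suc)
  have "(\<exists>u v. 1 \<le> u \<and> u \<le> v \<and> v \<le> length (core p) \<and> (x, y) = (u - 1, v) \<and>
      snd \<theta> = map (\<lambda>w. core p ! (w - 1)) [u..<Suc v]) \<longleftrightarrow>
      Suc x \<le> y \<and> snd \<theta> = map (\<lambda>w. core p ! (w - 1)) [Suc x..<Suc y]" (is "?ex \<longleftrightarrow> ?eq")
  proof
    assume ?ex
    then show ?eq
      by (elim exE conjE) (auto simp del: upt_Suc)
  next
    assume ?eq
    then show ?ex
      using xy by (intro exI[of _ "Suc x"] exI[of _ y]) (auto simp del: upt_Suc)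
  qed
  also have "\<dots> \<longleftrightarrow> x \<le> y \<and> snd \<theta> = snd (core_segment p x y)"
    using slice False by (cases "x = y") (auto simp: core_segment_def simp del: upt_Suc)
  also have "\<dots> \<longleftrightarrow> x \<le> y \<and> \<theta> = core_segment p x y"
  proof -
    have "core_segment p x y \<in> quiver_paths Q"
      using core_segment_in_B[OF p] by (simp add: paths_in_algebra_def)
    then have "fst \<theta> = fst (core_segment p x y)" if "snd \<theta> = snd (core_segment p x y)"
      using \<theta> False that by (cases \<theta>; cases "core_segment p x y") (auto simp: quiver_paths_eq walks_def)
    then show ?thesis
      by (auto intro: prod_eqI)
  qed
  finally show ?thesis
    using False xy by (simp add: eta_path_def del: upt_Suc)
qed

lemma eta_KQ_in_V: "eta_KQ Q I f \<in> carrier V"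
  by (auto simp: carrier_V eta_KQ_def)

lemma entry_eta_KQ:
  assumes f: "f \<in> carrier base.KQ" and p: "p \<in> Labels" and xy: "x < period p" "y < period p"
  shows "entry (eta_KQ Q I f) p x y = (if x \<le> y then Poly_Mapping.lookup f (core_segment p x y) else 0)"
proof -
  have "(\<Sum>\<theta>\<in>Poly_Mapping.keys f. Poly_Mapping.lookup f \<theta> * eta_path Q (core_path p) \<theta> $$ (x, y))
     = (\<Sum>\<theta>\<in>Poly_Mapping.keys f. if \<theta> = core_segment p x y then if x \<le> y then Poly_Mapping.lookup f \<theta> else 0 else 0)"
    using f by (intro sum.cong) (auto simp: eta_path_entry[OF p xy] in_keys_iff simp del: split_paired_All)
  also have "\<dots> = (if x \<le> y then Poly_Mapping.lookup f (core_segment p x y) else 0)"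
    by (simp add: in_keys_iff)
  finally have matrix: "(\<Sum>\<theta>\<in>Poly_Mapping.keys f. Poly_Mapping.lookup f \<theta> * eta_path Q (core_path p) \<theta> $$ (x, y))
     = (if x \<le> y then Poly_Mapping.lookup f (core_segment p x y) else 0)" .
  show ?thesis
    using p
  proof (cases rule: core_path_cases)
    case maximal
    then show ?thesis
      using matrix xy by (simp add: entry_def eta_KQ_def)
  next
    case trivial
    then show ?thesis
      using xy by (simp add: entry_def eta_KQ_def core_segment_def if_distrib[of "(*) _"] in_keys_iff cong: if_cong)
  qed
qed

lemma eta_coset:
  assumes f: "f \<in> carrier base.KQ"
  shows "eta Q I (I +>\<^bsub>base.KQ\<^esub> f) = eta_KQ Q I f"
proof -
  have "eta_KQ Q I g = eta_KQ Q I f" if "g \<in> I +>\<^bsub>base.KQ\<^esub> f" for g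
    using base.coset_members[OF f that] f
    by (intro V_eqI eta_KQ_in_V) (simp add: entry_eta_KQ core_segment_in_B del: carrier_path_algebra)
  then have "eta_KQ Q I ` (I +>\<^bsub>base.KQ\<^esub> f) = {eta_KQ Q I f}"
    using base.coset_self[OF f] by blast
  then show ?thesis
    by (simp add: eta_def)
qed

lemma eta_in_V: "X \<in> carrier base.A \<Longrightarrow> eta Q I X \<in> carrier V"
  unfolding base.carrier_quotient using eta_coset eta_KQ_in_V by auto

lemma entry_eta:
  assumes "X \<in> carrier base.A" "p \<in> Labels" "x < period p" "y < period p"
  shows "entry (eta Q I X) p x y = (if x \<le> y then base.coef X (core_segment p x y) else 0)"
proof -
  obtain f where f: "f \<in> carrier base.KQ" "X = I +>\<^bsub>base.KQ\<^esub> f"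
    using assms(1) unfolding base.carrier_quotient by blast
  show ?thesis
    unfolding f(2) eta_coset[OF f(1)] entry_eta_KQ[OF f(1) assms(2-4)]
      base.coef_coset[OF f(1) core_segment_in_B[OF assms(2)]] ..
qed

section \<open>The triangular algebra in coordinates\<close>

abbreviation "Tri \<equiv> triangular_algebra Q I k"

lemma carrier_Tri:
  "S \<in> carrier Tri \<longleftrightarrow> fst S \<in> (\<Pi>\<^sub>E i\<in>{1..k}. carrier base.A) \<and> snd S \<in> (\<Pi>\<^sub>E ij\<in>strict_upper k. carrier V)"
  by (cases S) (simp add: triangular_algebra_def Let_def binary_product_def family_product_def)

lemma Tri_simps:
  "\<one>\<^bsub>Tri\<^esub> = ((\<lambda>i\<in>{1..k}. \<one>\<^bsub>base.A\<^esub>), (\<lambda>ij\<in>strict_upper k. \<zero>\<^bsub>V\<^esub>))"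
  "S \<otimes>\<^bsub>Tri\<^esub> S' = ((\<lambda>i\<in>{1..k}. fst S i \<otimes>\<^bsub>base.A\<^esub> fst S' i),
     (\<lambda>(i, j)\<in>strict_upper k. eta Q I (fst S i) \<otimes>\<^bsub>V\<^esub> snd S' (i, j)
        \<oplus>\<^bsub>V\<^esub> (\<Oplus>\<^bsub>V\<^esub>m\<in>{i<..<j}. snd S (i, m) \<otimes>\<^bsub>V\<^esub> snd S' (m, j))
        \<oplus>\<^bsub>V\<^esub> snd S (i, j) \<otimes>\<^bsub>V\<^esub> eta Q I (fst S' j)))"
  "S \<oplus>\<^bsub>Tri\<^esub> S' = ((\<lambda>i\<in>{1..k}. fst S i \<oplus>\<^bsub>base.A\<^esub> fst S' i), (\<lambda>ij\<in>strict_upper k. snd S ij \<oplus>\<^bsub>V\<^esub> snd S' ij))"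
  "c \<odot>\<^bsub>Tri\<^esub> S = ((\<lambda>i\<in>{1..k}. c \<odot>\<^bsub>base.A\<^esub> fst S i), (\<lambda>ij\<in>strict_upper k. c \<odot>\<^bsub>V\<^esub> snd S ij))"
  by (simp_all add: triangular_algebra_def Let_def binary_product_def family_product_def case_prod_beta)

lemma strict_upper_intermediate:
  assumes "(i, j) \<in> strict_upper k"
  shows "i \<in> {1..k}" "j \<in> {1..k}" "m \<in> {i<..<j} \<Longrightarrow> (i, m) \<in> strict_upper k" "m \<in> {i<..<j} \<Longrightarrow> (m, j) \<in> strict_upper k"
  using assms by (auto simp: strict_upper_def)

lemma Tri_components:
  assumes "S \<in> carrier Tri"
  shows "i \<in> {1..k} \<Longrightarrow> fst S i \<in> carrier base.A" "ij \<in> strict_upper k \<Longrightarrow> snd S ij \<in> carrier V"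
proof -
  have S: "fst S \<in> (\<Pi>\<^sub>E i\<in>{1..k}. carrier base.A)" "snd S \<in> (\<Pi>\<^sub>E ij\<in>strict_upper k. carrier V)"
    using assms unfolding carrier_Tri by blast+
  show "i \<in> {1..k} \<Longrightarrow> fst S i \<in> carrier base.A" "ij \<in> strict_upper k \<Longrightarrow> snd S ij \<in> carrier V"
    by (rule PiE_mem[OF S(1)] PiE_mem[OF S(2)]; assumption)+
qed

lemma Tri_mult_summands:
  assumes S: "S \<in> carrier Tri" "S' \<in> carrier Tri" and ij: "(i, j) \<in> strict_upper k"
  shows "eta Q I (fst S i) \<otimes>\<^bsub>V\<^esub> snd S' (i, j) \<in> carrier V"
    "m \<in> {i<..<j} \<Longrightarrow> snd S (i, m) \<otimes>\<^bsub>V\<^esub> snd S' (m, j) \<in> carrier V"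
    "(\<Oplus>\<^bsub>V\<^esub>m\<in>{i<..<j}. snd S (i, m) \<otimes>\<^bsub>V\<^esub> snd S' (m, j)) \<in> carrier V"
    "snd S (i, j) \<otimes>\<^bsub>V\<^esub> eta Q I (fst S' j) \<in> carrier V"
proof -
  interpret abelian_monoid V
    by (rule abelian_monoid_V)
  note mem = strict_upper_intermediate[OF ij] Tri_components[OF S(1)] Tri_components[OF S(2)] eta_in_V
  show "eta Q I (fst S i) \<otimes>\<^bsub>V\<^esub> snd S' (i, j) \<in> carrier V"
    "snd S (i, j) \<otimes>\<^bsub>V\<^esub> eta Q I (fst S' j) \<in> carrier V"
    using mem ij by auto
  show products: "snd S (i, m) \<otimes>\<^bsub>V\<^esub> snd S' (m, j) \<in> carrier V" if "m \<in> {i<..<j}" for m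
    using mem that by auto
  show "(\<Oplus>\<^bsub>V\<^esub>m\<in>{i<..<j}. snd S (i, m) \<otimes>\<^bsub>V\<^esub> snd S' (m, j)) \<in> carrier V"
    using products by (intro finsum_closed) auto
qed

lemma Tri_closed:
  "S \<in> carrier Tri \<Longrightarrow> S' \<in> carrier Tri \<Longrightarrow> S \<otimes>\<^bsub>Tri\<^esub> S' \<in> carrier Tri"
  "S \<in> carrier Tri \<Longrightarrow> S' \<in> carrier Tri \<Longrightarrow> S \<oplus>\<^bsub>Tri\<^esub> S' \<in> carrier Tri"
  "\<one>\<^bsub>Tri\<^esub> \<in> carrier Tri"
  "S \<in> carrier Tri \<Longrightarrow> c \<odot>\<^bsub>Tri\<^esub> S \<in> carrier Tri"
proof -
  assume S: "S \<in> carrier Tri" and S': "S' \<in> carrier Tri"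
  have "fst (S \<otimes>\<^bsub>Tri\<^esub> S') \<in> (\<Pi>\<^sub>E i\<in>{1..k}. carrier base.A)"
    using Tri_components[OF S] Tri_components[OF S'] base.coef_mult(1) by (auto simp: Tri_simps)
  moreover have "snd (S \<otimes>\<^bsub>Tri\<^esub> S') \<in> (\<Pi>\<^sub>E ij\<in>strict_upper k. carrier V)"
    using Tri_mult_summands[OF S S'] by (auto simp: Tri_simps)
  ultimately show "S \<otimes>\<^bsub>Tri\<^esub> S' \<in> carrier Tri"
    by (simp add: carrier_Tri)
  show "S \<oplus>\<^bsub>Tri\<^esub> S' \<in> carrier Tri"
    using Tri_components[OF S] Tri_components[OF S'] base.coef_add(1) by (auto simp: Tri_simps carrier_Tri)
next
  show "\<one>\<^bsub>Tri\<^esub> \<in> carrier Tri"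
    using base.coef_one(1) by (auto simp: Tri_simps carrier_Tri)
next
  assume S: "S \<in> carrier Tri"
  show "c \<odot>\<^bsub>Tri\<^esub> S \<in> carrier Tri"
    using Tri_components[OF S] base.coef_smult(1) by (auto simp: Tri_simps carrier_Tri)
qed

definition tri_coef where
  "tri_coef S c = (case c of Inl (i, \<theta>) \<Rightarrow> base.coef (fst S i) \<theta> | Inr (p, i, x, j, y) \<Rightarrow> entry (snd S (i, j)) p x y)"

lemma tri_coef_eqI:
  assumes S: "S \<in> carrier Tri" and S': "S' \<in> carrier Tri"
    and eq: "\<And>c. c \<in> Cells \<Longrightarrow> tri_coef S c = tri_coef S' c"
  shows "S = S'"
proof (rule prod_eqI)
  show "fst S = fst S'"
  proof (rule PiE_ext)
    show "fst S \<in> (\<Pi>\<^sub>E i\<in>{1..k}. carrier base.A)" "fst S' \<in> (\<Pi>\<^sub>E i\<in>{1..k}. carrier base.A)"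
      using S S' by (auto simp: carrier_Tri)
    fix i assume i: "i \<in> {1..k}"
    show "fst S i = fst S' i"
    proof (rule base.quotient_eqI)
      fix \<theta> assume "\<theta> \<in> base.B"
      then show "base.coef (fst S i) \<theta> = base.coef (fst S' i) \<theta>"
        using i eq[of "Inl (i, \<theta>)"] by (simp add: tri_coef_def)
    qed (use Tri_components S S' i in auto)
  qed
  show "snd S = snd S'"
  proof (rule PiE_ext)
    show "snd S \<in> (\<Pi>\<^sub>E ij\<in>strict_upper k. carrier V)" "snd S' \<in> (\<Pi>\<^sub>E ij\<in>strict_upper k. carrier V)"
      using S S' by (auto simp: carrier_Tri)
    fix ij assume ij: "ij \<in> strict_upper k"
    show "snd S ij = snd S' ij"
    proof (rule V_eqI)
      fix p x y assume "p \<in> Labels" "x < period p" "y < period p"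
      then show "entry (snd S ij) p x y = entry (snd S' ij) p x y"
        using ij eq[of "Inr (p, fst ij, x, snd ij, y)"] by (simp add: tri_coef_def)
    qed (use Tri_components S S' ij in auto)
  qed
qed

lemma track_coef_tri:
  assumes "S \<in> carrier Tri" "p \<in> Labels" "i \<in> {1..k}" "x < period p" "y < period p"
  shows "track_coef (tri_coef S) p i x i y = entry (eta Q I (fst S i)) p x y"
    and "i < j \<Longrightarrow> track_coef (tri_coef S) p i x j y = entry (snd S (i, j)) p x y"
    and "j < i \<Longrightarrow> track_coef (tri_coef S) p i x j y = 0"
  using assms Tri_components(1)[OF assms(1), of i] by (auto simp: track_coef_def tri_coef_def entry_eta)

text \<open>
  In the sum over the intermediate block \<open>m\<close>, the term \<open>m = i\<close> is the summand with \<open>\<eta>\<close> on the left, the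
  term \<open>m = j\<close> the one with \<open>\<eta>\<close> on the right, the terms strictly between form the matrix
  product, and all other terms vanish.
\<close>
lemma tri_coef_mult:
  assumes S: "S \<in> carrier Tri" and S': "S' \<in> carrier Tri" and c: "c \<in> Cells"
  shows "tri_coef (S \<otimes>\<^bsub>Tri\<^esub> S') c = cell_mult (tri_coef S) (tri_coef S') c"
proof (cases c)
  case (Inl z)
  obtain i v as where z: "z = (i, v, as)"
    by (cases z)
  then have "i \<in> {1..k}" "(v, as) \<in> base.B"
    using c Inl by auto
  then show ?thesis
    using Tri_components[OF S] Tri_components[OF S']
    by (simp add: Inl z tri_coef_def cell_mult_def Tri_simps base.coef_mult(2))
next
  case (Inr z)
  obtain p i x j y where z: "z = (p, i, x, j, y)"
    by (cases z)
  have cell: "p \<in> Labels" "(i, j) \<in> strict_upper k" "x < period p" "y < period p"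
    using c by (simp_all add: Inr z)
  note ij = strict_upper_intermediate[OF cell(2)]
  have less: "i < j"
    using cell(2) by (simp add: strict_upper_def)
  note summands = Tri_mult_summands[OF S S' cell(2)]
  interpret abelian_monoid V
    by (rule abelian_monoid_V)
  let ?g = "\<lambda>m. \<Sum>z<period p. track_coef (tri_coef S) p i x m z * track_coef (tri_coef S') p m z j y"
  have first: "entry (eta Q I (fst S i) \<otimes>\<^bsub>V\<^esub> snd S' (i, j)) p x y = ?g i"
    using S S' cell ij less Tri_components(1)[OF S, of i] Tri_components(2)[OF S', of "(i, j)"] eta_in_V
    by (simp add: entry_mult track_coef_tri del: sum.lessThan_Suc)
  have last: "entry (snd S (i, j) \<otimes>\<^bsub>V\<^esub> eta Q I (fst S' j)) p x y = ?g j"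
    using S S' cell ij less Tri_components(2)[OF S, of "(i, j)"] Tri_components(1)[OF S', of j] eta_in_V
    by (simp add: entry_mult track_coef_tri del: sum.lessThan_Suc)
  have middle: "entry (snd S (i, m) \<otimes>\<^bsub>V\<^esub> snd S' (m, j)) p x y = ?g m" if "m \<in> {i<..<j}" for m
    using S S' cell ij that Tri_components(2)[OF S, of "(i, m)"] Tri_components(2)[OF S', of "(m, j)"]
    by (simp add: entry_mult track_coef_tri del: sum.lessThan_Suc)
  have inner: "entry (\<Oplus>\<^bsub>V\<^esub>m\<in>{i<..<j}. snd S (i, m) \<otimes>\<^bsub>V\<^esub> snd S' (m, j)) p x y = (\<Sum>m\<in>{i<..<j}. ?g m)"
    by (rule trans[OF entry_finsum sum.cong[OF refl middle]])
      (use cell summands in \<open>simp_all del: sum.lessThan_Suc\<close>)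
  have zero: "?g m = 0" if "m \<in> {1..k}" "m \<notin> {i..j}" for m
    using that S S' cell ij by (intro sum.neutral) (auto simp: track_coef_tri)
  have "tri_coef (S \<otimes>\<^bsub>Tri\<^esub> S') c = ?g i + (\<Sum>m\<in>{i<..<j}. ?g m) + ?g j"
    using cell summands
    by (simp add: Inr z tri_coef_def Tri_simps entry_add first inner last del: sum.lessThan_Suc)
  also have "\<dots> = (\<Sum>m\<in>{i..j}. ?g m)"
  proof -
    have "{i..j} = insert i (insert j {i<..<j})"
      using less by auto
    then show ?thesis
      using less by (simp add: algebra_simps del: sum.lessThan_Suc)
  qed
  also have "\<dots> = (\<Sum>m\<in>{1..k}. ?g m)"
    using ij zero by (intro sum.mono_neutral_left) auto
  also have "\<dots> = cell_mult (tri_coef S) (tri_coef S') c"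
    by (simp add: Inr z cell_mult_def)
  finally show ?thesis .
qed

lemma finite_track_cells: "finite {z. Inr z \<in> Cells}"
proof -
  have "{z. Inr z \<in> Cells} \<subseteq> (\<Union>p\<in>Labels. {p} \<times> {1..k} \<times> {..<period p} \<times> {1..k} \<times> {..<period p})"
    by (auto simp: strict_upper_def)
  then show ?thesis
    by (rule finite_subset) auto
qed

lemma finite_tri_support:
  assumes "S \<in> carrier Tri"
  shows "finite {c \<in> Cells. tri_coef S c \<noteq> 0}"
proof -
  let ?D = "\<lambda>i. {\<theta> \<in> base.B. base.coef (fst S i) \<theta> \<noteq> 0}"
  have "{c \<in> Cells. tri_coef S c \<noteq> 0} \<subseteq> Inl ` (SIGMA i:{1..k}. ?D i) \<union> Inr ` {z. Inr z \<in> Cells}"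
  proof
    fix c assume "c \<in> {c \<in> Cells. tri_coef S c \<noteq> 0}"
    then show "c \<in> Inl ` (SIGMA i:{1..k}. ?D i) \<union> Inr ` {z. Inr z \<in> Cells}"
      by (cases c) (auto simp: tri_coef_def simp del: Cells_simps(2))
  qed
  moreover have "finite (?D i)" if "i \<in> {1..k}" for i
    using base.finite_coef_support Tri_components(1)[OF assms that] .
  then have "finite (Inl ` (SIGMA i:{1..k}. ?D i) \<union> Inr ` {z. Inr z \<in> Cells})"
    using finite_track_cells by (intro finite_UnI finite_imageI finite_SigmaI) auto
  ultimately show ?thesis
    by (rule finite_subset)
qed

lemma tri_exists:
  assumes "finite {c \<in> Cells. \<phi> c \<noteq> 0}"
  shows "\<exists>S\<in>carrier Tri. \<forall>c\<in>Cells. tri_coef S c = \<phi> c"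
proof -
  have "\<exists>X. X \<in> carrier base.A \<and> (\<forall>\<theta>\<in>base.B. base.coef X \<theta> = \<phi> (Inl (i, \<theta>)))" if i: "i \<in> {1..k}" for i
  proof -
    have "Inl ` Pair i ` {\<theta> \<in> base.B. \<phi> (Inl (i, \<theta>)) \<noteq> 0} \<subseteq> {c \<in> Cells. \<phi> c \<noteq> 0}"
      using i by auto
    then have "finite (Inl ` Pair i ` {\<theta> \<in> base.B. \<phi> (Inl (i, \<theta>)) \<noteq> 0} :: ('v, 'a) cell set)"
      using assms by (rule finite_subset)
    then have "finite {\<theta> \<in> base.B. \<phi> (Inl (i, \<theta>)) \<noteq> 0}"
      by (auto dest!: finite_imageD simp: inj_on_def)
    then obtain X where "X \<in> carrier base.A" "\<And>\<theta>. \<theta> \<in> base.B \<Longrightarrow> base.coef X \<theta> = \<phi> (Inl (i, \<theta>))"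
      by (rule base.quotient_exists[where \<phi> = "\<lambda>\<theta>. \<phi> (Inl (i, \<theta>))"]) blast
    then show ?thesis
      by blast
  qed
  then have "\<forall>i\<in>{1..k}. \<exists>X. X \<in> carrier base.A \<and> (\<forall>\<theta>\<in>base.B. base.coef X \<theta> = \<phi> (Inl (i, \<theta>)))"
    by blast
  then obtain D where D: "\<forall>i\<in>{1..k}. D i \<in> carrier base.A \<and> (\<forall>\<theta>\<in>base.B. base.coef (D i) \<theta> = \<phi> (Inl (i, \<theta>)))"
    by (rule bchoice[THEN exE])
  have "\<forall>ij. \<exists>w. w \<in> carrier V \<and>
      (\<forall>p\<in>Labels. \<forall>x<period p. \<forall>y<period p. entry w p x y = \<phi> (Inr (p, fst ij, x, snd ij, y)))"
    using V_exists[of "\<lambda>p x y. \<phi> (Inr (p, fst ij, x, snd ij, y))" for ij] unfolding Bex_def ..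
  then obtain U where U: "\<forall>ij. U ij \<in> carrier V \<and>
      (\<forall>p\<in>Labels. \<forall>x<period p. \<forall>y<period p. entry (U ij) p x y = \<phi> (Inr (p, fst ij, x, snd ij, y)))"
    by (rule choice[THEN exE])
  let ?S = "(restrict D {1..k}, restrict U (strict_upper k))"
  have "?S \<in> carrier Tri"
    using D U by (auto simp: carrier_Tri)
  moreover have "tri_coef ?S c = \<phi> c" if "c \<in> Cells" for c
  proof (cases c)
    case (Inl z)
    then show ?thesis
      using that D by (cases z) (auto simp: tri_coef_def)
  next
    case (Inr z)
    then show ?thesis
      using that U by (cases z) (auto simp: tri_coef_def)
  qed
  ultimately show ?thesis
    by blast
qed

lemma rep_coef_eqI:
  assumes "X \<in> carrier rep.A" "Y \<in> carrier rep.A" "\<And>c. c \<in> Cells \<Longrightarrow> rep_coef X c = rep_coef Y c"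
  shows "X = Y"
proof (rule rep.quotient_eqI[OF assms(1,2)])
  fix \<theta> assume "\<theta> \<in> rep.B"
  then obtain c where "c \<in> Cells" "\<theta> = cell_path c"
    using bij_betw_cell_path by (auto simp: bij_betw_def)
  then show "rep.coef X \<theta> = rep.coef Y \<theta>"
    using assms(3) by (simp add: rep_coef_def)
qed

lemma finite_rep_support:
  assumes "X \<in> carrier rep.A"
  shows "finite {c \<in> Cells. rep_coef X c \<noteq> 0}"
proof -
  have "cell_path ` {c \<in> Cells. rep_coef X c \<noteq> 0} \<subseteq> {\<theta> \<in> rep.B. rep.coef X \<theta> \<noteq> 0}"
    using cell_path_in_B by (auto simp: rep_coef_def)
  then have "finite (cell_path ` {c \<in> Cells. rep_coef X c \<noteq> 0})"
    using rep.finite_coef_support[OF assms] by (rule finite_subset)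
  moreover have "inj_on cell_path {c \<in> Cells. rep_coef X c \<noteq> 0}"
    using bij_betw_cell_path by (auto simp: bij_betw_def intro: inj_on_subset)
  ultimately show ?thesis
    by (rule finite_imageD)
qed

lemma rep_exists:
  assumes "finite {c \<in> Cells. \<phi> c \<noteq> 0}"
  shows "\<exists>X\<in>carrier rep.A. \<forall>c\<in>Cells. rep_coef X c = \<phi> c"
proof -
  let ?inv = "inv_into Cells cell_path"
  have inv: "?inv (cell_path c) = c" if "c \<in> Cells" for c
    using that bij_betw_cell_path by (simp add: bij_betw_def inv_into_f_f)
  have "{\<theta> \<in> rep.B. \<phi> (?inv \<theta>) \<noteq> 0} \<subseteq> cell_path ` {c \<in> Cells. \<phi> c \<noteq> 0}"
    using bij_betw_cell_path inv by (force simp: bij_betw_def)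
  then have "finite {\<theta> \<in> rep.B. \<phi> (?inv \<theta>) \<noteq> 0}"
    using assms by (auto elim: finite_subset)
  then obtain X where X: "X \<in> carrier rep.A" "\<And>\<theta>. \<theta> \<in> rep.B \<Longrightarrow> rep.coef X \<theta> = \<phi> (?inv \<theta>)"
    by (rule rep.quotient_exists[where \<phi> = "\<lambda>\<theta>. \<phi> (?inv \<theta>)"]) blast
  have "rep_coef X c = \<phi> c" if "c \<in> Cells" for c
    unfolding rep_coef_def X(2)[OF cell_path_in_B[OF that]] inv[OF that] ..
  then show ?thesis
    using X(1) by blast
qed

lemma rep_coef_add:
  "c \<in> Cells \<Longrightarrow> X \<in> carrier rep.A \<Longrightarrow> Y \<in> carrier rep.A \<Longrightarrow>
    rep_coef (X \<oplus>\<^bsub>rep.A\<^esub> Y) c = rep_coef X c + rep_coef Y c"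
  unfolding rep_coef_def by (intro rep.coef_add cell_path_in_B)

lemma rep_coef_smult:
  "c \<in> Cells \<Longrightarrow> X \<in> carrier rep.A \<Longrightarrow> rep_coef (a \<odot>\<^bsub>rep.A\<^esub> X) c = a * rep_coef X c"
  unfolding rep_coef_def by (intro rep.coef_smult cell_path_in_B)

lemma tri_coef_add:
  assumes "c \<in> Cells" "S \<in> carrier Tri" "S' \<in> carrier Tri"
  shows "tri_coef (S \<oplus>\<^bsub>Tri\<^esub> S') c = tri_coef S c + tri_coef S' c"
  using assms(1) Tri_components[OF assms(2)] Tri_components[OF assms(3)]
  by (cases c) (auto simp: tri_coef_def Tri_simps base.coef_add entry_add)

lemma tri_coef_smult:
  assumes "c \<in> Cells" "S \<in> carrier Tri"
  shows "tri_coef (a \<odot>\<^bsub>Tri\<^esub> S) c = a * tri_coef S c"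
  using assms(1) Tri_components[OF assms(2)]
  by (cases c) (auto simp: tri_coef_def Tri_simps base.coef_smult entry_smult)

lemma coef_one_agree:
  assumes "c \<in> Cells"
  shows "rep_coef \<one>\<^bsub>rep.A\<^esub> c = tri_coef \<one>\<^bsub>Tri\<^esub> c"
proof (cases c)
  case (Inl z)
  obtain i v as where z: "z = (i, v, as)"
    by (cases z)
  then have "i \<in> {1..k}" "(v, as) \<in> base.B" "((v, i), map (\<lambda>\<alpha>. Copy \<alpha> i) as) \<in> rep.B"
    using assms cell_path_in_B[OF assms] Inl by (auto simp: copy_path_def)
  then show ?thesis
    by (simp add: Inl z rep_coef_def tri_coef_def Tri_simps copy_path_def rep.coef_one(2) base.coef_one(2))
next
  case (Inr z)
  obtain p i x j y where z: "z = (p, i, x, j, y)"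
    by (cases z)
  have cell: "p \<in> Labels" "(i, j) \<in> strict_upper k" "x < period p" "y < period p"
    using assms by (simp_all add: Inr z)
  let ?M = "position p i x" and ?N = "position p j y"
  have "?M < ?N"
    using cell position_block_bounds(1)[of i j x p] position_block_bounds(2)[of i j x p y]
    unfolding strict_upper_def by simp
  then have nonempty: "map (track_arrow p) [?M..<?N] \<noteq> []"
    by (simp only: map_is_Nil_conv upt_eq_Nil_conv) linarith
  have B: "(track_vertex p ?M, map (track_arrow p) [?M..<?N]) \<in> rep.B"
    using cell_path_in_B[OF assms] by (simp only: Inr z cell_path.simps prod.case track_path_def)
  have "rep_coef \<one>\<^bsub>rep.A\<^esub> c = 0"
    unfolding Inr z rep_coef_def cell_path.simps prod.case track_path_def rep.coef_one(2)[OF B]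
    using nonempty by (rule if_not_P)
  then show ?thesis
    using cell by (simp add: Inr z tri_coef_def Tri_simps)
qed

end

section \<open>The isomorphism\<close>

text \<open>
  A relation that is compatible with the operations and pairs off the elements of two algebras is
  the graph of an isomorphism.
\<close>
lemma algebra_iso_of_relation:
  assumes R: "\<And>x x'. x \<in> carrier R \<Longrightarrow> x' \<in> carrier R \<Longrightarrow> x \<otimes>\<^bsub>R\<^esub> x' \<in> carrier R"
      "\<And>x x'. x \<in> carrier R \<Longrightarrow> x' \<in> carrier R \<Longrightarrow> x \<oplus>\<^bsub>R\<^esub> x' \<in> carrier R"
      "\<one>\<^bsub>R\<^esub> \<in> carrier R" "\<And>c x. x \<in> carrier R \<Longrightarrow> c \<odot>\<^bsub>R\<^esub> x \<in> carrier R"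
    and S: "\<And>y y'. y \<in> carrier S \<Longrightarrow> y' \<in> carrier S \<Longrightarrow> y \<otimes>\<^bsub>S\<^esub> y' \<in> carrier S"
      "\<And>y y'. y \<in> carrier S \<Longrightarrow> y' \<in> carrier S \<Longrightarrow> y \<oplus>\<^bsub>S\<^esub> y' \<in> carrier S"
      "\<one>\<^bsub>S\<^esub> \<in> carrier S" "\<And>c y. y \<in> carrier S \<Longrightarrow> c \<odot>\<^bsub>S\<^esub> y \<in> carrier S"
    and total: "\<And>x. x \<in> carrier R \<Longrightarrow> \<exists>y\<in>carrier S. rel x y"
      "\<And>y. y \<in> carrier S \<Longrightarrow> \<exists>x\<in>carrier R. rel x y"
    and unique: "\<And>x y y'. x \<in> carrier R \<Longrightarrow> y \<in> carrier S \<Longrightarrow> y' \<in> carrier S \<Longrightarrow> rel x y \<Longrightarrow> rel x y' \<Longrightarrow> y = y'"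
      "\<And>x x' y. x \<in> carrier R \<Longrightarrow> x' \<in> carrier R \<Longrightarrow> y \<in> carrier S \<Longrightarrow> rel x y \<Longrightarrow> rel x' y \<Longrightarrow> x = x'"
    and ops: "\<And>x x' y y'. x \<in> carrier R \<Longrightarrow> x' \<in> carrier R \<Longrightarrow> y \<in> carrier S \<Longrightarrow> y' \<in> carrier S \<Longrightarrow>
        rel x y \<Longrightarrow> rel x' y' \<Longrightarrow> rel (x \<otimes>\<^bsub>R\<^esub> x') (y \<otimes>\<^bsub>S\<^esub> y')"
      "\<And>x x' y y'. x \<in> carrier R \<Longrightarrow> x' \<in> carrier R \<Longrightarrow> y \<in> carrier S \<Longrightarrow> y' \<in> carrier S \<Longrightarrow>
        rel x y \<Longrightarrow> rel x' y' \<Longrightarrow> rel (x \<oplus>\<^bsub>R\<^esub> x') (y \<oplus>\<^bsub>S\<^esub> y')"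
      "rel \<one>\<^bsub>R\<^esub> \<one>\<^bsub>S\<^esub>"
      "\<And>c x y. x \<in> carrier R \<Longrightarrow> y \<in> carrier S \<Longrightarrow> rel x y \<Longrightarrow> rel (c \<odot>\<^bsub>R\<^esub> x) (c \<odot>\<^bsub>S\<^esub> y)"
  shows "\<exists>\<psi>. \<psi> \<in> algebra_iso R S"
proof -
  have "\<forall>x\<in>carrier R. \<exists>y. y \<in> carrier S \<and> rel x y"
    using total(1) by blast
  then obtain \<psi> where "\<forall>x\<in>carrier R. \<psi> x \<in> carrier S \<and> rel x (\<psi> x)"
    by (rule bchoice[THEN exE])
  then have \<psi>: "\<psi> x \<in> carrier S" "rel x (\<psi> x)" if "x \<in> carrier R" for x
    using that by auto
  have "bij_betw \<psi> (carrier R) (carrier S)"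
  proof (rule bij_betw_imageI)
    show "inj_on \<psi> (carrier R)"
      using \<psi> unique(2) by (metis inj_onI)
    show "\<psi> ` carrier R = carrier S"
      using \<psi> unique(1) total(2) by (metis (no_types, opaque_lifting) image_eqI image_subsetI subsetI subset_antisym)
  qed
  moreover have "\<psi> \<in> Ring.ring_hom R S"
  proof (rule ring_hom_memI)
    fix x x' assume x: "x \<in> carrier R" "x' \<in> carrier R"
    show "\<psi> (x \<otimes>\<^bsub>R\<^esub> x') = \<psi> x \<otimes>\<^bsub>S\<^esub> \<psi> x'"
      by (rule unique(1)[of "x \<otimes>\<^bsub>R\<^esub> x'"]) (intro R S \<psi> ops x)+
    show "\<psi> (x \<oplus>\<^bsub>R\<^esub> x') = \<psi> x \<oplus>\<^bsub>S\<^esub> \<psi> x'"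
      by (rule unique(1)[of "x \<oplus>\<^bsub>R\<^esub> x'"]) (intro R S \<psi> ops x)+
  next
    show "\<psi> \<one>\<^bsub>R\<^esub> = \<one>\<^bsub>S\<^esub>"
      by (rule unique(1)[of "\<one>\<^bsub>R\<^esub>"]) (intro R S \<psi> ops)+
  qed (rule \<psi>)
  moreover have "\<psi> (c \<odot>\<^bsub>R\<^esub> x) = c \<odot>\<^bsub>S\<^esub> \<psi> x" if "x \<in> carrier R" for c x
    by (rule unique(1)[of "c \<odot>\<^bsub>R\<^esub> x"]) (intro R S \<psi> ops that)+
  ultimately show ?thesis
    by (auto simp: algebra_iso_def ring_iso_def)
qed

text \<open>
  Two elements correspond if they have the same coordinates. Existence of partners comes from the
  finiteness of supports, and multiplicativity from the common rule \<open>cell_mult\<close>.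
\<close>
lemma (in gentle_repetition) repetition_iso_triangular:
  "\<exists>\<psi>. \<psi> \<in> algebra_iso (repetition_algebra Q I sg tu Ibl k) (triangular_algebra Q I k)"
  unfolding repetition_algebra_eq
proof (rule algebra_iso_of_relation[where rel = "\<lambda>X S. \<forall>c\<in>Cells. rep_coef X c = tri_coef S c"])
  fix X assume "X \<in> carrier rep.A"
  from tri_exists[OF finite_rep_support[OF this]]
  show "\<exists>S\<in>carrier Tri. \<forall>c\<in>Cells. rep_coef X c = tri_coef S c"
    by metis
next
  fix S assume "S \<in> carrier Tri"
  from rep_exists[OF finite_tri_support[OF this]]
  show "\<exists>X\<in>carrier rep.A. \<forall>c\<in>Cells. rep_coef X c = tri_coef S c" .
next
  fix X S S' assume "S \<in> carrier Tri" "S' \<in> carrier Tri"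
    "\<forall>c\<in>Cells. rep_coef X c = tri_coef S c" "\<forall>c\<in>Cells. rep_coef X c = tri_coef S' c"
  then show "S = S'"
    by (intro tri_coef_eqI) auto
next
  fix X X' S assume "X \<in> carrier rep.A" "X' \<in> carrier rep.A"
    "\<forall>c\<in>Cells. rep_coef X c = tri_coef S c" "\<forall>c\<in>Cells. rep_coef X' c = tri_coef S c"
  then show "X = X'"
    by (intro rep_coef_eqI) auto
next
  fix X X' S S'
  assume mem: "X \<in> carrier rep.A" "X' \<in> carrier rep.A" "S \<in> carrier Tri" "S' \<in> carrier Tri"
    and rel: "\<forall>c\<in>Cells. rep_coef X c = tri_coef S c" "\<forall>c\<in>Cells. rep_coef X' c = tri_coef S' c"
  show "\<forall>c\<in>Cells. rep_coef (X \<otimes>\<^bsub>rep.A\<^esub> X') c = tri_coef (S \<otimes>\<^bsub>Tri\<^esub> S') c"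
  proof
    fix c assume c: "c \<in> Cells"
    have "rep_coef (X \<otimes>\<^bsub>rep.A\<^esub> X') c = cell_mult (rep_coef X) (rep_coef X') c"
      by (rule rep_coef_mult[OF mem(1,2) c])
    also have "\<dots> = cell_mult (tri_coef S) (tri_coef S') c"
      by (rule cell_mult_cong) (use rel c in auto)
    also have "\<dots> = tri_coef (S \<otimes>\<^bsub>Tri\<^esub> S') c"
      by (rule tri_coef_mult[OF mem(3,4) c, symmetric])
    finally show "rep_coef (X \<otimes>\<^bsub>rep.A\<^esub> X') c = tri_coef (S \<otimes>\<^bsub>Tri\<^esub> S') c" .
  qed
  show "\<forall>c\<in>Cells. rep_coef (X \<oplus>\<^bsub>rep.A\<^esub> X') c = tri_coef (S \<oplus>\<^bsub>Tri\<^esub> S') c"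
    using mem rel by (simp add: rep_coef_add tri_coef_add)
next
  fix a X S assume "X \<in> carrier rep.A" "S \<in> carrier Tri" "\<forall>c\<in>Cells. rep_coef X c = tri_coef S c"
  then show "\<forall>c\<in>Cells. rep_coef (a \<odot>\<^bsub>rep.A\<^esub> X) c = tri_coef (a \<odot>\<^bsub>Tri\<^esub> S) c"
    by (simp add: rep_coef_smult tri_coef_smult)
qed (intro rep.coef_mult(1) rep.coef_add(1) rep.coef_one(1) rep.coef_smult(1) Tri_closed ballI coef_one_agree; assumption)+

theorem proposition7p4:
  fixes Q :: "('v, 'a) pre_digraph"
    and I :: "(('v, 'a) path \<Rightarrow>\<^sub>0 'k::alg_closed_field) set"
    and sg tu :: "nat \<Rightarrow> 'v"
    and Ibl :: "(('v blossom_vertex, 'a blossom_arrow) path \<Rightarrow>\<^sub>0 'k) set"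
    and k :: nat
  assumes "locally_gentle Q I"
    and "Digraph_Component.connected Q"
    and "arcs Q \<noteq> {}"
    and "blossom_number Q > 0"
    and "blossoming Q I sg tu Ibl"
    and "k > 0"
  shows "\<exists>\<psi>. \<psi> \<in> algebra_iso (repetition_algebra Q I sg tu Ibl k) (triangular_algebra Q I k)"
proof -
  interpret gentle_repetition Q I sg tu Ibl k
    using assms by unfold_locales
  show ?thesis
    by (rule repetition_iso_triangular)
qed

end
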